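(* Let $\Theta(z)=\exp\left(\frac{z+1}{z-1}\right)$ be the atomic inner function and let $S_\Theta$ be the compressed shift on the model space $\mathcal{K}_\Theta$. For $A\in\mathcal{B}(\mathcal{K}_\Theta)$ the following are equivalent. (i) $A^2=S_\Theta$. (ii) $A=A_\psi$ for some $\psi\in H^\infty$ such that $\psi^2=z+\Theta h$ for some $h\in H^\infty$. Furthermore, $S_\Theta$ has exactly two square roots, i.e. there are exactly two operators $A\in\mathcal{B}(\mathcal{K}_\Theta)$ with $A^2=S_\Theta$.
   Context: $H^2$ and $H^\infty$ are the usual Hardy spaces of the open unit disc $\mathbb{D}$; $\mathcal{B}(\mathcal{H})$ denotes the bounded linear operators on a Hilbert space $\mathcal{H}$. $\mathcal{K}_\Theta=H^2\cap(\Theta H^2)^\perp$, regarded via radial boundary values as a closed subspace of $L^2(\mathbb{T})$, and $P_\Theta$ is the orthogonal projection of $L^2(\mathbb{T})$ onto $\mathcal{K}_\Theta$. With $(Sf)(z)=zf(z)$ the unilateral shift on $H^2$, the compressed shift is $S_\Theta=P_\Theta S|_{\mathcal{K}_\Theta}$. For $\psi\in H^\infty$, $A_\psi$ is the operator on $\mathcal{K}_\Theta$ given by $A_\psi f=P_\Theta(\psi f)$. *)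

theory Defs
  imports "HOL-Complex_Analysis.Complex_Analysis"
begin

text \<open>Normalised arc length on the unit circle, as a Borel measure on the plane.\<close>

definition circle_measure :: "complex measure" where
  "circle_measure = distr (uniform_measure lborel {0..2*pi}) borel cis"

text \<open>
  Elements of \<open>L\<^sup>2\<close> of the circle are represented by functions, which are not identified
  when they agree almost everywhere. They are Borel functions on the plane, but integrals, and hence
  inner products and norms, depend only on their values on the unit circle.
\<close>

definition L2_circle :: "(complex \<Rightarrow> complex) set" where
  "L2_circle = {u \<in> borel_measurable circle_measure.
                  integrable circle_measure (\<lambda>\<zeta>. (cmod (u \<zeta>))\<^sup>2)}"

definition L2_inner :: "(complex \<Rightarrow> complex) \<Rightarrow> (complex \<Rightarrow> complex) \<Rightarrow> complex" where
  "L2_inner u v = (\<integral>\<zeta>. u \<zeta> * cnj (v \<zeta>) \<partial>circle_measure)"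

definition L2_norm :: "(complex \<Rightarrow> complex) \<Rightarrow> real" where
  "L2_norm u = sqrt (\<integral>\<zeta>. (cmod (u \<zeta>))\<^sup>2 \<partial>circle_measure)"

text \<open>
  The normalisation \<open>f z = 0\<close> off the open disc makes equality of functions coincide with
  equality on the disc, so that functions in \<open>H2\<close> are the elements of the Hardy space.
\<close>

definition H2 :: "(complex \<Rightarrow> complex) set" where
  "H2 = {f. f holomorphic_on ball 0 1 \<and> (\<forall>z. z \<notin> ball 0 1 \<longrightarrow> f z = 0) \<and>
            bdd_above ((\<lambda>r::real. \<integral>\<zeta>. (cmod (f (of_real r * \<zeta>)))\<^sup>2 \<partial>circle_measure) ` {0..<1})}"

text \<open>Values off the disc are not normalised here, and nothing below depends on them.\<close>

definition Hinf :: "(complex \<Rightarrow> complex) set" where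
  "Hinf = {\<psi>. \<psi> holomorphic_on ball 0 1 \<and> bounded (\<psi> ` ball 0 1)}"

text \<open>Radial limits; the value is unspecified where the limit does not exist.\<close>

definition radial_bv :: "(complex \<Rightarrow> complex) \<Rightarrow> complex \<Rightarrow> complex" where
  "radial_bv f \<zeta> = Lim (at_left 1) (\<lambda>r::real. f (of_real r * \<zeta>))"

definition model_space :: "(complex \<Rightarrow> complex) \<Rightarrow> (complex \<Rightarrow> complex) set" where
  "model_space \<Theta> =
     {f \<in> H2. \<forall>g\<in>H2. L2_inner (radial_bv f) (radial_bv (\<lambda>z. \<Theta> z * g z)) = 0}"

text \<open>
  The orthogonal projection of \<open>L\<^sup>2\<close> of the circle onto the model space, with values given as
  functions on the disc.
\<close>

definition model_proj ::
    "(complex \<Rightarrow> complex) \<Rightarrow> (complex \<Rightarrow> complex) \<Rightarrow> (complex \<Rightarrow> complex)" where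
  "model_proj \<Theta> = (\<lambda>u\<in>L2_circle. THE k. k \<in> model_space \<Theta> \<and>
     (\<forall>g\<in>model_space \<Theta>. L2_inner (\<lambda>\<zeta>. u \<zeta> - radial_bv k \<zeta>) (radial_bv g) = 0))"

text \<open>
  Bounded complex-linear operators on the model space, as functions that are extensional on it
  (\<open>undefined\<close> outside), so that equality of functions is equality of operators.
\<close>

definition bounded_ops ::
    "(complex \<Rightarrow> complex) \<Rightarrow> ((complex \<Rightarrow> complex) \<Rightarrow> (complex \<Rightarrow> complex)) set" where
  "bounded_ops \<Theta> = {A \<in> model_space \<Theta> \<rightarrow>\<^sub>E model_space \<Theta>.
     (\<forall>f\<in>model_space \<Theta>. \<forall>g\<in>model_space \<Theta>. A (\<lambda>z. f z + g z) = (\<lambda>z. A f z + A g z)) \<and>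
     (\<forall>c. \<forall>f\<in>model_space \<Theta>. A (\<lambda>z. c * f z) = (\<lambda>z. c * A f z)) \<and>
     (\<exists>C. \<forall>f\<in>model_space \<Theta>. L2_norm (radial_bv (A f)) \<le> C * L2_norm (radial_bv f))}"

definition unilateral_shift :: "(complex \<Rightarrow> complex) \<Rightarrow> (complex \<Rightarrow> complex)" where
  "unilateral_shift f = (\<lambda>z. z * f z)"

definition compressed_shift ::
    "(complex \<Rightarrow> complex) \<Rightarrow> (complex \<Rightarrow> complex) \<Rightarrow> (complex \<Rightarrow> complex)" where
  "compressed_shift \<Theta> =
     (\<lambda>f\<in>model_space \<Theta>. model_proj \<Theta> (radial_bv (unilateral_shift f)))"

definition model_mult ::
    "(complex \<Rightarrow> complex) \<Rightarrow> (complex \<Rightarrow> complex) \<Rightarrow> (complex \<Rightarrow> complex) \<Rightarrow> (complex \<Rightarrow> complex)" where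
  "model_mult \<Theta> \<psi> =
     (\<lambda>f\<in>model_space \<Theta>. model_proj \<Theta> (radial_bv (\<lambda>z. \<psi> z * f z)))"

definition atomic_inner :: "complex \<Rightarrow> complex" where
  "atomic_inner z = exp ((z + 1) / (z - 1))"

end

theory Submission
  imports Defs
begin

text \<open>
  Existence: in the half-plane variable \<open>w = (1 + z) / (1 - z)\<close>, where \<open>\<Theta> = exp (- w)\<close>, the function
  \<open>z + \<Theta> (1 - z) / 2\<close> equals \<open>(w - 1 + exp (- w)) / (w + 1)\<close>. It has no zeros in the disc, so it has a
  square root \<open>\<psi>\<close> there, and \<open>A\<^sub>\<psi>\<close> and \<open>- A\<^sub>\<psi>\<close> are square roots of the compressed shift.

  Uniqueness: let \<open>A\<close> be a square root, \<open>k\<^sub>0\<close> the projection of \<open>1\<close>, and \<open>a = A k\<^sub>0\<close>. Since \<open>A\<close> commutes with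
  the compressed shift, \<open>A\<close> maps the projection of a polynomial \<open>p\<close> to the projection of \<open>p a\<close>. Hence \<open>a\<close>
  determines \<open>A\<close>, and \<open>a\<^sup>2 - z\<close> is divisible by \<open>\<Theta>\<close> in the sense that
  \<open>\<bar>a(x)\<^sup>2 - x\<bar> \<le> C \<Theta>(x) / (1 - x)\<close> on the radius ending at \<open>1\<close>, where \<open>\<Theta>\<close> decays exponentially. For two
  square roots \<open>A\<close>, \<open>B\<close> it follows that, for one choice of the sign, \<open>f = a \<plusminus> b\<close> satisfies
  \<open>\<bar>f(x)\<bar> \<le> C \<Theta>(x) / (1 - x)\<close> near \<open>1\<close>. The moments \<open>F(t) = \<langle>f, \<Theta>\<^sup>t\<rangle>\<close> vanish at \<open>t = 1\<close>, and \<open>f\<close> on the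
  radius is expressed through \<open>F(0)\<close> and the Laplace transform of \<open>F\<close> over \<open>[0, 1]\<close>; by Mikusinski's
  lemma such fast decay forces \<open>F(t) = F(0) exp t\<close> on \<open>[0, 1]\<close>, hence \<open>F = 0\<close> and \<open>f = 0\<close>.

  The boundary values that enter the definitions exist by Fatou's theorem, which for \<open>H\<^sup>2\<close> follows from an
  \<open>L\<^sup>2\<close> bound for the radial maximal function.
\<close>

section \<open>The circle and its square integrable functions\<close>

text \<open>A bounded symbol for an arbitrary root \<open>A\<close> would have to come from
  commutant lifting. Instead everything is done with \<open>a = A k\<^sub>0\<close>, which is only
  known to lie in \<open>H2\<close>: the estimate of \<open>a\<^sup>2 - z\<close> asks for an L1
  bound alone, and (i) implies (ii) falls out of the count, because two roots with explicit symbols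
  are built and no third one exists. One radius suffices for uniqueness because, with
  \<open>x = (X - 1) / (X + 1)\<close>, one has \<open>\<Theta>(x) = exp (- X)\<close>. This is the
  size at \<open>X\<close> of a Laplace transform concentrated at the far end \<open>t = 1\<close>
  of \<open>[0, 1]\<close>, so a continuous function on \<open>[0, 1]\<close> with so small a
  transform for all large \<open>X\<close> has to vanish. The multiple of exp t arises from the
  constant \<open>F(0)\<close> in the formula for \<open>f\<close>: over the whole half-line
  \<open>X - 1\<close> times the transform of exp t is 1, and cutting at \<open>t = 1\<close> costs
  \<open>exp (1 - X)\<close>, again of the admissible order. Orthogonality to
  \<open>\<Theta>\<close>, in the form \<open>F(1) = 0\<close>, then forces the multiple to be
  0.\<close>

lemma sets_circle_measure [simp, measurable_cong]: "sets circle_measure = sets borel"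
  by (simp add: circle_measure_def)

lemma space_circle_measure [simp]: "space circle_measure = UNIV"
  by (simp add: circle_measure_def)

lemma borel_measurable_circle_measure [simp]:
  "borel_measurable circle_measure = borel_measurable borel"
  by (intro measurable_cong_sets) simp_all

lemma cis_measurable [measurable]: "cis \<in> borel_measurable borel"
  by (intro borel_measurable_continuous_onI continuous_intros)

lemma cnj_measurable [measurable]: "cnj \<in> borel_measurable borel"
  by (intro borel_measurable_continuous_onI continuous_intros)

lemma emeasure_circle_measure_UNIV: "emeasure circle_measure UNIV = 1"
proof -
  have "emeasure circle_measure UNIV = emeasure (uniform_measure lborel {0..2*pi}) UNIV"
    unfolding circle_measure_def by (subst emeasure_distr) auto
  also have "\<dots> = 1"
    by (subst emeasure_uniform_measure) (auto simp: divide_ennreal)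
  finally show ?thesis .
qed

lemma measure_circle_measure_UNIV [simp]: "measure circle_measure UNIV = 1"
  by (simp add: measure_def emeasure_circle_measure_UNIV)

interpretation circle: finite_measure circle_measure
  by (rule finite_measureI) (simp add: emeasure_circle_measure_UNIV)


lemma AE_circle_measureI:
  assumes "{\<zeta>. P \<zeta>} \<in> sets borel" and "AE t in lborel. P (cis t)"
  shows "AE \<zeta> in circle_measure. P \<zeta>"
proof -
  have "AE t in uniform_measure lborel {0..2*pi}. P (cis t)"
    using assms(2) by (intro AE_uniform_measureI) auto
  then show ?thesis
    unfolding circle_measure_def using assms(1) by (subst AE_distr_iff) auto
qed

lemma AE_circle_norm: "AE \<zeta> in circle_measure. cmod \<zeta> = 1"
  by (rule AE_circle_measureI) auto

text \<open>The atomic inner function has its only boundary singularity at 1. As this point is null,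
  boundary identities may be checked on the rest of the circle.\<close>

lemma AE_circle_neq_1: "AE \<zeta> in circle_measure. \<zeta> \<noteq> 1"
proof (rule AE_circle_measureI)
  have "{t. cis t = 1} \<subseteq> range (\<lambda>n::int. n * 2 * pi)"
    by (auto simp: complex_eq_iff cos_one_2pi_int)
  then have "countable {t. cis t = 1}"
    by (rule countable_subset) auto
  then have "AE t in lborel. t \<notin> {t. cis t = 1}"
    by (intro AE_not_in countable_imp_null_set_lborel)
  then show "AE t in lborel. cis t \<noteq> 1" by simp
qed auto

lemma integral_circle_cis:
  fixes u :: "complex \<Rightarrow> complex"
  assumes "u \<in> borel_measurable borel"
  shows "(\<integral>\<zeta>. u \<zeta> \<partial>circle_measure) = (LBINT t:{0..2*pi}. u (cis t)) / (2 * pi)"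
proof -
  have "(\<integral>\<zeta>. u \<zeta> \<partial>circle_measure) = (\<integral>t. u (cis t) \<partial>uniform_measure lborel {0..2*pi})"
    unfolding circle_measure_def using assms by (subst integral_distr) auto
  also have "uniform_measure lborel {0..2*pi} = density lborel (\<lambda>t. ennreal (indicator {0..2*pi} t / (2*pi)))"
    unfolding uniform_measure_def
    by (intro density_cong) (auto simp: indicator_def divide_ennreal[symmetric])
  also have "(\<integral>t. u (cis t) \<partial>density lborel (\<lambda>t. ennreal (indicator {0..2*pi} t / (2*pi)))) =
      (\<integral>t. (indicator {0..2*pi} t / (2*pi)) *\<^sub>R u (cis t) \<partial>lborel)"
    using assms by (intro integral_density) auto
  also have "\<dots> = (\<integral>t. (indicator {0..2*pi} t *\<^sub>R u (cis t)) / (2*pi) \<partial>lborel)"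
    by (intro Bochner_Integration.integral_cong) (auto simp: scaleR_conv_of_real)
  also have "\<dots> = (LBINT t:{0..2*pi}. u (cis t)) / (2 * pi)"
    by (simp add: set_lebesgue_integral_def)
  finally show ?thesis .
qed

lemma integral_circle_zpower:
  assumes "k \<noteq> (0::int)"
  shows "(LBINT t:{0..2*pi}. cis (real_of_int k * t)) = 0"
proof -
  have "((\<lambda>t. cis (k * t)) has_integral (cis (real_of_int k * (2*pi)) / (\<i> * k) - cis (real_of_int k * 0) / (\<i> * k))) {0..2*pi}"
  proof (rule fundamental_theorem_of_calculus[where f = "\<lambda>t. cis (real_of_int k * t) / (\<i> * k)"])
    fix t :: real assume "t \<in> {0..2*pi}"
    have "((\<lambda>z. exp (c * z) / c) has_field_derivative exp (c * t)) (at (of_real t))" if "c \<noteq> 0" for c :: complex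
      using that by (auto intro!: derivative_eq_intros)
    from this[of "\<i> * k"] assms
    have "((\<lambda>z. exp (\<i> * (k * z)) / (\<i> * k)) has_field_derivative exp (\<i> * (k * t))) (at (of_real t))"
      by (simp add: mult.assoc)
    from has_vector_derivative_real_field[OF this, of "{0..2*pi}"]
    show "((\<lambda>t. cis (k * t) / (\<i> * k)) has_vector_derivative cis (k * t)) (at t within {0..2*pi})"
      by (simp add: cis_conv_exp o_def)
  qed simp
  moreover have "cis (k * (2*pi)) = 1"
    by (metis cis_multiple_2pi Ints_of_int mult.assoc mult.commute)
  ultimately have *: "((\<lambda>t. cis (k * t)) has_integral 0) {0..2*pi}" by simp
  have "set_integrable lborel {0..2*pi} (\<lambda>t. cis (k * t))"
    by (intro borel_integrable_atLeastAtMost') (intro continuous_intros)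
  from set_borel_integral_eq_integral(2)[OF this] * show ?thesis
    by (simp add: integral_unique)
qed

lemma integral_circle_power:
  "(\<integral>\<zeta>. \<zeta> ^ m * cnj \<zeta> ^ n \<partial>circle_measure) = (if m = n then 1 else 0)"
proof -
  have "cis t ^ m * cnj (cis t) ^ n = cis (real_of_int (int m - int n) * t)" for t
    by (simp add: cis_cnj Complex.DeMoivre cis_mult left_diff_distrib)
  then have "(\<integral>\<zeta>. \<zeta> ^ m * cnj \<zeta> ^ n \<partial>circle_measure) =
      (LBINT t:{0..2*pi}. cis (real_of_int (int m - int n) * t)) / (2 * pi)"
    by (subst integral_circle_cis) auto
  then show ?thesis
    using integral_circle_zpower[of "int m - int n"]
    by (cases "m = n") (auto simp: set_lebesgue_integral_def scaleR_conv_of_real)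
qed

section \<open>Closure properties of L2 of the circle, inner product and norm\<close>

lemma mem_L2_circle:
  "u \<in> L2_circle \<longleftrightarrow> u \<in> borel_measurable borel \<and> integrable circle_measure (\<lambda>\<zeta>. (cmod (u \<zeta>))\<^sup>2)"
  by (simp add: L2_circle_def)

lemma L2_circle_measurable [measurable_dest]: "u \<in> L2_circle \<Longrightarrow> u \<in> borel_measurable borel"
  by (simp add: mem_L2_circle)

lemma L2_circle_norm_mult_integrable:
  assumes "u \<in> L2_circle" "v \<in> L2_circle"
  shows "integrable circle_measure (\<lambda>\<zeta>. cmod (u \<zeta>) * cmod (v \<zeta>))"
proof (rule Bochner_Integration.integrable_bound)
  show "integrable circle_measure (\<lambda>\<zeta>. (cmod (u \<zeta>))\<^sup>2 + (cmod (v \<zeta>))\<^sup>2)"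
    using assms by (auto simp: mem_L2_circle)
  show "(\<lambda>\<zeta>. cmod (u \<zeta>) * cmod (v \<zeta>)) \<in> borel_measurable circle_measure"
    using assms by (auto simp: mem_L2_circle)
  have "a * b \<le> a\<^sup>2 + b\<^sup>2" if "0 \<le> a" "0 \<le> b" for a b :: real
    using sum_squares_bound[of a b] mult_nonneg_nonneg[OF that] by simp
  then show "AE \<zeta> in circle_measure. norm (cmod (u \<zeta>) * cmod (v \<zeta>)) \<le> norm ((cmod (u \<zeta>))\<^sup>2 + (cmod (v \<zeta>))\<^sup>2)"
    by auto
qed

lemma L2_circle_mult_integrable:
  assumes "u \<in> L2_circle" "v \<in> L2_circle"
  shows "integrable circle_measure (\<lambda>\<zeta>. u \<zeta> * cnj (v \<zeta>))"
proof (rule Bochner_Integration.integrable_bound[OF L2_circle_norm_mult_integrable[OF assms]])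
  show "(\<lambda>\<zeta>. u \<zeta> * cnj (v \<zeta>)) \<in> borel_measurable circle_measure"
    using assms by (auto simp: mem_L2_circle)
qed (auto simp: norm_mult)

lemma L2_circle_AE_bounded:
  assumes [measurable]: "u \<in> borel_measurable borel" and "AE \<zeta> in circle_measure. cmod (u \<zeta>) \<le> C"
  shows "u \<in> L2_circle"
  unfolding mem_L2_circle
proof
  show "integrable circle_measure (\<lambda>\<zeta>. (cmod (u \<zeta>))\<^sup>2)"
  proof (rule Bochner_Integration.integrable_bound)
    show "integrable circle_measure (\<lambda>\<zeta>. C\<^sup>2)" by simp
    show "AE \<zeta> in circle_measure. norm ((cmod (u \<zeta>))\<^sup>2) \<le> norm (C\<^sup>2)"
      using assms(2) by eventually_elim (auto intro: power_mono)
  qed auto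
qed fact

lemma L2_circle_bounded_mult:
  assumes [measurable]: "u \<in> borel_measurable borel" and "AE \<zeta> in circle_measure. cmod (u \<zeta>) \<le> C"
    and v: "v \<in> L2_circle"
  shows "(\<lambda>\<zeta>. u \<zeta> * v \<zeta>) \<in> L2_circle"
  unfolding mem_L2_circle
proof
  note [measurable] = L2_circle_measurable[OF v]
  show "(\<lambda>\<zeta>. u \<zeta> * v \<zeta>) \<in> borel_measurable borel" by simp
  show "integrable circle_measure (\<lambda>\<zeta>. (cmod (u \<zeta> * v \<zeta>))\<^sup>2)"
  proof (rule Bochner_Integration.integrable_bound)
    show "integrable circle_measure (\<lambda>\<zeta>. C\<^sup>2 * (cmod (v \<zeta>))\<^sup>2)" using v by (auto simp: mem_L2_circle)
    show "AE \<zeta> in circle_measure. norm ((cmod (u \<zeta> * v \<zeta>))\<^sup>2) \<le> norm (C\<^sup>2 * (cmod (v \<zeta>))\<^sup>2)"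
      using assms(2)
      by eventually_elim (auto simp: norm_mult power_mult_distrib intro!: mult_right_mono power_mono)
  qed auto
qed

lemma L2_circle_cnj: "u \<in> L2_circle \<Longrightarrow> (\<lambda>\<zeta>. cnj (u \<zeta>)) \<in> L2_circle"
  by (auto simp: mem_L2_circle)

lemma L2_circle_cmult: "u \<in> L2_circle \<Longrightarrow> (\<lambda>\<zeta>. c * u \<zeta>) \<in> L2_circle"
  by (rule L2_circle_bounded_mult[where C = "cmod c"]) auto

lemma L2_circle_add:
  assumes "u \<in> L2_circle" "v \<in> L2_circle"
  shows "(\<lambda>\<zeta>. u \<zeta> + v \<zeta>) \<in> L2_circle"
  unfolding mem_L2_circle
proof
  note [measurable] = L2_circle_measurable[OF assms(1)] L2_circle_measurable[OF assms(2)]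
  show "(\<lambda>\<zeta>. u \<zeta> + v \<zeta>) \<in> borel_measurable borel" by simp
  show "integrable circle_measure (\<lambda>\<zeta>. (cmod (u \<zeta> + v \<zeta>))\<^sup>2)"
  proof (rule Bochner_Integration.integrable_bound)
    show "integrable circle_measure (\<lambda>\<zeta>. (cmod (u \<zeta>))\<^sup>2 + (cmod (v \<zeta>))\<^sup>2 + 2 * (cmod (u \<zeta>) * cmod (v \<zeta>)))"
      using assms L2_circle_norm_mult_integrable[OF assms] by (auto simp: mem_L2_circle)
    have "(cmod (u \<zeta> + v \<zeta>))\<^sup>2 \<le> (cmod (u \<zeta>) + cmod (v \<zeta>))\<^sup>2" for \<zeta>
      by (intro power_mono norm_triangle_ineq) auto
    then show "AE \<zeta> in circle_measure. norm ((cmod (u \<zeta> + v \<zeta>))\<^sup>2) \<le>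
        norm ((cmod (u \<zeta>))\<^sup>2 + (cmod (v \<zeta>))\<^sup>2 + 2 * (cmod (u \<zeta>) * cmod (v \<zeta>)))"
      by (auto simp: power2_sum algebra_simps)
  qed auto
qed

lemma L2_circle_diff:
  assumes "u \<in> L2_circle" "v \<in> L2_circle"
  shows "(\<lambda>\<zeta>. u \<zeta> - v \<zeta>) \<in> L2_circle"
  using L2_circle_add[OF assms(1) L2_circle_cmult[OF assms(2), of "-1"]] by simp

lemma L2_circle_power: "(\<lambda>\<zeta>. \<zeta> ^ n) \<in> L2_circle"
proof (rule L2_circle_AE_bounded)
  show "AE \<zeta> in circle_measure. cmod (\<zeta> ^ n) \<le> 1"
    using AE_circle_norm by eventually_elim (simp add: norm_power)
qed auto

lemma L2_circle_sum:
  assumes "\<And>i. i \<in> I \<Longrightarrow> u i \<in> L2_circle"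
  shows "(\<lambda>\<zeta>. \<Sum>i\<in>I. u i \<zeta>) \<in> L2_circle"
  using assms
proof (induction I rule: infinite_finite_induct)
  case (insert i I)
  then show ?case by (simp add: L2_circle_add)
qed (auto intro: L2_circle_AE_bounded[where C = 0])

lemma L2_inner_add_left:
  assumes "u \<in> L2_circle" "v \<in> L2_circle" "w \<in> L2_circle"
  shows "L2_inner (\<lambda>\<zeta>. u \<zeta> + v \<zeta>) w = L2_inner u w + L2_inner v w"
  using assms by (simp add: L2_inner_def distrib_right L2_circle_mult_integrable)

lemma L2_inner_diff_left:
  assumes "u \<in> L2_circle" "v \<in> L2_circle" "w \<in> L2_circle"
  shows "L2_inner (\<lambda>\<zeta>. u \<zeta> - v \<zeta>) w = L2_inner u w - L2_inner v w"
  using assms by (simp add: L2_inner_def left_diff_distrib L2_circle_mult_integrable)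

lemma L2_inner_cmult_left: "L2_inner (\<lambda>\<zeta>. c * u \<zeta>) w = c * L2_inner u w"
  by (simp add: L2_inner_def mult.assoc)

lemma L2_inner_commute: "L2_inner u v = cnj (L2_inner v u)"
  by (simp add: L2_inner_def Bochner_Integration.integral_cnj[symmetric] mult.commute del: Bochner_Integration.integral_cnj)

lemma L2_inner_sum_left:
  assumes "\<And>i. i \<in> I \<Longrightarrow> u i \<in> L2_circle" "w \<in> L2_circle"
  shows "L2_inner (\<lambda>\<zeta>. \<Sum>i\<in>I. u i \<zeta>) w = (\<Sum>i\<in>I. L2_inner (u i) w)"
  using assms by (simp add: L2_inner_def sum_distrib_right L2_circle_mult_integrable)

lemma L2_inner_cong_AE:
  assumes "u \<in> borel_measurable borel" "v \<in> borel_measurable borel"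
    "u' \<in> borel_measurable borel" "v' \<in> borel_measurable borel"
    "AE \<zeta> in circle_measure. u \<zeta> = u' \<zeta>" "AE \<zeta> in circle_measure. v \<zeta> = v' \<zeta>"
  shows "L2_inner u v = L2_inner u' v'"
  unfolding L2_inner_def
proof (rule integral_cong_AE)
  show "AE \<zeta> in circle_measure. u \<zeta> * cnj (v \<zeta>) = u' \<zeta> * cnj (v' \<zeta>)"
    using assms(5,6) by eventually_elim simp
qed (use assms(1-4) in simp_all)

lemma L2_norm_nonneg [simp]: "L2_norm u \<ge> 0"
  by (simp add: L2_norm_def)

lemma L2_norm_square: "(L2_norm u)\<^sup>2 = (\<integral>\<zeta>. (cmod (u \<zeta>))\<^sup>2 \<partial>circle_measure)"
  by (simp add: L2_norm_def)

lemma L2_inner_self: "L2_inner u u = of_real ((L2_norm u)\<^sup>2)"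
  unfolding L2_norm_square L2_inner_def
  by (simp add: complex_norm_square[symmetric] integral_complex_of_real[symmetric] del: integral_complex_of_real)

lemma L2_norm_cmult: "L2_norm (\<lambda>\<zeta>. c * u \<zeta>) = cmod c * L2_norm u"
  by (simp add: L2_norm_def norm_mult power_mult_distrib real_sqrt_mult)

lemma L2_norm_mult_le:
  assumes "u \<in> L2_circle" "v \<in> L2_circle"
  shows "(\<integral>\<zeta>. cmod (u \<zeta>) * cmod (v \<zeta>) \<partial>circle_measure) \<le> L2_norm u * L2_norm v"
proof -
  define A B C where "A = (L2_norm u)\<^sup>2" and "B = (\<integral>\<zeta>. cmod (u \<zeta>) * cmod (v \<zeta>) \<partial>circle_measure)"
    and "C = (L2_norm v)\<^sup>2"
  \<comment> \<open>The polynomial in \<open>t\<close> is the integral of a square. Its value at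
    \<open>t = B / A\<close> gives the claim for positive \<open>A\<close>; for \<open>A = 0\<close>
    it is linear, and \<open>t = (C + 1) / (2 * B)\<close> would make it equal to -1.\<close>
  have quad: "0 \<le> t\<^sup>2 * A - 2 * t * B + C" for t
  proof -
    have "0 \<le> (\<integral>\<zeta>. (t * cmod (u \<zeta>) - cmod (v \<zeta>))\<^sup>2 \<partial>circle_measure)" by simp
    also have "\<dots> = (\<integral>\<zeta>. t\<^sup>2 * (cmod (u \<zeta>))\<^sup>2 - 2 * t * (cmod (u \<zeta>) * cmod (v \<zeta>)) + (cmod (v \<zeta>))\<^sup>2 \<partial>circle_measure)"
      by (simp add: power2_diff power_mult_distrib algebra_simps)
    also have "\<dots> = t\<^sup>2 * A - 2 * t * B + C"
      using assms L2_circle_norm_mult_integrable[OF assms]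
      by (simp add: A_def B_def C_def L2_norm_square mem_L2_circle)
    finally show ?thesis .
  qed
  have "B\<^sup>2 \<le> A * C"
  proof (cases "A = 0")
    case True
    have "B = 0"
    proof (rule ccontr)
      assume "B \<noteq> 0"
      with quad[of "(C + 1) / (2 * B)"] True show False by (simp add: field_simps)
    qed
    then show ?thesis using True by simp
  next
    case False
    then have "A > 0" by (simp add: A_def)
    with quad[of "B / A"] show ?thesis by (simp add: field_simps power2_eq_square)
  qed
  then show ?thesis
    unfolding B_def[symmetric] by (auto simp: A_def C_def power_mult_distrib[symmetric] intro: power2_le_imp_le)
qed

lemma cmod_L2_inner_le:
  assumes "u \<in> L2_circle" "v \<in> L2_circle"
  shows "cmod (L2_inner u v) \<le> L2_norm u * L2_norm v"
proof -
  have "cmod (L2_inner u v) \<le> (\<integral>\<zeta>. cmod (u \<zeta> * cnj (v \<zeta>)) \<partial>circle_measure)"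
    unfolding L2_inner_def by (rule integral_norm_bound)
  also have "\<dots> \<le> L2_norm u * L2_norm v"
    using L2_norm_mult_le[OF assms] by (simp add: norm_mult)
  finally show ?thesis .
qed

lemma L2_norm_mono_AE:
  assumes "u \<in> borel_measurable borel" "v \<in> L2_circle"
    and "AE \<zeta> in circle_measure. cmod (u \<zeta>) \<le> cmod (v \<zeta>)"
  shows "L2_norm u \<le> L2_norm v"
  unfolding L2_norm_def
proof (intro real_sqrt_le_mono integral_mono_AE')
  show "AE \<zeta> in circle_measure. (cmod (u \<zeta>))\<^sup>2 \<le> (cmod (v \<zeta>))\<^sup>2"
    using assms(3) by eventually_elim (auto intro: power_mono)
qed (use assms in \<open>auto simp: mem_L2_circle\<close>)

lemma L2_norm_cong_AE:
  assumes "u \<in> L2_circle" "v \<in> L2_circle" "AE \<zeta> in circle_measure. u \<zeta> = v \<zeta>"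
  shows "L2_norm u = L2_norm v"
  using assms(3) by (intro antisym L2_norm_mono_AE) (use assms in \<open>auto simp: mem_L2_circle\<close>)

section \<open>Fourier coefficients of nonnegative index and Bessel's inequality\<close>

definition fourier_coeff :: "(complex \<Rightarrow> complex) \<Rightarrow> nat \<Rightarrow> complex" where
  "fourier_coeff u n = L2_inner u (\<lambda>\<zeta>. \<zeta> ^ n)"

lemma fourier_coeff_alt: "fourier_coeff u n = (\<integral>\<zeta>. u \<zeta> * cnj \<zeta> ^ n \<partial>circle_measure)"
  by (simp add: fourier_coeff_def L2_inner_def)

text \<open>Pythagoras for the projection onto the monomials with exponent in \<open>I\<close>. The
  left side being nonnegative gives Bessel's inequality; for polynomials it is 0, which gives
  Parseval's identity.\<close>

lemma L2_norm_square_diff_power_sum: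
  assumes u: "u \<in> L2_circle" and I: "finite I"
  shows "(L2_norm (\<lambda>\<zeta>. u \<zeta> - (\<Sum>n\<in>I. fourier_coeff u n * \<zeta> ^ n)))\<^sup>2 =
    (L2_norm u)\<^sup>2 - (\<Sum>n\<in>I. (cmod (fourier_coeff u n))\<^sup>2)"
proof -
  define p where "p = (\<lambda>\<zeta>::complex. \<Sum>n\<in>I. fourier_coeff u n * \<zeta> ^ n)"
  have p: "p \<in> L2_circle"
    unfolding p_def by (intro L2_circle_sum L2_circle_cmult L2_circle_power)
  have inner_p: "L2_inner p w = (\<Sum>n\<in>I. fourier_coeff u n * L2_inner (\<lambda>\<zeta>. \<zeta> ^ n) w)" if "w \<in> L2_circle" for w
    unfolding p_def using that
    by (subst L2_inner_sum_left) (auto intro: L2_circle_cmult L2_circle_power simp: L2_inner_cmult_left)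
  define S where "S = complex_of_real (\<Sum>n\<in>I. (cmod (fourier_coeff u n))\<^sup>2)"
  have pu: "L2_inner p u = S"
    by (subst inner_p[OF u], subst L2_inner_commute)
      (simp add: S_def fourier_coeff_def complex_norm_square[symmetric])
  have up: "L2_inner u p = S"
    by (subst L2_inner_commute, subst pu) (simp add: S_def)
  have pn: "L2_inner p (\<lambda>\<zeta>. \<zeta> ^ n) = (if n \<in> I then fourier_coeff u n else 0)" for n
    using I by (subst inner_p[OF L2_circle_power])
      (simp add: L2_inner_def integral_circle_power if_distrib[of "(*) _"] sum.delta' cong: if_cong)
  have pp: "L2_inner p p = S"
  proof -
    have "L2_inner p p = (\<Sum>n\<in>I. fourier_coeff u n * cnj (L2_inner p (\<lambda>\<zeta>. \<zeta> ^ n)))"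
      by (subst inner_p[OF p], subst L2_inner_commute) simp
    also have "\<dots> = S" by (simp add: pn S_def complex_norm_square[symmetric])
    finally show ?thesis .
  qed
  have d: "(\<lambda>\<zeta>. u \<zeta> - p \<zeta>) \<in> L2_circle" using u p by (rule L2_circle_diff)
  have "complex_of_real ((L2_norm (\<lambda>\<zeta>. u \<zeta> - p \<zeta>))\<^sup>2) = L2_inner (\<lambda>\<zeta>. u \<zeta> - p \<zeta>) (\<lambda>\<zeta>. u \<zeta> - p \<zeta>)"
    by (simp only: L2_inner_self)
  also have "\<dots> = L2_inner u (\<lambda>\<zeta>. u \<zeta> - p \<zeta>) - L2_inner p (\<lambda>\<zeta>. u \<zeta> - p \<zeta>)"
    by (rule L2_inner_diff_left) fact+
  also have "\<dots> = cnj (L2_inner u u - L2_inner p u) - cnj (L2_inner u p - L2_inner p p)"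
    using L2_inner_diff_left[OF u p u] L2_inner_diff_left[OF u p p] L2_inner_commute by metis
  also have "\<dots> = of_real ((L2_norm u)\<^sup>2) - S"
    by (simp add: pu up pp L2_inner_self[of u] S_def)
  also have "\<dots> = of_real ((L2_norm u)\<^sup>2 - (\<Sum>n\<in>I. (cmod (fourier_coeff u n))\<^sup>2))"
    by (simp add: S_def)
  finally show ?thesis unfolding p_def of_real_eq_iff .
qed

lemma bessel:
  assumes "u \<in> L2_circle" "finite I"
  shows "(\<Sum>n\<in>I. (cmod (fourier_coeff u n))\<^sup>2) \<le> (L2_norm u)\<^sup>2"
  using L2_norm_square_diff_power_sum[OF assms] by (smt (verit) zero_le_power2)

lemma bessel_summable:
  assumes "u \<in> L2_circle"
  shows "summable (\<lambda>n. (cmod (fourier_coeff u n))\<^sup>2)"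
  using bessel[OF assms]
  by (intro summableI_nonneg_bounded[where x = "(L2_norm u)\<^sup>2"]) auto

lemma fourier_coeff_power_sum:
  "finite I \<Longrightarrow> fourier_coeff (\<lambda>\<zeta>. \<Sum>n\<in>I. a n * \<zeta> ^ n) k = (if k \<in> I then a k else 0)"
  unfolding fourier_coeff_def
  by (subst L2_inner_sum_left) (auto intro: L2_circle_cmult L2_circle_power
      simp: L2_inner_cmult_left L2_inner_def integral_circle_power if_distrib[of "(*) _"] sum.delta' cong: if_cong)

lemma L2_norm_power_sum:
  assumes "finite I"
  shows "(L2_norm (\<lambda>\<zeta>. \<Sum>n\<in>I. a n * \<zeta> ^ n))\<^sup>2 = (\<Sum>n\<in>I. (cmod (a n))\<^sup>2)"
proof -
  let ?p = "\<lambda>\<zeta>::complex. \<Sum>n\<in>I. a n * \<zeta> ^ n"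
  have p: "?p \<in> L2_circle" by (intro L2_circle_sum L2_circle_cmult L2_circle_power)
  have "(\<Sum>n\<in>I. fourier_coeff ?p n * \<zeta> ^ n) = ?p \<zeta>" for \<zeta>
    using assms by (intro sum.cong) (auto simp: fourier_coeff_power_sum)
  moreover have "(\<Sum>n\<in>I. (cmod (fourier_coeff ?p n))\<^sup>2) = (\<Sum>n\<in>I. (cmod (a n))\<^sup>2)"
    using assms by (intro sum.cong) (auto simp: fourier_coeff_power_sum)
  ultimately show ?thesis
    using L2_norm_square_diff_power_sum[OF p assms] by (simp add: L2_norm_def sum_nonneg)
qed

text \<open>The reproducing kernel of \<open>H2\<close>, with the conjugate already inside: a
  boundary function is multiplied by it and integrated, without a further conjugation.\<close>

definition szego :: "complex \<Rightarrow> complex \<Rightarrow> complex" where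
  "szego z \<eta> = 1 / (1 - z * cnj \<eta>)"

lemma szego_measurable [measurable]:
  assumes "f \<in> borel_measurable M" "g \<in> borel_measurable M"
  shows "(\<lambda>x. szego (f x) (g x)) \<in> borel_measurable M"
proof -
  have "(\<lambda>x. cnj (g x)) \<in> borel_measurable M"
    using assms(2) cnj_measurable by (rule measurable_compose)
  then show ?thesis
    using assms(1) unfolding szego_def by measurable
qed

lemma cmod_1_minus_ge:
  fixes z \<eta> :: complex
  assumes "cmod \<eta> = 1"
  shows "1 - cmod z \<le> cmod (1 - z * cnj \<eta>)"
  using norm_triangle_ineq2[of 1 "z * cnj \<eta>"] assms by (simp add: norm_mult)

text \<open>On the circle the kernel is a geometric series dominated by the powers of
  \<open>cmod z\<close>, so sum and integral may be exchanged. Special choices of \<open>u\<close>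
  compute the kernel integrals further down.\<close>

lemma sums_szego:
  assumes u: "integrable circle_measure u" and z: "cmod z < 1"
  shows "(\<lambda>n. fourier_coeff u n * z ^ n) sums (\<integral>\<eta>. u \<eta> * szego z \<eta> \<partial>circle_measure)"
proof -
  let ?f = "\<lambda>n \<eta>. u \<eta> * (z * cnj \<eta>) ^ n"
  have [measurable]: "u \<in> borel_measurable borel"
    using borel_measurable_integrable[OF u] by simp
  have bd: "AE \<eta> in circle_measure. cmod (?f n \<eta>) \<le> cmod z ^ n * cmod (u \<eta>)" for n
    using AE_circle_norm by eventually_elim (simp add: norm_mult norm_power)
  have int: "integrable circle_measure (?f n)" for n
  proof (rule Bochner_Integration.integrable_bound)
    show "integrable circle_measure (\<lambda>\<eta>. cmod z ^ n * cmod (u \<eta>))" using u by auto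
    show "AE \<eta> in circle_measure. norm (?f n \<eta>) \<le> norm (cmod z ^ n * cmod (u \<eta>))"
      using bd[of n] by eventually_elim auto
  qed auto
  have "(\<lambda>n. \<integral>\<eta>. ?f n \<eta> \<partial>circle_measure) sums (\<integral>\<eta>. (\<Sum>n. ?f n \<eta>) \<partial>circle_measure)"
  proof (rule sums_integral)
    show "AE \<eta> in circle_measure. summable (\<lambda>n. norm (?f n \<eta>))"
      using AE_circle_norm
      by eventually_elim (use z in \<open>auto simp: norm_mult norm_power intro!: summable_mult summable_geometric\<close>)
    show "summable (\<lambda>n. \<integral>\<eta>. norm (?f n \<eta>) \<partial>circle_measure)"
    proof (rule summable_comparison_test')
      show "summable (\<lambda>n. cmod z ^ n * (\<integral>\<eta>. cmod (u \<eta>) \<partial>circle_measure))"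
        using z by (intro summable_mult2 summable_geometric) auto
      fix n
      have "(\<integral>\<eta>. norm (?f n \<eta>) \<partial>circle_measure) \<le> (\<integral>\<eta>. cmod z ^ n * cmod (u \<eta>) \<partial>circle_measure)"
        using u int bd by (intro integral_mono_AE) auto
      then show "norm (\<integral>\<eta>. norm (?f n \<eta>) \<partial>circle_measure) \<le> cmod z ^ n * (\<integral>\<eta>. cmod (u \<eta>) \<partial>circle_measure)"
        by simp
    qed
  qed (use int in auto)
  moreover have "(\<integral>\<eta>. ?f n \<eta> \<partial>circle_measure) = fourier_coeff u n * z ^ n" for n
    unfolding fourier_coeff_alt by (subst integral_mult_left_zero[symmetric]) (simp add: power_mult_distrib algebra_simps)
  moreover have "(\<integral>\<eta>. (\<Sum>n. ?f n \<eta>) \<partial>circle_measure) = (\<integral>\<eta>. u \<eta> * szego z \<eta> \<partial>circle_measure)"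
  proof (rule integral_cong_AE)
    show "AE \<eta> in circle_measure. (\<Sum>n. ?f n \<eta>) = u \<eta> * szego z \<eta>"
      using AE_circle_norm
    proof eventually_elim
      case (elim \<eta>)
      then have "(\<lambda>n. ?f n \<eta>) sums (u \<eta> * (1 / (1 - z * cnj \<eta>)))"
        using z by (intro sums_mult geometric_sums) (simp add: norm_mult)
      then show ?case by (simp add: szego_def sums_unique[symmetric])
    qed
  qed auto
  ultimately show ?thesis by simp
qed

section \<open>Szego and Poisson kernels\<close>

text \<open>For unimodular \<open>w\<close> this is the Poisson kernel at \<open>z\<close>. The
  second argument may also lie inside the disc, which describes the composition of two Poisson
  kernels: it depends only on \<open>z * cnj w\<close>.\<close>

definition poisson :: "complex \<Rightarrow> complex \<Rightarrow> real" where
  "poisson z w = (1 - (cmod z * cmod w)\<^sup>2) / (cmod (1 - z * cnj w))\<^sup>2"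

lemma poisson_measurable [measurable]:
  assumes "f \<in> borel_measurable M" "g \<in> borel_measurable M"
  shows "(\<lambda>x. poisson (f x) (g x)) \<in> borel_measurable M"
proof -
  have "(\<lambda>x. cnj (g x)) \<in> borel_measurable M"
    using assms(2) cnj_measurable by (rule measurable_compose)
  then show ?thesis
    using assms unfolding poisson_def by measurable
qed

lemma poisson_nonneg: "cmod z \<le> 1 \<Longrightarrow> cmod w \<le> 1 \<Longrightarrow> poisson z w \<ge> 0"
  unfolding poisson_def
  by (intro divide_nonneg_nonneg) (auto simp: abs_square_le_1 mult_le_one)

lemma poisson_eq_szego:
  assumes "cmod (z * cnj w) < 1"
  shows "complex_of_real (poisson z w) = szego z w + cnj (szego z w) - 1"
proof -
  define c where "c = z * cnj w"
  have ne: "1 - c \<noteq> 0" "1 - cnj c \<noteq> 0" using assms by (auto simp: c_def) (metis complex_cnj_cnj complex_cnj_mult complex_cnj_one less_irrefl norm_one)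
  have "complex_of_real ((1 - (cmod c)\<^sup>2) / (cmod (1 - c))\<^sup>2) = (1 - c * cnj c) / ((1 - c) * (1 - cnj c))"
    using complex_norm_square[of c] complex_norm_square[of "1 - c"] by simp
  also have "\<dots> = 1 / (1 - c) + 1 / (1 - cnj c) - 1"
    using ne by (simp add: divide_simps) (simp add: algebra_simps)
  finally show ?thesis
    by (simp add: c_def szego_def poisson_def norm_mult)
qed

lemma cmod_szego_le:
  assumes "cmod \<eta> = 1" "cmod z < 1"
  shows "cmod (szego z \<eta>) \<le> 1 / (1 - cmod z)"
  using cmod_1_minus_ge[OF assms(1), of z] assms
  by (auto simp: szego_def norm_divide intro!: divide_left_mono mult_pos_pos)

lemma szego_L2:
  assumes "cmod z < 1"
  shows "szego z \<in> L2_circle"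
proof (rule L2_circle_AE_bounded)
  show "AE \<eta> in circle_measure. cmod (szego z \<eta>) \<le> 1 / (1 - cmod z)"
    using AE_circle_norm by eventually_elim (auto intro: cmod_szego_le assms)
qed measurable

lemma L2_circle_integrable: "u \<in> L2_circle \<Longrightarrow> integrable circle_measure u"
  using L2_circle_mult_integrable[of u "\<lambda>_. 1"] L2_circle_power[of 0] by simp

lemma integral_cnj_power: "(\<integral>\<eta>. cnj \<eta> ^ n \<partial>circle_measure) = (if n = 0 then 1 else 0)"
  using integral_circle_power[of 0 n] by (cases "n = 0") simp_all

text \<open>Conjugated monomials have no positive frequencies, so \<open>sums_szego\<close>, applied
  to \<open>cnj (\<eta> ^ n)\<close>, retains at most its constant term.\<close>

lemma fourier_coeff_szego:
  assumes "cmod z < 1"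
  shows "fourier_coeff (szego z) n = (if n = 0 then 1 else 0)"
proof -
  have "(\<lambda>\<eta>. cnj (\<eta> ^ n)) \<in> L2_circle"
    by (rule L2_circle_cnj[OF L2_circle_power])
  from sums_szego[OF L2_circle_integrable[OF this] assms]
  have "(\<lambda>m. fourier_coeff (\<lambda>\<eta>. cnj (\<eta> ^ n)) m * z ^ m) sums (\<integral>\<eta>. cnj (\<eta> ^ n) * szego z \<eta> \<partial>circle_measure)" .
  also have "(\<lambda>m. fourier_coeff (\<lambda>\<eta>. cnj (\<eta> ^ n)) m * z ^ m) = (\<lambda>m. if m = 0 then (if n = 0 then 1 else 0) else 0)"
    using integral_cnj_power[of "n + m" for m] by (auto simp: fourier_coeff_alt power_add fun_eq_iff)
  finally have "(\<integral>\<eta>. cnj (\<eta> ^ n) * szego z \<eta> \<partial>circle_measure) = (if n = 0 then 1 else 0)"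
    using sums_single[of 0 "\<lambda>m. if n = 0 then 1 else 0"] by (rule sums_unique2)
  then show ?thesis by (simp add: fourier_coeff_alt mult.commute)
qed

lemma inner_power_szego:
  assumes "cmod z < 1"
  shows "L2_inner (\<lambda>\<eta>. \<eta> ^ n) (szego z) = (if n = 0 then 1 else 0)"
  using L2_inner_commute[of "\<lambda>\<eta>. \<eta> ^ n" "szego z"] fourier_coeff_szego[OF assms, of n]
  by (simp add: fourier_coeff_def)

lemma integral_power_szego:
  assumes "cmod z < 1"
  shows "(\<integral>\<eta>. \<eta> ^ n * szego z \<eta> \<partial>circle_measure) = z ^ n"
proof -
  have "(\<lambda>m. fourier_coeff (\<lambda>\<eta>. \<eta> ^ n) m * z ^ m) sums (\<integral>\<eta>. \<eta> ^ n * szego z \<eta> \<partial>circle_measure)"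
    by (rule sums_szego[OF L2_circle_integrable[OF L2_circle_power] assms])
  also have "(\<lambda>m. fourier_coeff (\<lambda>\<eta>. \<eta> ^ n) m * z ^ m) = (\<lambda>m. if m = n then z ^ m else 0)"
    by (simp add: fourier_coeff_alt integral_circle_power fun_eq_iff)
  finally show ?thesis
    using sums_single[of n "\<lambda>m. z ^ m"] by (rule sums_unique2)
qed

lemma integral_szego_szego:
  assumes "cmod z < 1" "cmod w < 1"
  shows "(\<integral>\<eta>. szego w \<eta> * szego z \<eta> \<partial>circle_measure) = 1"
proof -
  have "(\<lambda>n. fourier_coeff (szego w) n * z ^ n) sums (\<integral>\<eta>. szego w \<eta> * szego z \<eta> \<partial>circle_measure)"
    using assms by (intro sums_szego L2_circle_integrable szego_L2)
  also have "(\<lambda>n. fourier_coeff (szego w) n * z ^ n) = (\<lambda>n. if n = 0 then z ^ n else 0)"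
    using assms by (simp add: fourier_coeff_szego fun_eq_iff)
  finally show ?thesis
    using sums_unique2[OF _ sums_single[of 0 "\<lambda>m. z ^ m"]] by simp
qed

lemma integral_cnj_szego_szego:
  assumes "cmod z < 1" "cmod w < 1"
  shows "(\<integral>\<eta>. cnj (szego w \<eta>) * szego z \<eta> \<partial>circle_measure) = szego z w"
proof -
  have "(\<lambda>\<eta>. cnj (szego w \<eta>)) \<in> L2_circle" by (intro L2_circle_cnj szego_L2 assms)
  then have "(\<lambda>n. fourier_coeff (\<lambda>\<eta>. cnj (szego w \<eta>)) n * z ^ n) sums (\<integral>\<eta>. cnj (szego w \<eta>) * szego z \<eta> \<partial>circle_measure)"
    using assms by (intro sums_szego L2_circle_integrable)
  moreover have "fourier_coeff (\<lambda>\<eta>. cnj (szego w \<eta>)) n = cnj w ^ n" for n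
  proof -
    have "fourier_coeff (\<lambda>\<eta>. cnj (szego w \<eta>)) n = (\<integral>\<eta>. cnj (\<eta> ^ n * szego w \<eta>) \<partial>circle_measure)"
      by (simp add: fourier_coeff_alt mult.commute)
    also have "\<dots> = cnj (\<integral>\<eta>. \<eta> ^ n * szego w \<eta> \<partial>circle_measure)"
      by (rule Bochner_Integration.integral_cnj)
    also have "\<dots> = cnj w ^ n"
      using assms(2) by (simp add: integral_power_szego)
    finally show ?thesis .
  qed
  moreover have "(\<lambda>n. cnj w ^ n * z ^ n) sums (1 / (1 - z * cnj w))"
  proof -
    have "cmod z * cmod w < 1" using assms mult_strict_mono'[of "cmod z" 1 "cmod w" 1] by simp
    then show ?thesis
      using geometric_sums[of "z * cnj w"] by (simp add: norm_mult power_mult_distrib mult.commute)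
  qed
  ultimately show ?thesis by (simp add: szego_def sums_unique2)
qed

lemma integral_szego:
  assumes "cmod z < 1"
  shows "(\<integral>\<eta>. szego z \<eta> \<partial>circle_measure) = 1"
  using integral_power_szego[OF assms, of 0] by simp

text \<open>A crude bound; it only serves to establish integrability and finiteness.\<close>

lemma poisson_bound:
  assumes "cmod \<eta> = 1" "cmod z < 1"
  shows "poisson z \<eta> \<le> 2 / (1 - cmod z) + 1"
proof -
  have "complex_of_real (poisson z \<eta>) = szego z \<eta> + cnj (szego z \<eta>) - 1"
    using assms by (intro poisson_eq_szego) (simp add: norm_mult)
  then have "\<bar>poisson z \<eta>\<bar> = cmod (szego z \<eta> + cnj (szego z \<eta>) - 1)"
    by (simp flip: norm_of_real[where 'a = complex])
  also have "\<dots> \<le> cmod (szego z \<eta>) + cmod (szego z \<eta>) + 1"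
    using norm_triangle_ineq4[of "szego z \<eta> + cnj (szego z \<eta>)" 1]
      norm_triangle_ineq[of "szego z \<eta>" "cnj (szego z \<eta>)"] by simp
  also have "\<dots> \<le> 2 / (1 - cmod z) + 1"
    using cmod_szego_le[OF assms] by simp
  finally show ?thesis by simp
qed

text \<open>The semigroup property of the Poisson kernel. Each factor is
  \<open>szego + cnj szego - 1\<close>, and all nine products have integrals that are known from the
  Szego series.\<close>

lemma integral_poisson_poisson:
  assumes "cmod z < 1" "cmod w < 1"
  shows "(\<integral>\<eta>. poisson z \<eta> * poisson w \<eta> \<partial>circle_measure) = poisson z w"
proof -
  note K = szego_L2[OF assms(1)] szego_L2[OF assms(2)]
  note KK = L2_circle_mult_integrable[OF K] L2_circle_mult_integrable[OF K(1) L2_circle_cnj[OF K(2)]]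
     L2_circle_mult_integrable[OF L2_circle_cnj[OF K(1)] K(2)]
     L2_circle_mult_integrable[OF L2_circle_cnj[OF K(1)] L2_circle_cnj[OF K(2)]]
  note K1 = K[THEN L2_circle_integrable] K[THEN L2_circle_cnj, THEN L2_circle_integrable]
  have "complex_of_real (\<integral>\<eta>. poisson z \<eta> * poisson w \<eta> \<partial>circle_measure) =
     (\<integral>\<eta>. complex_of_real (poisson z \<eta> * poisson w \<eta>) \<partial>circle_measure)"
    by (rule integral_complex_of_real[symmetric])
  also have "\<dots> = (\<integral>\<eta>. szego z \<eta> * szego w \<eta> + szego z \<eta> * cnj (szego w \<eta>) - szego z \<eta>
     + cnj (szego z \<eta>) * szego w \<eta> + cnj (szego z \<eta>) * cnj (szego w \<eta>) - cnj (szego z \<eta>)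
     - szego w \<eta> - cnj (szego w \<eta>) + 1 \<partial>circle_measure)"
  proof (rule integral_cong_AE)
    show "AE \<eta> in circle_measure. complex_of_real (poisson z \<eta> * poisson w \<eta>) =
      szego z \<eta> * szego w \<eta> + szego z \<eta> * cnj (szego w \<eta>) - szego z \<eta>
     + cnj (szego z \<eta>) * szego w \<eta> + cnj (szego z \<eta>) * cnj (szego w \<eta>) - cnj (szego z \<eta>)
     - szego w \<eta> - cnj (szego w \<eta>) + 1"
      using AE_circle_norm
    proof eventually_elim
      case (elim \<eta>)
      then have "complex_of_real (poisson z \<eta>) = szego z \<eta> + cnj (szego z \<eta>) - 1"
        "complex_of_real (poisson w \<eta>) = szego w \<eta> + cnj (szego w \<eta>) - 1"
        using assms by (auto intro!: poisson_eq_szego simp: norm_mult)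
      then show ?case
        unfolding of_real_mult by (simp only:) (simp add: algebra_simps)
    qed
  qed measurable
  \<comment> \<open>The nine values in the order of the integrand: the two mixed products give Szego
    kernels, every other integral is 1.\<close>
  also have "\<dots> = 1 + szego z w - 1 + szego w z + 1 - 1 - 1 - 1 + 1"
  proof -
    have "(\<integral>\<eta>. cnj (szego z \<eta>) * cnj (szego w \<eta>) \<partial>circle_measure) = cnj (\<integral>\<eta>. szego z \<eta> * szego w \<eta> \<partial>circle_measure)"
      by (simp flip: complex_cnj_mult)
    moreover have "(\<integral>\<eta>. szego z \<eta> * cnj (szego w \<eta>) \<partial>circle_measure) = szego z w"
      using integral_cnj_szego_szego[OF assms] by (simp add: mult.commute)
    ultimately show ?thesis
      using K1 KK assms by (simp add: integral_szego_szego integral_cnj_szego_szego integral_szego)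
  qed
  also have "\<dots> = szego z w + cnj (szego z w) - 1"
    by (simp add: szego_def mult.commute)
  also have "\<dots> = complex_of_real (poisson z w)"
    using assms mult_strict_mono'[of "cmod z" 1 "cmod w" 1]
    by (intro poisson_eq_szego[symmetric]) (simp add: norm_mult)
  finally show ?thesis unfolding of_real_eq_iff .
qed

lemma nn_integral_poisson_poisson:
  assumes "cmod z < 1" "cmod w < 1"
  shows "(\<integral>\<^sup>+\<eta>. ennreal (poisson z \<eta>) * ennreal (poisson w \<eta>) \<partial>circle_measure) = ennreal (poisson z w)"
proof -
  have nn: "AE \<eta> in circle_measure. 0 \<le> poisson z \<eta> \<and> 0 \<le> poisson w \<eta>"
    using AE_circle_norm by eventually_elim (use assms in \<open>auto intro!: poisson_nonneg\<close>)
  have int: "integrable circle_measure (\<lambda>\<eta>. poisson z \<eta> * poisson w \<eta>)"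
  proof (rule Bochner_Integration.integrable_bound)
    show "integrable circle_measure (\<lambda>\<eta>. (2 / (1 - cmod z) + 1) * (2 / (1 - cmod w) + 1))" by simp
    show "AE \<eta> in circle_measure. norm (poisson z \<eta> * poisson w \<eta>) \<le> norm ((2 / (1 - cmod z) + 1) * (2 / (1 - cmod w) + 1))"
      using nn AE_circle_norm
    proof eventually_elim
      case (elim \<eta>)
      note b = poisson_bound[OF elim(2) assms(1)] poisson_bound[OF elim(2) assms(2)]
      have "norm (poisson z \<eta> * poisson w \<eta>) = poisson z \<eta> * poisson w \<eta>"
        using elim by simp
      also have "\<dots> \<le> (2 / (1 - cmod z) + 1) * (2 / (1 - cmod w) + 1)"
        using elim b by (intro mult_mono) linarith+
      also have "\<dots> \<le> norm \<dots>" unfolding real_norm_def by (rule abs_ge_self)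
      finally show ?case .
    qed
  qed measurable
  have "(\<integral>\<^sup>+\<eta>. ennreal (poisson z \<eta>) * ennreal (poisson w \<eta>) \<partial>circle_measure) =
     (\<integral>\<^sup>+\<eta>. ennreal (poisson z \<eta> * poisson w \<eta>) \<partial>circle_measure)"
    by (rule nn_integral_cong_AE) (use nn in \<open>eventually_elim, auto simp: ennreal_mult\<close>)
  also have "\<dots> = ennreal (\<integral>\<eta>. poisson z \<eta> * poisson w \<eta> \<partial>circle_measure)"
    by (rule nn_integral_eq_integral[OF int]) (use nn in \<open>eventually_elim, auto\<close>)
  finally show ?thesis
    by (simp only: integral_poisson_poisson[OF assms])
qed

text \<open>The Szego part of the kernel reproduces the polynomial. The conjugated part and the
  constant -1 each contribute the mean value, with opposite signs.\<close>

lemma poisson_power_sum: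
  assumes "cmod z < 1" "finite I"
  shows "(\<integral>\<eta>. (\<Sum>n\<in>I. a n * \<eta> ^ n) * of_real (poisson z \<eta>) \<partial>circle_measure) = (\<Sum>n\<in>I. a n * z ^ n)"
proof -
  let ?p = "\<lambda>\<eta>::complex. \<Sum>n\<in>I. a n * \<eta> ^ n"
  note K = szego_L2[OF assms(1)]
  have p: "?p \<in> L2_circle" by (intro L2_circle_sum L2_circle_cmult L2_circle_power)
  have "(\<integral>\<eta>. ?p \<eta> * of_real (poisson z \<eta>) \<partial>circle_measure) =
     (\<integral>\<eta>. ?p \<eta> * szego z \<eta> + ?p \<eta> * cnj (szego z \<eta>) - ?p \<eta> \<partial>circle_measure)"
  proof (rule integral_cong_AE)
    show "AE \<eta> in circle_measure. ?p \<eta> * of_real (poisson z \<eta>) = ?p \<eta> * szego z \<eta> + ?p \<eta> * cnj (szego z \<eta>) - ?p \<eta>"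
      using AE_circle_norm
    proof eventually_elim
      case (elim \<eta>)
      then have "complex_of_real (poisson z \<eta>) = szego z \<eta> + cnj (szego z \<eta>) - 1"
        using assms by (auto intro!: poisson_eq_szego simp: norm_mult)
      then show ?case by (simp only: ring_distribs mult_1_right)
    qed
  qed measurable
  also have "\<dots> = (\<integral>\<eta>. ?p \<eta> * szego z \<eta> \<partial>circle_measure) + L2_inner ?p (szego z) - (\<integral>\<eta>. ?p \<eta> \<partial>circle_measure)"
    using L2_circle_mult_integrable[OF p K] L2_circle_mult_integrable[OF p L2_circle_cnj[OF K]] L2_circle_integrable[OF p]
    by (simp add: L2_inner_def)
  also have "(\<integral>\<eta>. ?p \<eta> * szego z \<eta> \<partial>circle_measure) = (\<Sum>n\<in>I. a n * z ^ n)"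
    unfolding sum_distrib_right mult.assoc
    using L2_circle_mult_integrable[OF L2_circle_power L2_circle_cnj[OF K]] assms(1)
    by (subst Bochner_Integration.integral_sum) (auto simp: integral_power_szego)
  also have "L2_inner ?p (szego z) = (\<integral>\<eta>. ?p \<eta> \<partial>circle_measure)"
  proof -
    have *: "L2_inner ?p w = (\<Sum>n\<in>I. a n * L2_inner (\<lambda>\<eta>. \<eta> ^ n) w)" if "w \<in> L2_circle" for w
      using that by (subst L2_inner_sum_left) (auto intro: L2_circle_cmult L2_circle_power simp: L2_inner_cmult_left)
    have "L2_inner ?p (szego z) = L2_inner ?p (\<lambda>\<eta>. \<eta> ^ 0)"
      unfolding *[OF K] *[OF L2_circle_power]
      using integral_circle_power[of _ 0] by (simp add: inner_power_szego[OF assms(1)]) (simp add: L2_inner_def)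
    then show ?thesis by (simp add: L2_inner_def)
  qed
  finally show ?thesis by simp
qed

text \<open>The 8 is 2 * 4. The numerator costs 2, because \<open>1 - \<rho>\<^sup>2\<close> is at
  most \<open>1 - s ^ 4\<close>, which is at most \<open>2 * (1 - s\<^sup>2)\<close>. The squared
  denominator costs 4, because \<open>s - \<rho>\<close> is at most \<open>1 - \<rho>\<close>, hence
  at most \<open>cmod (1 - \<rho> * u)\<close>.\<close>

lemma poisson_product_le_aux:
  fixes s \<rho> :: real and u :: complex
  assumes "0 \<le> s" "s < 1" "s\<^sup>2 \<le> \<rho>" "\<rho> \<le> s" "cmod u = 1"
  shows "(1 - \<rho>\<^sup>2) / (cmod (1 - \<rho> * u))\<^sup>2 \<le> 8 * ((1 - s\<^sup>2) / (cmod (1 - s * u))\<^sup>2)"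
proof -
  have \<rho>: "0 \<le> \<rho>" "\<rho> < 1" using assms zero_le_power2[of s] by linarith+
  have a: "1 - \<rho> \<le> cmod (1 - \<rho> * u)" "1 - s \<le> cmod (1 - s * u)"
    using norm_triangle_ineq2[of 1 "\<rho> * u"] norm_triangle_ineq2[of 1 "s * u"] assms \<rho> by (auto simp: norm_mult)
  have "cmod (1 - s * u) \<le> cmod (1 - \<rho> * u) + cmod ((\<rho> - s) * u)"
    using norm_triangle_ineq[of "1 - \<rho> * u" "(\<rho> - s) * u"] by (simp add: algebra_simps)
  also have "cmod ((\<rho> - s) * u) = s - \<rho>"
    using assms by (simp add: norm_mult flip: of_real_diff)
  also have "s - \<rho> \<le> cmod (1 - \<rho> * u)" using a assms by simp
  finally have b: "cmod (1 - s * u) \<le> 2 * cmod (1 - \<rho> * u)" by simp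
  have b2: "(cmod (1 - s * u))\<^sup>2 \<le> 4 * (cmod (1 - \<rho> * u))\<^sup>2"
    using power_mono[OF b, of 2] by (simp add: power_mult_distrib)
  have "(s\<^sup>2)\<^sup>2 \<le> \<rho>\<^sup>2" using assms by (intro power_mono) auto
  then have "1 - \<rho>\<^sup>2 \<le> (1 - s\<^sup>2) * (1 + s\<^sup>2)" by (simp add: algebra_simps power2_eq_square)
  also have "\<dots> \<le> (1 - s\<^sup>2) * 2"
    using assms by (intro mult_left_mono) (auto simp: power_le_one)
  finally have c: "1 - \<rho>\<^sup>2 \<le> 2 * (1 - s\<^sup>2)" by simp
  have pos: "0 < (cmod (1 - s * u))\<^sup>2" "0 < (cmod (1 - \<rho> * u))\<^sup>2" using a assms \<rho> by auto
  have s2: "0 \<le> 1 - s\<^sup>2" using assms by (simp add: power_le_one)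
  have "(1 - \<rho>\<^sup>2) * (cmod (1 - s * u))\<^sup>2 \<le> (2 * (1 - s\<^sup>2)) * (4 * (cmod (1 - \<rho> * u))\<^sup>2)"
    using c b2 s2 by (intro mult_mono) auto
  then show ?thesis using pos by (simp add: field_simps)
qed

text \<open>If \<open>s\<close> is the smaller radius, then the radius \<open>r * s\<close> of the
  composed kernel lies between \<open>s\<^sup>2\<close> and \<open>s\<close>, so the kernel is
  comparable to the one of radius \<open>s\<close>. The sum on the right covers both orders of the
  radii.\<close>

lemma poisson_product_le:
  assumes r: "0 \<le> r" "r < 1" and s: "0 \<le> s" "s < 1" and n: "cmod \<zeta> = 1" "cmod \<xi> = 1"
  shows "poisson (of_real r * \<zeta>) (of_real s * \<xi>) \<le> 8 * (poisson (of_real r * \<zeta>) \<xi> + poisson (of_real s * \<xi>) \<zeta>)"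
proof -
  have *: "poisson (of_real r * \<zeta>) (of_real s * \<xi>) \<le> 8 * poisson (of_real s * \<xi>) \<zeta>"
    if rs: "s \<le> r" and r: "0 \<le> r" "r < 1" and s: "0 \<le> s" "s < 1" and n: "cmod \<zeta> = 1" "cmod \<xi> = 1" for r s \<zeta> \<xi>
  proof -
    define u where "u = \<xi> * cnj \<zeta>"
    have e: "cmod (1 - t * (\<zeta> * cnj \<xi>)) = cmod (1 - complex_of_real t * u)" for t
    proof -
      have "1 - complex_of_real t * (\<zeta> * cnj \<xi>) = cnj (1 - complex_of_real t * u)" by (simp add: u_def mult.commute)
      then show ?thesis by (metis complex_mod_cnj)
    qed
    have "poisson (of_real r * \<zeta>) (of_real s * \<xi>) = (1 - (r * s)\<^sup>2) / (cmod (1 - of_real (r * s) * u))\<^sup>2"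
      unfolding poisson_def e[symmetric] using n r s by (simp add: norm_mult algebra_simps)
    also have "\<dots> \<le> 8 * ((1 - s\<^sup>2) / (cmod (1 - s * u))\<^sup>2)"
      using r s rs n by (intro poisson_product_le_aux)
         (auto simp: u_def norm_mult power2_eq_square mult_right_mono mult_left_le_one_le)
    also have "(1 - s\<^sup>2) / (cmod (1 - s * u))\<^sup>2 = poisson (of_real s * \<xi>) \<zeta>"
      using n s by (simp add: poisson_def u_def norm_mult mult.assoc)
    finally show ?thesis .
  qed
  have sym: "poisson (of_real r * \<zeta>) (of_real s * \<xi>) = poisson (of_real s * \<xi>) (of_real r * \<zeta>)"
  proof -
    have "1 - of_real r * \<zeta> * cnj (of_real s * \<xi>) = cnj (1 - of_real s * \<xi> * cnj (of_real r * \<zeta>))" by (simp add: mult.commute)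
    then show ?thesis unfolding poisson_def by (metis complex_mod_cnj mult.commute)
  qed
  have "0 \<le> poisson (of_real r * \<zeta>) \<xi>" "0 \<le> poisson (of_real s * \<xi>) \<zeta>"
    using r s n by (auto intro!: poisson_nonneg simp: norm_mult)
  then show ?thesis
    using *[of s r \<zeta> \<xi>] *[of r s \<xi> \<zeta>] sym r s n by (cases "s \<le> r") auto
qed

section \<open>The linearised maximal inequality\<close>

text \<open>The inequality behind both absorption arguments below, in a form free of subtraction
  because the values may be infinite.\<close>

lemma ennreal_two_mult_le: "2 * x * y \<le> x\<^sup>2 + y\<^sup>2" for x y :: ennreal
proof (cases x; cases y)
  fix a b assume ab: "x = ennreal a" "0 \<le> a" "y = ennreal b" "0 \<le> b"
  have "2 * x * y = ennreal (2 * a * b)"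
    using ab by (simp add: ennreal_mult)
  also have "\<dots> \<le> ennreal (a\<^sup>2 + b\<^sup>2)"
    by (intro ennreal_leI) (use sum_squares_bound[of a b] in simp)
  also have "\<dots> = x\<^sup>2 + y\<^sup>2"
    using ab by (simp add: ennreal_power ennreal_plus)
  finally show ?thesis .
qed (auto simp: power2_eq_square ennreal_top_mult ennreal_mult_top)

interpretation circle_pair: pair_sigma_finite circle_measure circle_measure ..

text \<open>Integrability is not assumed: the Bochner integral of a function that is not integrable
  is 0.\<close>

lemma ennreal_cmod_integral_le:
  "ennreal (cmod (\<integral>x. f x \<partial>M)) \<le> (\<integral>\<^sup>+x. ennreal (cmod (f x)) \<partial>M)"
  by (cases "integrable M f") (auto simp: not_integrable_integral_eq intro: integral_norm_bound_ennreal)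

lemma nn_integral_circle_le:
  "AE \<zeta> in circle_measure. f \<zeta> \<le> c \<Longrightarrow> (\<integral>\<^sup>+\<zeta>. f \<zeta> \<partial>circle_measure) \<le> c"
  by (rule order_trans[OF nn_integral_mono_AE]) (auto simp: emeasure_circle_measure_UNIV)

context
  fixes \<rho> :: "complex \<Rightarrow> real" and R :: real
  assumes \<rho> [measurable]: "\<rho> \<in> borel_measurable borel"
    and \<rho>_bounds: "\<And>\<zeta>. 0 \<le> \<rho> \<zeta>" "\<And>\<zeta>. \<rho> \<zeta> \<le> R" "R < 1"
begin

lemma cmod_radius_mult_le: "cmod \<zeta> = 1 \<Longrightarrow> cmod (\<rho> \<zeta> * \<zeta>) \<le> R" for \<zeta> :: complex
  using \<rho>_bounds by (simp add: norm_mult)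

text \<open>Radii at most \<open>R < 1\<close> keep the kernels bounded. This makes the quadratic
  quantities below finite, so that they can be cancelled; \<open>R\<close> does not enter the
  resulting constants.\<close>

lemma poisson_radius_mult_le:
  fixes \<zeta> :: complex
  assumes "cmod \<zeta> = 1" "cmod \<eta> = 1" "c \<le> ennreal H"
  shows "ennreal (poisson (\<rho> \<zeta> * \<zeta>) \<eta>) * c \<le> ennreal ((2 / (1 - R) + 1) * max H 0)"
proof -
  have "poisson (\<rho> \<zeta> * \<zeta>) \<eta> \<le> 2 / (1 - cmod (\<rho> \<zeta> * \<zeta>)) + 1"
    using assms cmod_radius_mult_le[OF assms(1)] \<rho>_bounds(3) by (intro poisson_bound) auto
  also have "\<dots> \<le> 2 / (1 - R) + 1"
    using cmod_radius_mult_le[OF assms(1)] \<rho>_bounds(3) by (intro add_right_mono divide_left_mono) auto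
  finally have "ennreal (poisson (\<rho> \<zeta> * \<zeta>) \<eta>) \<le> ennreal (2 / (1 - R) + 1)" by (rule ennreal_leI)
  moreover have "c \<le> ennreal (max H 0)" by (rule order_trans[OF assms(3)]) (simp add: ennreal_leI)
  ultimately have "ennreal (poisson (\<rho> \<zeta> * \<zeta>) \<eta>) * c \<le> ennreal (2 / (1 - R) + 1) * ennreal (max H 0)"
    by (intro mult_mono) auto
  also have "\<dots> = ennreal ((2 / (1 - R) + 1) * max H 0)"
    using \<rho>_bounds(3) by (intro ennreal_mult[symmetric]) auto
  finally show ?thesis .
qed

text \<open>
  The maximal operator, linearised: \<open>\<rho> \<zeta>\<close> selects the radius at the boundary point \<open>\<zeta>\<close>. The
  square of the adjoint is controlled by the operator itself because composing two Poisson kernels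
  multiplies the radii (Kolmogorov--Seliverstov).
\<close>

lemma poisson_adjoint_bound:
  fixes h :: "complex \<Rightarrow> ennreal"
  assumes [measurable]: "h \<in> borel_measurable borel"
    and h: "AE \<zeta> in circle_measure. h \<zeta> \<le> ennreal H"
  shows "(\<integral>\<^sup>+\<eta>. (\<integral>\<^sup>+\<zeta>. ennreal (poisson (\<rho> \<zeta> * \<zeta>) \<eta>) * h \<zeta> \<partial>circle_measure)\<^sup>2 \<partial>circle_measure) \<le>
    256 * (\<integral>\<^sup>+\<zeta>. (h \<zeta>)\<^sup>2 \<partial>circle_measure)"
proof -
  define Q where "Q \<zeta> \<eta> = ennreal (poisson (\<rho> \<zeta> * \<zeta>) \<eta>)" for \<zeta> \<eta> :: complex
  define g where "g \<eta> = (\<integral>\<^sup>+\<zeta>. Q \<zeta> \<eta> * h \<zeta> \<partial>circle_measure)" for \<eta>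
  have Q_meas: "(\<lambda>x. Q (f x) (f' x)) \<in> borel_measurable M"
    if [measurable]: "f \<in> borel_measurable M" "f' \<in> borel_measurable M" for f f' and M :: "'a measure"
    unfolding Q_def by measurable
  note [measurable] = Q_meas
  have [measurable]: "g \<in> borel_measurable borel"
    unfolding g_def by measurable
  define X Y where "X = (\<integral>\<^sup>+\<eta>. (g \<eta>)\<^sup>2 \<partial>circle_measure)" and "Y = (\<integral>\<^sup>+\<zeta>. (h \<zeta>)\<^sup>2 \<partial>circle_measure)"
  note \<rho>1 = cmod_radius_mult_le
  have QQ: "(\<integral>\<^sup>+\<eta>. Q \<zeta> \<eta> * Q \<xi> \<eta> \<partial>circle_measure) \<le> 8 * (Q \<zeta> \<xi> + Q \<xi> \<zeta>)" if "cmod \<zeta> = 1" "cmod \<xi> = 1" for \<zeta> \<xi> :: complex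
  proof -
    have "(\<integral>\<^sup>+\<eta>. Q \<zeta> \<eta> * Q \<xi> \<eta> \<partial>circle_measure) = ennreal (poisson (\<rho> \<zeta> * \<zeta>) (\<rho> \<xi> * \<xi>))"
      unfolding Q_def using \<rho>1[OF that(1)] \<rho>1[OF that(2)] \<rho>_bounds(3) by (intro nn_integral_poisson_poisson) auto
    also have "\<dots> \<le> ennreal (8 * (poisson (\<rho> \<zeta> * \<zeta>) \<xi> + poisson (\<rho> \<xi> * \<xi>) \<zeta>))"
      using that \<rho>_bounds(1,3) \<rho>_bounds(2)[of \<zeta>] \<rho>_bounds(2)[of \<xi>]
      by (intro ennreal_leI poisson_product_le) auto
    also have "\<dots> = 8 * (Q \<zeta> \<xi> + Q \<xi> \<zeta>)"
      using that \<rho>1[OF that(1)] \<rho>1[OF that(2)] \<rho>_bounds(3)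
      by (simp add: Q_def ennreal_mult poisson_nonneg ennreal_plus)
    finally show ?thesis .
  qed
  \<comment> \<open>Expand the square and integrate over \<open>\<eta>\<close> first, so that
    \<open>QQ\<close> applies to the product of the two kernels. Its two summands contribute equally
    by symmetry, hence the factor 16 = 2 * 8.\<close>
  have "X = (\<integral>\<^sup>+\<eta>. \<integral>\<^sup>+\<zeta>. \<integral>\<^sup>+\<xi>. h \<zeta> * h \<xi> * (Q \<zeta> \<eta> * Q \<xi> \<eta>) \<partial>circle_measure \<partial>circle_measure \<partial>circle_measure)"
  proof -
    have "(g \<eta>)\<^sup>2 = (\<integral>\<^sup>+\<zeta>. \<integral>\<^sup>+\<xi>. h \<zeta> * h \<xi> * (Q \<zeta> \<eta> * Q \<xi> \<eta>) \<partial>circle_measure \<partial>circle_measure)" for \<eta>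
    proof -
      have "(g \<eta>)\<^sup>2 = (\<integral>\<^sup>+\<zeta>. Q \<zeta> \<eta> * h \<zeta> * g \<eta> \<partial>circle_measure)"
        unfolding power2_eq_square by (subst nn_integral_multc) (auto simp: g_def)
      also have "\<dots> = (\<integral>\<^sup>+\<zeta>. \<integral>\<^sup>+\<xi>. Q \<zeta> \<eta> * h \<zeta> * (Q \<xi> \<eta> * h \<xi>) \<partial>circle_measure \<partial>circle_measure)"
        by (subst g_def, subst nn_integral_cmult) auto
      finally show ?thesis by (simp add: mult_ac)
    qed
    then show ?thesis unfolding X_def by simp
  qed
  also have "\<dots> = (\<integral>\<^sup>+\<zeta>. \<integral>\<^sup>+\<eta>. \<integral>\<^sup>+\<xi>. h \<zeta> * h \<xi> * (Q \<zeta> \<eta> * Q \<xi> \<eta>) \<partial>circle_measure \<partial>circle_measure \<partial>circle_measure)"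
    by (rule circle_pair.Fubini') measurable
  also have "\<dots> = (\<integral>\<^sup>+\<zeta>. \<integral>\<^sup>+\<xi>. \<integral>\<^sup>+\<eta>. h \<zeta> * h \<xi> * (Q \<zeta> \<eta> * Q \<xi> \<eta>) \<partial>circle_measure \<partial>circle_measure \<partial>circle_measure)"
    by (intro nn_integral_cong circle_pair.Fubini') measurable
  also have "\<dots> = (\<integral>\<^sup>+\<zeta>. \<integral>\<^sup>+\<xi>. h \<zeta> * h \<xi> * (\<integral>\<^sup>+\<eta>. Q \<zeta> \<eta> * Q \<xi> \<eta> \<partial>circle_measure) \<partial>circle_measure \<partial>circle_measure)"
    by (intro nn_integral_cong nn_integral_cmult) measurable
  also have "\<dots> \<le> (\<integral>\<^sup>+\<zeta>. \<integral>\<^sup>+\<xi>. h \<zeta> * h \<xi> * (8 * (Q \<zeta> \<xi> + Q \<xi> \<zeta>)) \<partial>circle_measure \<partial>circle_measure)"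
  proof (rule nn_integral_mono_AE, use AE_circle_norm in eventually_elim)
    case (elim \<zeta>)
    show ?case
    proof (rule nn_integral_mono_AE, use AE_circle_norm in eventually_elim)
      case (elim \<xi>)
      with QQ[OF \<open>cmod \<zeta> = 1\<close> elim] show ?case by (intro mult_left_mono) auto
    qed
  qed
  also have "\<dots> = (\<integral>\<^sup>+\<zeta>. \<integral>\<^sup>+\<xi>. 8 * (h \<xi> * (Q \<zeta> \<xi> * h \<zeta>)) + 8 * (h \<zeta> * (Q \<xi> \<zeta> * h \<xi>)) \<partial>circle_measure \<partial>circle_measure)"
    by (simp add: ring_distribs mult_ac)
  also have "\<dots> = 8 * (\<integral>\<^sup>+\<zeta>. \<integral>\<^sup>+\<xi>. h \<xi> * (Q \<zeta> \<xi> * h \<zeta>) \<partial>circle_measure \<partial>circle_measure) +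
     8 * (\<integral>\<^sup>+\<zeta>. \<integral>\<^sup>+\<xi>. h \<zeta> * (Q \<xi> \<zeta> * h \<xi>) \<partial>circle_measure \<partial>circle_measure)"
    by (simp add: nn_integral_add nn_integral_cmult)
  also have "(\<integral>\<^sup>+\<zeta>. \<integral>\<^sup>+\<xi>. h \<xi> * (Q \<zeta> \<xi> * h \<zeta>) \<partial>circle_measure \<partial>circle_measure) =
      (\<integral>\<^sup>+\<zeta>. \<integral>\<^sup>+\<xi>. h \<zeta> * (Q \<xi> \<zeta> * h \<xi>) \<partial>circle_measure \<partial>circle_measure)"
    by (rule circle_pair.Fubini') measurable
  also have "(\<integral>\<^sup>+\<zeta>. \<integral>\<^sup>+\<xi>. h \<zeta> * (Q \<xi> \<zeta> * h \<xi>) \<partial>circle_measure \<partial>circle_measure) = (\<integral>\<^sup>+\<xi>. h \<xi> * g \<xi> \<partial>circle_measure)"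
    by (simp add: nn_integral_cmult g_def)
  finally have X: "X \<le> 16 * (\<integral>\<^sup>+\<xi>. h \<xi> * g \<xi> \<partial>circle_measure)"
    by (simp flip: distrib_right)
  \<comment> \<open>Twice \<open>16 * h * g\<close> is at most
    \<open>(16 * h)\<^sup>2 + g\<^sup>2\<close>, and the second term integrates to \<open>X\<close>
    again. Being finite, \<open>X\<close> may be cancelled, which leaves the constant 256 = 16 *
    16.\<close>
  have "X + X = 2 * X" by (simp add: mult_2)
  also have "\<dots> \<le> 2 * (16 * (\<integral>\<^sup>+\<xi>. h \<xi> * g \<xi> \<partial>circle_measure))"
    using X by (intro mult_left_mono) auto
  also have "\<dots> = (\<integral>\<^sup>+\<xi>. 2 * (16 * h \<xi>) * g \<xi> \<partial>circle_measure)"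
    by (simp add: nn_integral_cmult[symmetric] mult_ac)
  also have "\<dots> \<le> (\<integral>\<^sup>+\<xi>. (16 * h \<xi>)\<^sup>2 + (g \<xi>)\<^sup>2 \<partial>circle_measure)"
    by (intro nn_integral_mono ennreal_two_mult_le)
  also have "\<dots> = 256 * Y + X"
    by (simp add: nn_integral_add nn_integral_cmult power_mult_distrib X_def Y_def)
  finally have XX: "X + X \<le> 256 * Y + X" .
  have "X < \<infinity>"
  proof -
    have "g \<eta> \<le> ennreal ((2 / (1 - R) + 1) * max H 0)" if "cmod \<eta> = 1" for \<eta>
      unfolding g_def Q_def
      by (rule nn_integral_circle_le, use AE_circle_norm h in eventually_elim)
        (rule poisson_radius_mult_le[OF _ that])
    then have "X \<le> (\<integral>\<^sup>+\<eta>. (ennreal ((2 / (1 - R) + 1) * max H 0))\<^sup>2 \<partial>circle_measure)"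
      unfolding X_def
      by (intro nn_integral_mono_AE) (use AE_circle_norm in \<open>eventually_elim, auto intro: power_mono\<close>)
    also have "\<dots> < \<infinity>" by (simp add: emeasure_circle_measure_UNIV power2_eq_square ennreal_mult_less_top)
    finally show ?thesis .
  qed
  then have "X \<le> 256 * Y"
    using XX by (auto simp: ennreal_add_left_cancel_le add.commute)
  then show ?thesis by (simp add: X_def Y_def g_def Q_def)
qed

text \<open>Duality: the integral of \<open>h\<^sup>2\<close> is the pairing of \<open>g\<close>
  with \<open>k\<close>, the adjoint applied to \<open>h\<close>, so the L2 bound for the adjoint
  yields the same bound for the operator.\<close>

lemma poisson_maximal_bound:
  fixes g :: "complex \<Rightarrow> ennreal"
  assumes [measurable]: "g \<in> borel_measurable borel"
    and g: "AE \<zeta> in circle_measure. g \<zeta> \<le> ennreal G"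
  shows "(\<integral>\<^sup>+\<zeta>. (\<integral>\<^sup>+\<eta>. ennreal (poisson (\<rho> \<zeta> * \<zeta>) \<eta>) * g \<eta> \<partial>circle_measure)\<^sup>2 \<partial>circle_measure) \<le>
    256 * (\<integral>\<^sup>+\<zeta>. (g \<zeta>)\<^sup>2 \<partial>circle_measure)"
proof -
  define Q where "Q \<zeta> \<eta> = ennreal (poisson (\<rho> \<zeta> * \<zeta>) \<eta>)" for \<zeta> \<eta> :: complex
  define h where "h \<zeta> = (\<integral>\<^sup>+\<eta>. Q \<zeta> \<eta> * g \<eta> \<partial>circle_measure)" for \<zeta>
  define k where "k \<eta> = (\<integral>\<^sup>+\<zeta>. Q \<zeta> \<eta> * h \<zeta> \<partial>circle_measure)" for \<eta>
  have Q_meas: "(\<lambda>x. Q (f x) (f' x)) \<in> borel_measurable M"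
    if [measurable]: "f \<in> borel_measurable M" "f' \<in> borel_measurable M" for f f' and M :: "'a measure"
    unfolding Q_def by measurable
  note [measurable] = Q_meas
  have [measurable]: "h \<in> borel_measurable borel"
    unfolding h_def by measurable
  have [measurable]: "k \<in> borel_measurable borel"
    unfolding k_def by measurable
  define C where "C = (2 / (1 - R) + 1) * max G 0"
  have h_bound: "h \<zeta> \<le> ennreal C" if "cmod \<zeta> = 1" for \<zeta>
    unfolding h_def Q_def C_def
    by (rule nn_integral_circle_le, use AE_circle_norm g in eventually_elim)
      (rule poisson_radius_mult_le[OF that])
  define W where "W = (\<integral>\<^sup>+\<zeta>. (h \<zeta>)\<^sup>2 \<partial>circle_measure)"
  have kW: "(\<integral>\<^sup>+\<eta>. (k \<eta>)\<^sup>2 \<partial>circle_measure) \<le> 256 * W"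
    unfolding k_def W_def Q_def
    by (rule poisson_adjoint_bound[where H = C]) (use h_bound AE_circle_norm in auto)
  have "W = (\<integral>\<^sup>+\<zeta>. \<integral>\<^sup>+\<eta>. g \<eta> * (Q \<zeta> \<eta> * h \<zeta>) \<partial>circle_measure \<partial>circle_measure)"
    unfolding W_def power2_eq_square
    by (subst (2) h_def, subst nn_integral_cmult[symmetric]) (auto simp: mult_ac)
  also have "\<dots> = (\<integral>\<^sup>+\<eta>. \<integral>\<^sup>+\<zeta>. g \<eta> * (Q \<zeta> \<eta> * h \<zeta>) \<partial>circle_measure \<partial>circle_measure)"
    by (rule circle_pair.Fubini') measurable
  also have "\<dots> = (\<integral>\<^sup>+\<eta>. g \<eta> * k \<eta> \<partial>circle_measure)"
    by (simp add: nn_integral_cmult k_def)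
  finally have W: "W = (\<integral>\<^sup>+\<eta>. g \<eta> * k \<eta> \<partial>circle_measure)" .
  \<comment> \<open>The splitting of \<open>2 * (256 * g) * k\<close> is scaled so that the integral
    of \<open>k\<^sup>2\<close> is at most one copy of \<open>256 * W\<close>, which is finite and
    can be cancelled.\<close>
  have "256 * W + 256 * W = 512 * W" by (simp flip: distrib_right)
  also have "\<dots> = (\<integral>\<^sup>+\<eta>. 512 * (g \<eta> * k \<eta>) \<partial>circle_measure)"
    by (simp add: W nn_integral_cmult)
  also have "\<dots> = (\<integral>\<^sup>+\<eta>. 2 * (256 * g \<eta>) * k \<eta> \<partial>circle_measure)"
    by (simp add: mult.assoc[symmetric])
  also have "\<dots> \<le> (\<integral>\<^sup>+\<eta>. (256 * g \<eta>)\<^sup>2 + (k \<eta>)\<^sup>2 \<partial>circle_measure)"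
    by (intro nn_integral_mono ennreal_two_mult_le)
  also have "\<dots> = 256 * (256 * (\<integral>\<^sup>+\<eta>. (g \<eta>)\<^sup>2 \<partial>circle_measure)) + (\<integral>\<^sup>+\<eta>. (k \<eta>)\<^sup>2 \<partial>circle_measure)"
    by (simp add: nn_integral_add nn_integral_cmult power_mult_distrib mult.assoc[symmetric])
  also have "\<dots> \<le> 256 * (256 * (\<integral>\<^sup>+\<eta>. (g \<eta>)\<^sup>2 \<partial>circle_measure)) + 256 * W"
    using kW by (intro add_left_mono)
  finally have *: "256 * W + 256 * W \<le> 256 * W + 256 * (256 * (\<integral>\<^sup>+\<eta>. (g \<eta>)\<^sup>2 \<partial>circle_measure))"
    by (simp add: add.commute)
  have "W \<le> (\<integral>\<^sup>+\<zeta>. (ennreal C)\<^sup>2 \<partial>circle_measure)"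
    unfolding W_def
    by (intro nn_integral_mono_AE) (use AE_circle_norm in \<open>eventually_elim, auto intro: power_mono h_bound\<close>)
  also have "\<dots> < \<infinity>" by (simp add: emeasure_circle_measure_UNIV power2_eq_square ennreal_mult_less_top)
  finally have "256 * W < \<infinity>" by (simp add: ennreal_mult_less_top)
  with * have "256 * W \<le> 256 * (256 * (\<integral>\<^sup>+\<eta>. (g \<eta>)\<^sup>2 \<partial>circle_measure))"
    by (auto simp: ennreal_add_left_cancel_le)
  then have "W \<le> 256 * (\<integral>\<^sup>+\<eta>. (g \<eta>)\<^sup>2 \<partial>circle_measure)"
    by (subst (asm) ennreal_mult_le_mult_iff) auto
  then show ?thesis by (simp add: W_def h_def Q_def)
qed

text \<open>A polynomial is the Poisson integral of its boundary values, so its modulus at an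
  interior point is at most the Poisson integral of its modulus on the circle.\<close>

lemma power_sum_maximal_bound:
  assumes "finite I"
  shows "(\<integral>\<^sup>+\<zeta>. (ennreal (cmod (\<Sum>n\<in>I. a n * (\<rho> \<zeta> * \<zeta>) ^ n)))\<^sup>2 \<partial>circle_measure) \<le>
    ennreal (256 * (\<Sum>n\<in>I. (cmod (a n))\<^sup>2))"
proof -
  let ?p = "\<lambda>\<zeta>::complex. \<Sum>n\<in>I. a n * \<zeta> ^ n"
  have p: "?p \<in> L2_circle" by (intro L2_circle_sum L2_circle_cmult L2_circle_power)
  have bd: "cmod (?p \<zeta>) \<le> (\<Sum>n\<in>I. cmod (a n))" if "cmod \<zeta> = 1" for \<zeta>
    using that norm_sum[of "\<lambda>n. a n * \<zeta> ^ n" I] by (simp add: norm_mult norm_power)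
  have "(\<integral>\<^sup>+\<zeta>. (ennreal (cmod (?p (\<rho> \<zeta> * \<zeta>))))\<^sup>2 \<partial>circle_measure) \<le>
    (\<integral>\<^sup>+\<zeta>. (\<integral>\<^sup>+\<eta>. ennreal (poisson (\<rho> \<zeta> * \<zeta>) \<eta>) * ennreal (cmod (?p \<eta>)) \<partial>circle_measure)\<^sup>2 \<partial>circle_measure)"
  proof (rule nn_integral_mono_AE, use AE_circle_norm in eventually_elim)
    case (elim \<zeta>)
    have lt: "cmod (\<rho> \<zeta> * \<zeta>) < 1"
      using elim \<rho>_bounds by (simp add: norm_mult) (meson le_less_trans)
    have nn: "AE \<eta> in circle_measure. 0 \<le> poisson (\<rho> \<zeta> * \<zeta>) \<eta>"
      using AE_circle_norm by eventually_elim (use lt in \<open>auto intro!: poisson_nonneg\<close>)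
    have "ennreal (cmod (?p (\<rho> \<zeta> * \<zeta>))) = ennreal (cmod (\<integral>\<eta>. ?p \<eta> * of_real (poisson (\<rho> \<zeta> * \<zeta>) \<eta>) \<partial>circle_measure))"
      by (simp only: poisson_power_sum[OF lt assms])
    also have "\<dots> \<le> (\<integral>\<^sup>+\<eta>. ennreal (cmod (?p \<eta> * of_real (poisson (\<rho> \<zeta> * \<zeta>) \<eta>))) \<partial>circle_measure)"
      by (rule ennreal_cmod_integral_le)
    also have "\<dots> = (\<integral>\<^sup>+\<eta>. ennreal (poisson (\<rho> \<zeta> * \<zeta>) \<eta>) * ennreal (cmod (?p \<eta>)) \<partial>circle_measure)"
      by (rule nn_integral_cong_AE)
        (use nn in \<open>eventually_elim, auto simp: norm_mult ennreal_mult[symmetric] mult.commute\<close>)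
    finally show ?case by (rule power_mono) simp
  qed
  also have "\<dots> \<le> 256 * (\<integral>\<^sup>+\<zeta>. (ennreal (cmod (?p \<zeta>)))\<^sup>2 \<partial>circle_measure)"
    by (rule poisson_maximal_bound[where G = "\<Sum>n\<in>I. cmod (a n)"])
      (use AE_circle_norm in \<open>measurable, eventually_elim, auto intro!: ennreal_leI bd\<close>)
  also have "(\<integral>\<^sup>+\<zeta>. (ennreal (cmod (?p \<zeta>)))\<^sup>2 \<partial>circle_measure) = ennreal ((L2_norm ?p)\<^sup>2)"
    unfolding L2_norm_square using p
    by (simp add: mem_L2_circle ennreal_power nn_integral_eq_integral)
  also have "(L2_norm ?p)\<^sup>2 = (\<Sum>n\<in>I. (cmod (a n))\<^sup>2)"
    by (rule L2_norm_power_sum[OF assms])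
  also have "256 * ennreal (\<Sum>n\<in>I. (cmod (a n))\<^sup>2) = ennreal (256 * (\<Sum>n\<in>I. (cmod (a n))\<^sup>2))"
    by (subst ennreal_mult) (auto intro: sum_nonneg)
  finally show ?thesis .
qed

end

section \<open>Taylor coefficients and the radial maximal function\<close>

definition taylor_coeff :: "(complex \<Rightarrow> complex) \<Rightarrow> nat \<Rightarrow> complex" where
  "taylor_coeff f n = (deriv ^^ n) f 0 / fact n"

lemma taylor_coeff_sums:
  assumes "f holomorphic_on ball 0 1" "cmod z < 1"
  shows "(\<lambda>n. taylor_coeff f n * z ^ n) sums f z"
  using holomorphic_power_series[OF assms(1), of z] assms(2) by (simp add: taylor_coeff_def)

lemma disc_measurable:
  fixes f :: "complex \<Rightarrow> complex"
  assumes "continuous_on (ball 0 1) f" "\<And>z. z \<notin> ball 0 1 \<Longrightarrow> f z = 0"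
  shows "f \<in> borel_measurable (borel :: complex measure)"
proof -
  have "(\<lambda>x. indicator (ball 0 1) x *\<^sub>R f x) \<in> borel_measurable borel"
    using assms(1) by (intro borel_measurable_continuous_on_indicator) auto
  also have "(\<lambda>x. indicator (ball 0 1) x *\<^sub>R f x) = f"
    using assms(2) by (auto simp: indicator_def fun_eq_iff)
  finally show ?thesis .
qed

lemma H2_holomorphic: "f \<in> H2 \<Longrightarrow> f holomorphic_on ball 0 1"
  and H2_zero: "f \<in> H2 \<Longrightarrow> z \<notin> ball 0 1 \<Longrightarrow> f z = 0"
  by (auto simp: H2_def)

lemma H2_measurable [measurable_dest]: "f \<in> H2 \<Longrightarrow> f \<in> borel_measurable borel"
  by (intro disc_measurable holomorphic_on_imp_continuous_on H2_holomorphic) (auto simp: H2_zero)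

lemma powser_abs_summable:
  fixes a :: "nat \<Rightarrow> complex"
  assumes "\<And>z. cmod z < 1 \<Longrightarrow> (\<lambda>n. a n * z ^ n) sums f z" "cmod z < 1"
  shows "summable (\<lambda>n. cmod (a n) * cmod z ^ n)"
proof -
  obtain r where r: "cmod z < r" "r < 1" using dense assms(2) by blast
  then have "r > 0" using norm_ge_zero[of z] by linarith
  have "summable (\<lambda>n. a n * of_real r ^ n)"
    using assms(1)[of "of_real r"] r \<open>r > 0\<close> by (auto simp: sums_iff)
  then have "summable (\<lambda>n. norm (a n * z ^ n))"
    by (rule powser_insidea) (use r \<open>r > 0\<close> in auto)
  then show ?thesis by (simp add: norm_mult norm_power)
qed

text \<open>On a circle of radius below 1 all partial sums are bounded by one constant, so the
  polynomial identities pass to the limit by dominated convergence.\<close>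

lemma power_series_slice:
  assumes sums: "\<And>z. cmod z < 1 \<Longrightarrow> (\<lambda>n. a n * z ^ n) sums f z"
    and [measurable]: "f \<in> borel_measurable borel" and r: "0 \<le> r" "r < 1"
  shows power_series_slice_bound: "cmod \<zeta> = 1 \<Longrightarrow> cmod (f (of_real r * \<zeta>)) \<le> (\<Sum>n. cmod (a n) * r ^ n)"
    and power_series_slice_L2: "(\<lambda>\<zeta>. f (of_real r * \<zeta>)) \<in> L2_circle"
    and power_series_slice_coeff: "fourier_coeff (\<lambda>\<zeta>. f (of_real r * \<zeta>)) n = a n * of_real r ^ n"
    and power_series_slice_norm: "(L2_norm (\<lambda>\<zeta>. f (of_real r * \<zeta>)))\<^sup>2 = (\<Sum>n. (cmod (a n))\<^sup>2 * (r ^ n)\<^sup>2)"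
proof -
  have sm: "summable (\<lambda>n. cmod (a n) * r ^ n)"
    using powser_abs_summable[OF sums, of "of_real r"] r by simp
  have bd: "cmod (\<Sum>n\<in>I. a n * (of_real r * \<zeta>) ^ n) \<le> (\<Sum>n. cmod (a n) * r ^ n)"
    if "cmod \<zeta> = 1" "finite I" for \<zeta> I
  proof -
    have "cmod (\<Sum>n\<in>I. a n * (of_real r * \<zeta>) ^ n) \<le> (\<Sum>n\<in>I. cmod (a n) * r ^ n)"
      by (rule sum_norm_le) (use that r in \<open>simp add: norm_mult norm_power\<close>)
    also have "\<dots> \<le> (\<Sum>n. cmod (a n) * r ^ n)"
      using that r by (intro sum_le_suminf sm) auto
    finally show ?thesis .
  qed
  have lim: "(\<lambda>N. \<Sum>n<N. a n * (of_real r * \<zeta>) ^ n) \<longlonglongrightarrow> f (of_real r * \<zeta>)" if "cmod \<zeta> = 1" for \<zeta>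
    using sums[of "of_real r * \<zeta>"] that r by (simp add: sums_def norm_mult)
  show bound: "cmod (f (of_real r * \<zeta>)) \<le> (\<Sum>n. cmod (a n) * r ^ n)" if "cmod \<zeta> = 1" for \<zeta>
    using tendsto_norm[OF lim[OF that]] by (rule LIMSEQ_le_const2) (use bd[OF that] in auto)
  show L2: "(\<lambda>\<zeta>. f (of_real r * \<zeta>)) \<in> L2_circle"
    by (rule L2_circle_AE_bounded[where C = "\<Sum>n. cmod (a n) * r ^ n"])
      (use AE_circle_norm in \<open>measurable, eventually_elim, auto intro: bound\<close>)
  have eq: "(\<Sum>n<N. a n * (of_real r * \<zeta>) ^ n) = (\<Sum>n<N. (a n * of_real r ^ n) * \<zeta> ^ n)" for \<zeta> N
    by (simp add: power_mult_distrib mult.assoc)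
  have "(\<lambda>N. (\<integral>\<zeta>. (\<Sum>n<N. a n * (of_real r * \<zeta>) ^ n) * cnj \<zeta> ^ n \<partial>circle_measure)) \<longlonglongrightarrow>
     (\<integral>\<zeta>. f (of_real r * \<zeta>) * cnj \<zeta> ^ n \<partial>circle_measure)"
  proof (rule integral_dominated_convergence[where w = "\<lambda>_. \<Sum>n. cmod (a n) * r ^ n"])
    show "AE \<zeta> in circle_measure. (\<lambda>N. (\<Sum>n<N. a n * (of_real r * \<zeta>) ^ n) * cnj \<zeta> ^ n) \<longlonglongrightarrow> f (of_real r * \<zeta>) * cnj \<zeta> ^ n"
      using AE_circle_norm by eventually_elim (intro tendsto_intros lim)
    show "AE \<zeta> in circle_measure. norm ((\<Sum>n<N. a n * (of_real r * \<zeta>) ^ n) * cnj \<zeta> ^ n) \<le> (\<Sum>n. cmod (a n) * r ^ n)" for N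
      using AE_circle_norm by eventually_elim (use bd in \<open>auto simp: norm_mult norm_power\<close>)
  qed auto
  moreover have "(\<integral>\<zeta>. (\<Sum>n<N. a n * (of_real r * \<zeta>) ^ n) * cnj \<zeta> ^ n \<partial>circle_measure) =
      (if n < N then a n * of_real r ^ n else 0)" for N
    using fourier_coeff_power_sum[of "{..<N}" "\<lambda>n. a n * of_real r ^ n" n]
    by (simp add: fourier_coeff_alt eq)
  ultimately have "(\<lambda>N. if n < N then a n * of_real r ^ n else 0) \<longlonglongrightarrow> fourier_coeff (\<lambda>\<zeta>. f (of_real r * \<zeta>)) n"
    by (simp add: fourier_coeff_alt)
  moreover have "(\<lambda>N. if n < N then a n * of_real r ^ n else 0) \<longlonglongrightarrow> a n * of_real r ^ n"
    by (rule tendsto_eventually) (use eventually_gt_at_top[of n] in eventually_elim, simp)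
  ultimately show "fourier_coeff (\<lambda>\<zeta>. f (of_real r * \<zeta>)) n = a n * of_real r ^ n"
    by (rule LIMSEQ_unique)
  have "(\<lambda>N. (\<integral>\<zeta>. (cmod (\<Sum>n<N. a n * (of_real r * \<zeta>) ^ n))\<^sup>2 \<partial>circle_measure)) \<longlonglongrightarrow>
     (\<integral>\<zeta>. (cmod (f (of_real r * \<zeta>)))\<^sup>2 \<partial>circle_measure)"
  proof (rule integral_dominated_convergence[where w = "\<lambda>_. (\<Sum>n. cmod (a n) * r ^ n)\<^sup>2"])
    show "AE \<zeta> in circle_measure. (\<lambda>N. (cmod (\<Sum>n<N. a n * (of_real r * \<zeta>) ^ n))\<^sup>2) \<longlonglongrightarrow> (cmod (f (of_real r * \<zeta>)))\<^sup>2"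
      using AE_circle_norm by eventually_elim (intro tendsto_intros lim)
    show "AE \<zeta> in circle_measure. norm ((cmod (\<Sum>n<N. a n * (of_real r * \<zeta>) ^ n))\<^sup>2) \<le> (\<Sum>n. cmod (a n) * r ^ n)\<^sup>2" for N
      using AE_circle_norm by eventually_elim (use bd in \<open>auto intro!: power_mono\<close>)
  qed auto
  moreover have "(\<integral>\<zeta>. (cmod (\<Sum>n<N. a n * (of_real r * \<zeta>) ^ n))\<^sup>2 \<partial>circle_measure) = (\<Sum>n<N. (cmod (a n))\<^sup>2 * (r ^ n)\<^sup>2)" for N
    unfolding eq using L2_norm_power_sum[of "{..<N}" "\<lambda>n. a n * of_real r ^ n"] r
    unfolding L2_norm_square by (simp add: norm_mult norm_power power_mult_distrib)
  ultimately show "(L2_norm (\<lambda>\<zeta>. f (of_real r * \<zeta>)))\<^sup>2 = (\<Sum>n. (cmod (a n))\<^sup>2 * (r ^ n)\<^sup>2)"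
    unfolding L2_norm_square by (simp add: sums_def[symmetric] sums_iff)
qed

text \<open>Bessel's inequality on the slices bounds every finite section uniformly in
  \<open>r\<close>; then let \<open>r\<close> tend to 1 in the finite sum.\<close>

lemma H2_coeff_summable:
  assumes f: "f \<in> H2"
  shows "summable (\<lambda>n. (cmod (taylor_coeff f n))\<^sup>2)"
proof -
  note sums = taylor_coeff_sums[OF H2_holomorphic[OF f]]
  obtain C where C: "(\<integral>\<zeta>. (cmod (f (of_real r * \<zeta>)))\<^sup>2 \<partial>circle_measure) \<le> C" if "r \<in> {0..<1}" for r
    using f by (force simp: H2_def bdd_above_def)
  have "(\<Sum>n<N. (cmod (taylor_coeff f n))\<^sup>2) \<le> C" for N
  proof (rule tendsto_upperbound)
    have "((\<lambda>r::real. \<Sum>n<N. (cmod (taylor_coeff f n))\<^sup>2 * (r ^ n)\<^sup>2) \<longlongrightarrow> (\<Sum>n<N. (cmod (taylor_coeff f n))\<^sup>2 * (1 ^ n)\<^sup>2)) (at_left 1)"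
      by (intro tendsto_intros)
    then show "((\<lambda>r::real. \<Sum>n<N. (cmod (taylor_coeff f n))\<^sup>2 * (r ^ n)\<^sup>2) \<longlongrightarrow> (\<Sum>n<N. (cmod (taylor_coeff f n))\<^sup>2)) (at_left 1)"
      by simp
    have "eventually (\<lambda>r. r \<in> {0<..<1}) (at_left (1::real))"
      by (rule eventually_at_left_real) simp
    then show "\<forall>\<^sub>F r in at_left 1. (\<Sum>n<N. (cmod (taylor_coeff f n))\<^sup>2 * (r ^ n)\<^sup>2) \<le> C"
    proof eventually_elim
      case (elim r)
      then have r: "0 \<le> r" "r < 1" by auto
      have "(\<Sum>n<N. (cmod (taylor_coeff f n))\<^sup>2 * (r ^ n)\<^sup>2) = (\<Sum>n<N. (cmod (fourier_coeff (\<lambda>\<zeta>. f (of_real r * \<zeta>)) n))\<^sup>2)"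
        using r by (simp add: power_series_slice_coeff[OF sums H2_measurable[OF f] r] norm_mult norm_power power_mult_distrib)
      also have "\<dots> \<le> (L2_norm (\<lambda>\<zeta>. f (of_real r * \<zeta>)))\<^sup>2"
        by (intro bessel power_series_slice_L2[OF sums H2_measurable[OF f] r]) auto
      also have "\<dots> \<le> C" unfolding L2_norm_square using r by (intro C) auto
      finally show ?case .
    qed
  qed simp
  then show ?thesis
    by (intro summableI_nonneg_bounded[where x = C]) auto
qed

text \<open>Converse of \<open>H2_coeff_summable\<close>. It places sums, the constant 1 and Riesz
  projections in \<open>H2\<close> and reads off their coefficients.\<close>

lemma power_series_H2:
  fixes a :: "nat \<Rightarrow> complex"
  assumes a: "summable (\<lambda>n. (cmod (a n))\<^sup>2)"
    and f: "\<And>z. cmod z < 1 \<Longrightarrow> (\<lambda>n. a n * z ^ n) sums f z" "\<And>z. z \<notin> ball 0 1 \<Longrightarrow> f z = 0"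
  shows "f \<in> H2" "taylor_coeff f = a"
proof -
  have hol: "f holomorphic_on ball 0 1"
    by (rule power_series_holomorphic[where a = a]) (use f(1) in simp)
  then have meas: "f \<in> borel_measurable borel"
    by (intro disc_measurable holomorphic_on_imp_continuous_on f) auto
  have "(\<integral>\<zeta>. (cmod (f (of_real r * \<zeta>)))\<^sup>2 \<partial>circle_measure) \<le> (\<Sum>n. (cmod (a n))\<^sup>2)" if r: "0 \<le> r" "r < 1" for r
  proof -
    have le: "(cmod (a n))\<^sup>2 * (r ^ n)\<^sup>2 \<le> (cmod (a n))\<^sup>2" for n
      using r by (intro mult_right_le_one_le) (auto simp: power_le_one)
    have "(\<Sum>n. (cmod (a n))\<^sup>2 * (r ^ n)\<^sup>2) \<le> (\<Sum>n. (cmod (a n))\<^sup>2)"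
      by (intro suminf_le le a summable_comparison_test'[OF a]) (use le in auto)
    then show ?thesis
      using power_series_slice_norm[OF f(1) meas r] by (simp add: L2_norm_square)
  qed
  then show "f \<in> H2"
    using hol f(2) by (auto simp: H2_def intro!: bdd_aboveI[where M = "\<Sum>n. (cmod (a n))\<^sup>2"])
  \<comment> \<open>Both expansions determine the Fourier coefficients of the slice of radius 1/2,
    an arbitrary choice in the open interval from 0 to 1.\<close>
  have "taylor_coeff f n = a n" for n
    using power_series_slice_coeff[OF f(1) meas, of "1/2" n]
      power_series_slice_coeff[OF taylor_coeff_sums[OF hol] meas, of "1/2" n] by simp
  then show "taylor_coeff f = a" by auto
qed

section \<open>Remainders of the Taylor series and their radial maximal function\<close>

definition partial_sum :: "(complex \<Rightarrow> complex) \<Rightarrow> nat \<Rightarrow> complex \<Rightarrow> complex" where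
  "partial_sum f N z = (\<Sum>n<N. taylor_coeff f n * z ^ n)"

definition coeff_tail :: "(complex \<Rightarrow> complex) \<Rightarrow> nat \<Rightarrow> real" where
  "coeff_tail f N = (\<Sum>n. (cmod (taylor_coeff f (n + N)))\<^sup>2)"

lemma partial_sum_measurable [measurable]: "partial_sum f N \<in> borel_measurable borel"
  unfolding partial_sum_def by measurable

lemma coeff_tail_tendsto_0: "f \<in> H2 \<Longrightarrow> coeff_tail f \<longlonglongrightarrow> 0"
  using suminf_exist_split2[OF H2_coeff_summable] unfolding coeff_tail_def by blast

lemma coeff_sum_le_tail:
  assumes "f \<in> H2"
  shows "(\<Sum>n=N..<M. (cmod (taylor_coeff f n))\<^sup>2) \<le> coeff_tail f N"
proof -
  have "(\<Sum>n=N..<M. (cmod (taylor_coeff f n))\<^sup>2) = (\<Sum>n<M - N. (cmod (taylor_coeff f (n + N)))\<^sup>2)"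
    by (cases "N \<le> M") (use sum.shift_bounds_nat_ivl[of "\<lambda>n. (cmod (taylor_coeff f n))\<^sup>2" 0 N "M - N"] in \<open>auto simp: atLeast0LessThan\<close>)
  also have "\<dots> \<le> coeff_tail f N"
    unfolding coeff_tail_def
    by (intro sum_le_suminf summable_ignore_initial_segment H2_coeff_summable assms) auto
  finally show ?thesis .
qed

text \<open>The maximal bound holds for the sections from \<open>N\<close> to \<open>M - 1\<close>
  of the series; Fatou's lemma for integrals lets \<open>M\<close> tend to infinity.\<close>

lemma remainder_linearised_bound:
  fixes \<rho> :: "complex \<Rightarrow> real"
  assumes f: "f \<in> H2" and [measurable]: "\<rho> \<in> borel_measurable borel"
    and \<rho>: "\<And>\<zeta>. 0 \<le> \<rho> \<zeta>" "\<And>\<zeta>. \<rho> \<zeta> \<le> R" "R < 1"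
  shows "(\<integral>\<^sup>+\<zeta>. ennreal ((cmod (f (\<rho> \<zeta> * \<zeta>) - partial_sum f N (\<rho> \<zeta> * \<zeta>)))\<^sup>2) \<partial>circle_measure) \<le> ennreal (256 * coeff_tail f N)"
proof -
  note [measurable] = H2_measurable[OF f]
  define u where "u M \<zeta> = ennreal ((cmod (\<Sum>n=N..<M. taylor_coeff f n * (\<rho> \<zeta> * \<zeta>) ^ n))\<^sup>2)" for M and \<zeta> :: complex
  have [measurable]: "u M \<in> borel_measurable borel" for M
    unfolding u_def by measurable
  have "(\<integral>\<^sup>+\<zeta>. ennreal ((cmod (f (\<rho> \<zeta> * \<zeta>) - partial_sum f N (\<rho> \<zeta> * \<zeta>)))\<^sup>2) \<partial>circle_measure) =
    (\<integral>\<^sup>+\<zeta>. liminf (\<lambda>M. u M \<zeta>) \<partial>circle_measure)"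
  proof (rule nn_integral_cong_AE, use AE_circle_norm in eventually_elim)
    case (elim \<zeta>)
    let ?z = "complex_of_real (\<rho> \<zeta>) * \<zeta>"
    have "cmod ?z < 1" using elim \<rho>(1)[of \<zeta>] \<rho>(2)[of \<zeta>] \<rho>(3) by (simp add: norm_mult)
    from taylor_coeff_sums[OF H2_holomorphic[OF f] this]
    have "(\<lambda>M. partial_sum f M ?z) \<longlonglongrightarrow> f ?z"
      by (simp add: partial_sum_def sums_def)
    then have "(\<lambda>M. partial_sum f M ?z - partial_sum f N ?z) \<longlonglongrightarrow> f ?z - partial_sum f N ?z"
      by (intro tendsto_intros)
    moreover have "\<forall>\<^sub>F M in sequentially. partial_sum f M ?z - partial_sum f N ?z = (\<Sum>n=N..<M. taylor_coeff f n * ?z ^ n)"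
      using eventually_ge_at_top[of N]
      by eventually_elim (simp add: partial_sum_def sum_diff_nat_ivl lessThan_atLeast0)
    ultimately have "(\<lambda>M. \<Sum>n=N..<M. taylor_coeff f n * ?z ^ n) \<longlonglongrightarrow> f ?z - partial_sum f N ?z"
      by (rule Lim_transform_eventually)
    then have "(\<lambda>M. u M \<zeta>) \<longlonglongrightarrow> ennreal ((cmod (f ?z - partial_sum f N ?z))\<^sup>2)"
      unfolding u_def by (intro tendsto_ennrealI tendsto_power tendsto_norm)
    from lim_imp_Liminf[OF _ this] show ?case by simp
  qed
  also have "\<dots> \<le> liminf (\<lambda>M. \<integral>\<^sup>+\<zeta>. u M \<zeta> \<partial>circle_measure)"
    by (rule nn_integral_liminf) measurable
  also have "\<dots> \<le> liminf (\<lambda>M. ennreal (256 * coeff_tail f N))"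
  proof (intro Liminf_mono always_eventually allI)
    fix M
    have "(\<integral>\<^sup>+\<zeta>. u M \<zeta> \<partial>circle_measure) \<le> ennreal (256 * (\<Sum>n=N..<M. (cmod (taylor_coeff f n))\<^sup>2))"
      using power_sum_maximal_bound[of \<rho> R "{N..<M}" "taylor_coeff f"] \<rho>
      by (simp add: u_def ennreal_power)
    also have "\<dots> \<le> ennreal (256 * coeff_tail f N)"
      by (intro ennreal_leI mult_left_mono coeff_sum_le_tail f) auto
    finally show "(\<integral>\<^sup>+\<zeta>. u M \<zeta> \<partial>circle_measure) \<le> ennreal (256 * coeff_tail f N)" .
  qed
  also have "\<dots> = ennreal (256 * coeff_tail f N)" by (simp add: Liminf_const)
  finally show ?thesis .
qed

text \<open>With countably many radii the maximal function is visibly measurable, and continuity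
  along the radius recovers the remaining ones.\<close>

definition radius_enum :: "nat \<Rightarrow> real" where
  "radius_enum = from_nat_into (\<rat> \<inter> {0..<1})"

lemma radius_enum_range: "range radius_enum = \<rat> \<inter> {0..<1}"
proof -
  have "0 \<in> \<rat> \<inter> {0..<1::real}" by simp
  then show ?thesis
    unfolding radius_enum_def by (intro range_from_nat_into) (auto intro: countable_Int1 countable_rat)
qed

lemma radius_enum_bounds: "0 \<le> radius_enum i" "radius_enum i < 1"
  using radius_enum_range rangeI[of radius_enum i] by auto

text \<open>The lower end \<open>a\<close> is -1 where a bound is known on the whole radius, and
  \<open>1 - 1 / Suc m\<close> in the Cauchy criterion for radial limits.\<close>

lemma radius_enum_dense:
  fixes \<phi> :: "real \<Rightarrow> complex"
  assumes cont: "continuous_on {0..<1} \<phi>" and le: "\<And>i. a < radius_enum i \<Longrightarrow> cmod (\<phi> (radius_enum i)) \<le> C"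
    and r: "a < r" "0 \<le> r" "r < 1"
  shows "cmod (\<phi> r) \<le> C"
proof (rule ccontr)
  assume *: "\<not> cmod (\<phi> r) \<le> C"
  have "((\<lambda>s. cmod (\<phi> s)) \<longlongrightarrow> cmod (\<phi> r)) (at r within {0..<1})"
    using cont r by (intro tendsto_norm) (auto simp: continuous_on_def)
  then have "\<forall>\<^sub>F s in at r within {0..<1}. C < cmod (\<phi> s)"
    using * by (intro order_tendstoD) auto
  then obtain d where d: "d > 0" "\<And>s. s \<in> {0..<1} \<Longrightarrow> s \<noteq> r \<Longrightarrow> dist s r < d \<Longrightarrow> C < cmod (\<phi> s)"
    by (auto simp: eventually_at)
  \<comment> \<open>The rational is taken to the right of \<open>r\<close>, so that it also lies
    above \<open>a\<close>.\<close>
  obtain s where s: "s \<in> \<rat>" "r < s" "s < min (r + d) 1"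
    using Rats_dense_in_real[of r "min (r + d) 1"] d(1) r by auto
  then have "s \<in> range radius_enum" unfolding radius_enum_range using r by auto
  then obtain i where "s = radius_enum i" by auto
  with le[of i] d(2)[of s] s r show False by (auto simp: dist_real_def)
qed

text \<open>The best of finitely many radii can be chosen measurably by comparing with one further
  radius at a time. Finitely many radii also have a common bound \<open>R\<close> below 1.\<close>

lemma radius_selection:
  fixes \<phi> :: "real \<Rightarrow> complex \<Rightarrow> real"
  assumes [measurable]: "\<And>\<rho>. \<rho> \<in> borel_measurable borel \<Longrightarrow> (\<lambda>\<zeta>. \<phi> (\<rho> \<zeta>) \<zeta>) \<in> borel_measurable borel"
  shows "\<exists>\<rho> R. \<rho> \<in> borel_measurable borel \<and> R < 1 \<and> (\<forall>\<zeta>. 0 \<le> \<rho> \<zeta> \<and> \<rho> \<zeta> \<le> R) \<and>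
    (\<forall>\<zeta>. \<forall>i\<le>n. \<phi> (radius_enum i) \<zeta> \<le> \<phi> (\<rho> \<zeta>) \<zeta>)"
proof (induction n)
  case 0
  show ?case
    by (rule exI[of _ "\<lambda>_. radius_enum 0"], rule exI[of _ "radius_enum 0"]) (use radius_enum_bounds in auto)
next
  case (Suc n)
  then obtain \<rho> R where [measurable]: "\<rho> \<in> borel_measurable borel" and
    \<rho>: "R < 1" "\<And>\<zeta>. 0 \<le> \<rho> \<zeta>" "\<And>\<zeta>. \<rho> \<zeta> \<le> R" "\<And>\<zeta> i. i \<le> n \<Longrightarrow> \<phi> (radius_enum i) \<zeta> \<le> \<phi> (\<rho> \<zeta>) \<zeta>"
    by blast
  let ?q = "radius_enum (Suc n)"
  define \<rho>' where "\<rho>' \<zeta> = (if \<phi> (\<rho> \<zeta>) \<zeta> < \<phi> ?q \<zeta> then ?q else \<rho> \<zeta>)" for \<zeta>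
  have "\<rho>' \<in> borel_measurable borel" unfolding \<rho>'_def by measurable
  moreover have "max R ?q < 1" using \<rho> radius_enum_bounds by auto
  moreover have "\<forall>\<zeta>. 0 \<le> \<rho>' \<zeta> \<and> \<rho>' \<zeta> \<le> max R ?q"
    using \<rho> radius_enum_bounds by (auto simp: \<rho>'_def le_max_iff_disj)
  moreover have "\<forall>\<zeta>. \<forall>i\<le>Suc n. \<phi> (radius_enum i) \<zeta> \<le> \<phi> (\<rho>' \<zeta>) \<zeta>"
    using \<rho>(4) by (auto simp: \<rho>'_def le_Suc_eq) (meson le_less_trans less_imp_le)
  ultimately show ?case by blast
qed

definition max_remainder :: "(complex \<Rightarrow> complex) \<Rightarrow> nat \<Rightarrow> complex \<Rightarrow> ennreal" where
  "max_remainder f N \<zeta> = (SUP i. ennreal ((cmod (f (of_real (radius_enum i) * \<zeta>) - partial_sum f N (of_real (radius_enum i) * \<zeta>)))\<^sup>2))"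

lemma max_remainder_measurable [measurable]:
  assumes "f \<in> H2"
  shows "max_remainder f N \<in> borel_measurable borel"
proof -
  note [measurable] = H2_measurable[OF assms]
  show ?thesis unfolding max_remainder_def by measurable
qed

text \<open>Monotone convergence reduces the supremum to finitely many radii. For these a measurable
  choice of radius does at least as well as each of them, and the linearised bound is independent of
  that choice.\<close>

lemma nn_integral_max_remainder:
  assumes f: "f \<in> H2"
  shows "(\<integral>\<^sup>+\<zeta>. max_remainder f N \<zeta> \<partial>circle_measure) \<le> ennreal (256 * coeff_tail f N)"
proof -
  note [measurable] = H2_measurable[OF f]
  define \<phi> where "\<phi> r \<zeta> = (cmod (f (of_real r * \<zeta>) - partial_sum f N (of_real r * \<zeta>)))\<^sup>2" for r and \<zeta> :: complex
  have \<phi>_meas [measurable]: "(\<lambda>\<zeta>. \<phi> (\<rho> \<zeta>) \<zeta>) \<in> borel_measurable borel" if [measurable]: "\<rho> \<in> borel_measurable borel" for \<rho>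
    unfolding \<phi>_def by measurable
  define e where "e n \<zeta> = (SUP i\<in>{..n}. ennreal (\<phi> (radius_enum i) \<zeta>))" for n \<zeta>
  have [measurable]: "e n \<in> borel_measurable borel" for n
    unfolding e_def by measurable
  have "max_remainder f N \<zeta> = (SUP n. e n \<zeta>)" for \<zeta>
    unfolding max_remainder_def e_def \<phi>_def
    by (rule antisym) (auto intro!: SUP_least intro: SUP_upper SUP_upper2)
  then have "(\<integral>\<^sup>+\<zeta>. max_remainder f N \<zeta> \<partial>circle_measure) = (\<integral>\<^sup>+\<zeta>. (SUP n. e n \<zeta>) \<partial>circle_measure)"
    by simp
  also have "\<dots> = (SUP n. \<integral>\<^sup>+\<zeta>. e n \<zeta> \<partial>circle_measure)"
  proof (rule nn_integral_monotone_convergence_SUP)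
    show "incseq e" unfolding e_def by (auto intro!: incseq_SucI le_funI SUP_subset_mono)
  qed measurable
  also have "\<dots> \<le> ennreal (256 * coeff_tail f N)"
  proof (rule SUP_least)
    fix n
    obtain \<rho> R where [measurable]: "\<rho> \<in> borel_measurable borel" and
      \<rho>: "R < 1" "\<And>\<zeta>. 0 \<le> \<rho> \<zeta>" "\<And>\<zeta>. \<rho> \<zeta> \<le> R" "\<And>\<zeta> i. i \<le> n \<Longrightarrow> \<phi> (radius_enum i) \<zeta> \<le> \<phi> (\<rho> \<zeta>) \<zeta>"
      using radius_selection[of \<phi> n] \<phi>_meas by blast
    have "(\<integral>\<^sup>+\<zeta>. e n \<zeta> \<partial>circle_measure) \<le> (\<integral>\<^sup>+\<zeta>. ennreal (\<phi> (\<rho> \<zeta>) \<zeta>) \<partial>circle_measure)"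
      unfolding e_def by (intro nn_integral_mono SUP_least ennreal_leI \<rho>) auto
    also have "\<dots> \<le> ennreal (256 * coeff_tail f N)"
      unfolding \<phi>_def using \<rho> by (intro remainder_linearised_bound[OF f, of \<rho> R]) auto
    finally show "(\<integral>\<^sup>+\<zeta>. e n \<zeta> \<partial>circle_measure) \<le> ennreal (256 * coeff_tail f N)" .
  qed
  finally show ?thesis .
qed

section \<open>Radial limits\<close>

lemma H2_continuous_radius:
  assumes "f \<in> H2" "cmod \<zeta> = 1"
  shows "continuous_on {0..<1} (\<lambda>r::real. f (of_real r * \<zeta>))"
  using assms(2)
  by (intro continuous_on_compose2[OF holomorphic_on_imp_continuous_on[OF H2_holomorphic[OF assms(1)]]] continuous_intros)
    (auto simp: norm_mult)

lemma max_remainder_bound: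
  assumes f: "f \<in> H2" and \<zeta>: "cmod \<zeta> = 1" and bd: "max_remainder f N \<zeta> \<le> ennreal (C\<^sup>2)" "0 \<le> C"
    and r: "0 \<le> r" "r < 1"
  shows "cmod (f (of_real r * \<zeta>) - partial_sum f N (of_real r * \<zeta>)) \<le> C"
proof (rule radius_enum_dense[where a = "-1"])
  show "continuous_on {0..<1} (\<lambda>r::real. f (of_real r * \<zeta>) - partial_sum f N (of_real r * \<zeta>))"
    unfolding partial_sum_def by (intro continuous_intros H2_continuous_radius f \<zeta>)
  fix i
  have "ennreal ((cmod (f (of_real (radius_enum i) * \<zeta>) - partial_sum f N (of_real (radius_enum i) * \<zeta>)))\<^sup>2) \<le> ennreal (C\<^sup>2)"
    using bd(1) unfolding max_remainder_def by (rule order_trans[OF SUP_upper[OF UNIV_I]])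
  then show "cmod (f (of_real (radius_enum i) * \<zeta>) - partial_sum f N (of_real (radius_enum i) * \<zeta>)) \<le> C"
    using bd(2) by (simp add: power2_le_iff_abs_le)
qed (use r in auto)

lemma eventually_at_left_1: "(\<And>r. 0 \<le> r \<Longrightarrow> r < 1 \<Longrightarrow> P r) \<Longrightarrow> \<forall>\<^sub>F r in at_left (1::real). P r"
  using eventually_at_left_real[of 0 "1::real"] by (auto elim!: eventually_mono)

text \<open>The infimum lies below every \<open>max_remainder f N\<close>, so its integral is at
  most 256 times each coefficient tail.\<close>

lemma AE_INF_max_remainder:
  assumes f: "f \<in> H2"
  shows "AE \<zeta> in circle_measure. (INF N. max_remainder f N \<zeta>) = 0"
proof -
  note [measurable] = max_remainder_measurable[OF f]
  have "(\<integral>\<^sup>+\<zeta>. (INF N. max_remainder f N \<zeta>) \<partial>circle_measure) \<le> ennreal (256 * coeff_tail f N)" for N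
    using nn_integral_max_remainder[OF f, of N]
    by (rule order_trans[rotated]) (intro nn_integral_mono INF_lower UNIV_I)
  moreover have "(\<lambda>N. ennreal (256 * coeff_tail f N)) \<longlonglongrightarrow> ennreal (256 * 0)"
    by (intro tendsto_ennrealI tendsto_intros coeff_tail_tendsto_0 f)
  ultimately have "(\<integral>\<^sup>+\<zeta>. (INF N. max_remainder f N \<zeta>) \<partial>circle_measure) \<le> ennreal (256 * 0)"
    by (intro LIMSEQ_le_const) auto
  then have "(\<integral>\<^sup>+\<zeta>. (INF N. max_remainder f N \<zeta>) \<partial>circle_measure) = 0" by simp
  then show ?thesis
    by (subst (asm) nn_integral_0_iff_AE) auto
qed

text \<open>A small maximal remainder means that \<open>f\<close> is uniformly close on the whole
  radius to a polynomial, and polynomials are continuous up to the boundary. Hence \<open>f\<close>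
  is Cauchy along the radius.\<close>

lemma radial_limit_exists:
  assumes f: "f \<in> H2" and \<zeta>: "cmod \<zeta> = 1" and inf: "(INF N. max_remainder f N \<zeta>) = 0"
  shows "\<exists>l. ((\<lambda>r::real. f (of_real r * \<zeta>)) \<longlongrightarrow> l) (at_left 1)"
proof -
  let ?F = "filtermap (\<lambda>r::real. f (of_real r * \<zeta>)) (at_left 1)"
  have "cauchy_filter ?F"
    unfolding cauchy_filter_metric_filtermap
  proof (intro allI impI)
    fix e :: real assume e: "e > 0"
    have "(INF N. max_remainder f N \<zeta>) < ennreal ((e/4)\<^sup>2)"
      unfolding inf using e by simp
    then obtain N where N: "max_remainder f N \<zeta> < ennreal ((e/4)\<^sup>2)"
      by (auto simp: INF_less_iff)
    have "((\<lambda>r. partial_sum f N (of_real r * \<zeta>)) \<longlongrightarrow> partial_sum f N (of_real 1 * \<zeta>)) (at_left 1)"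
      unfolding partial_sum_def by (intro tendsto_intros)
    then have "\<forall>\<^sub>F r in at_left 1. dist (partial_sum f N (of_real r * \<zeta>)) (partial_sum f N \<zeta>) < e/4"
      using e by (intro tendstoD) auto
    moreover have "\<forall>\<^sub>F r in at_left (1::real). cmod (f (of_real r * \<zeta>) - partial_sum f N (of_real r * \<zeta>)) \<le> e/4"
      using e by (intro eventually_at_left_1 max_remainder_bound f \<zeta> less_imp_le[OF N]) auto
    ultimately have ev: "\<forall>\<^sub>F r in at_left 1. dist (f (of_real r * \<zeta>)) (partial_sum f N \<zeta>) < e/2"
    proof eventually_elim
      case (elim r)
      have "dist (f (of_real r * \<zeta>)) (partial_sum f N \<zeta>) \<le>
        dist (f (of_real r * \<zeta>)) (partial_sum f N (of_real r * \<zeta>)) + dist (partial_sum f N (of_real r * \<zeta>)) (partial_sum f N \<zeta>)"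
        by (rule dist_triangle)
      also have "\<dots> < e/4 + e/4"
        using elim by (intro add_le_less_mono) (simp_all add: dist_norm)
      finally show ?case by simp
    qed
    show "\<exists>P. eventually P (at_left 1) \<and> (\<forall>x y. P x \<and> P y \<longrightarrow> dist (f (of_real x * \<zeta>)) (f (of_real y * \<zeta>)) < e)"
      by (rule exI[of _ "\<lambda>r. dist (f (of_real r * \<zeta>)) (partial_sum f N \<zeta>) < e/2"])
        (use ev in \<open>auto intro: dist_triangle_half_l\<close>)
  qed
  moreover have "?F \<le> principal UNIV" "?F \<noteq> bot" by (auto simp: filtermap_bot_iff)
  ultimately obtain l where "?F \<le> nhds l"
    using complete_UNIV[where 'a = complex] unfolding complete_uniform by blast
  then show ?thesis unfolding filterlim_def by blast
qed

lemma tendsto_radial_bv: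
  assumes "((\<lambda>r::real. f (of_real r * \<zeta>)) \<longlongrightarrow> l) (at_left 1)"
  shows "radial_bv f \<zeta> = l"
  unfolding radial_bv_def using assms by (intro tendsto_Lim) auto

theorem fatou_radial_limit:
  assumes "f \<in> H2"
  shows "AE \<zeta> in circle_measure. ((\<lambda>r::real. f (of_real r * \<zeta>)) \<longlongrightarrow> radial_bv f \<zeta>) (at_left 1)"
  using AE_INF_max_remainder[OF assms] AE_circle_norm
proof eventually_elim
  case (elim \<zeta>)
  then obtain l where "((\<lambda>r::real. f (of_real r * \<zeta>)) \<longlongrightarrow> l) (at_left 1)"
    using radial_limit_exists[OF assms] by blast
  then show ?case using tendsto_radial_bv by metis
qed

text \<open>Expresses the existence of the radial limit through countably many radii, which makes
  the set of boundary points with a radial limit measurable.\<close>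

lemma radial_cauchy_iff:
  assumes f: "f \<in> H2" and \<zeta>: "cmod \<zeta> = 1"
  shows "(\<exists>l. ((\<lambda>r::real. f (of_real r * \<zeta>)) \<longlongrightarrow> l) (at_left 1)) \<longleftrightarrow>
    (\<forall>k::nat. \<exists>m::nat. \<forall>i j. 1 - 1 / real (Suc m) < radius_enum i \<longrightarrow> 1 - 1 / real (Suc m) < radius_enum j \<longrightarrow>
      cmod (f (of_real (radius_enum i) * \<zeta>) - f (of_real (radius_enum j) * \<zeta>)) \<le> 1 / real (Suc k))"
    (is "_ \<longleftrightarrow> ?R")
proof
  assume "\<exists>l. ((\<lambda>r::real. f (of_real r * \<zeta>)) \<longlongrightarrow> l) (at_left 1)"
  then obtain l where l: "((\<lambda>r::real. f (of_real r * \<zeta>)) \<longlongrightarrow> l) (at_left 1)" ..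
  show ?R
  proof
    fix k :: nat
    have "\<forall>\<^sub>F r in at_left 1. dist (f (of_real r * \<zeta>)) l < 1 / real (Suc k) / 2"
      using l by (rule tendstoD) auto
    then obtain b where b: "b < 1" "\<And>r. b < r \<Longrightarrow> r < 1 \<Longrightarrow> dist (f (of_real r * \<zeta>)) l < 1 / real (Suc k) / 2"
      by (auto simp: eventually_at_left_field)
    obtain m where m: "1 / real (Suc m) < 1 - b"
      using b(1) nat_approx_posE[of "1 - b"] by auto
    show "\<exists>m::nat. \<forall>i j. 1 - 1 / real (Suc m) < radius_enum i \<longrightarrow> 1 - 1 / real (Suc m) < radius_enum j \<longrightarrow>
      cmod (f (of_real (radius_enum i) * \<zeta>) - f (of_real (radius_enum j) * \<zeta>)) \<le> 1 / real (Suc k)"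
    proof (intro exI[of _ m] allI impI)
      fix i j assume "1 - 1 / real (Suc m) < radius_enum i" "1 - 1 / real (Suc m) < radius_enum j"
      with m have "dist (f (of_real (radius_enum i) * \<zeta>)) l < 1 / real (Suc k) / 2"
        "dist (f (of_real (radius_enum j) * \<zeta>)) l < 1 / real (Suc k) / 2"
        using radius_enum_bounds b(2)[of "radius_enum i"] b(2)[of "radius_enum j"] by simp_all
      then have "dist (f (of_real (radius_enum i) * \<zeta>)) (f (of_real (radius_enum j) * \<zeta>)) < 1 / real (Suc k)"
        by (rule dist_triangle_half_l)
      then show "cmod (f (of_real (radius_enum i) * \<zeta>) - f (of_real (radius_enum j) * \<zeta>)) \<le> 1 / real (Suc k)"
        by (simp add: dist_norm)
    qed
  qed
next
  assume R: ?R
  have cont: "continuous_on {0..<1} (\<lambda>r::real. f (of_real r * \<zeta>))"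
    by (rule H2_continuous_radius[OF f \<zeta>])
  let ?F = "filtermap (\<lambda>r::real. f (of_real r * \<zeta>)) (at_left 1)"
  have "cauchy_filter ?F"
    unfolding cauchy_filter_metric_filtermap
  proof (intro allI impI)
    fix e :: real assume "e > 0"
    then obtain k where k: "1 / real (Suc k) < e" using nat_approx_posE by blast
    from R obtain m :: nat where m: "\<And>i j. 1 - 1 / real (Suc m) < radius_enum i \<Longrightarrow> 1 - 1 / real (Suc m) < radius_enum j \<Longrightarrow>
      cmod (f (of_real (radius_enum i) * \<zeta>) - f (of_real (radius_enum j) * \<zeta>)) \<le> 1 / real (Suc k)" by blast
    let ?a = "1 - 1 / real (Suc m)"
    have a: "0 \<le> ?a" by simp
    have 1: "cmod (f (of_real r * \<zeta>) - f (of_real (radius_enum j) * \<zeta>)) \<le> 1 / real (Suc k)"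
      if "?a < r" "r < 1" "?a < radius_enum j" for r j
      using radius_enum_dense[OF continuous_on_diff[OF cont continuous_on_const] m[OF _ that(3)] that(1) _ that(2)]
        that a by simp
    have 2: "cmod (f (of_real r * \<zeta>) - f (of_real s * \<zeta>)) \<le> 1 / real (Suc k)"
      if "?a < r" "r < 1" "?a < s" "s < 1" for r s
      using radius_enum_dense[OF continuous_on_diff[OF continuous_on_const cont] 1[OF that(1,2)] that(3) _ that(4)]
        that a by simp
    have "eventually (\<lambda>r. r \<in> {?a<..<1}) (at_left (1::real))"
      by (rule eventually_at_left_real) simp
    then show "\<exists>P. eventually P (at_left 1) \<and> (\<forall>x y. P x \<and> P y \<longrightarrow> dist (f (of_real x * \<zeta>)) (f (of_real y * \<zeta>)) < e)"
      using k 2 by (intro exI[of _ "\<lambda>r. r \<in> {?a<..<1}"] conjI allI impI) (auto simp: dist_norm intro: le_less_trans)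
  qed
  moreover have "?F \<le> principal UNIV" "?F \<noteq> bot" by (auto simp: filtermap_bot_iff)
  ultimately obtain l where "?F \<le> nhds l"
    using complete_UNIV[where 'a = complex] unfolding complete_uniform by blast
  then show "\<exists>l. ((\<lambda>r::real. f (of_real r * \<zeta>)) \<longlongrightarrow> l) (at_left 1)" unfolding filterlim_def by blast
qed

lemma radial_bv_inside:
  assumes f: "f \<in> H2" and "cmod \<zeta> < 1"
  shows "radial_bv f \<zeta> = f \<zeta>"
proof (rule tendsto_radial_bv)
  have "isCont f \<zeta>"
    using assms holomorphic_on_imp_continuous_on[OF H2_holomorphic[OF f]]
    by (simp add: continuous_on_eq_continuous_at)
  then have "((\<lambda>r::real. f (of_real r * \<zeta>)) \<longlongrightarrow> f \<zeta>) (at 1)"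
    by (intro isCont_tendsto_compose[of _ f] ) (auto intro!: tendsto_eq_intros)
  then show "((\<lambda>r::real. f (of_real r * \<zeta>)) \<longlongrightarrow> f \<zeta>) (at_left 1)"
    by (rule tendsto_mono[rotated]) (simp add: at_le)
qed

lemma radial_bv_outside:
  assumes f: "f \<in> H2" and "cmod \<zeta> > 1"
  shows "radial_bv f \<zeta> = 0"
proof (rule tendsto_radial_bv)
  have "eventually (\<lambda>r. r \<in> {1 / cmod \<zeta><..<1}) (at_left (1::real))"
    using assms(2) by (intro eventually_at_left_real) (simp add: divide_less_eq)
  then have "\<forall>\<^sub>F r in at_left 1. f (of_real r * \<zeta>) = 0"
  proof eventually_elim
    case (elim r)
    moreover have "0 < 1 / cmod \<zeta>" using assms(2) by (intro divide_pos_pos) linarith+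
    ultimately have "0 < r" by (metis greaterThanLessThan_iff less_trans)
    moreover have "1 < r * cmod \<zeta>"
      using elim assms(2) pos_divide_less_eq[of "cmod \<zeta>" 1 r] by (cases "\<zeta> = 0") auto
    ultimately show ?case by (intro H2_zero f) (auto simp: norm_mult)
  qed
  then show "((\<lambda>r::real. f (of_real r * \<zeta>)) \<longlongrightarrow> 0) (at_left 1)" by (rule tendsto_eventually)
qed

lemma radial_bv_measurable:
  assumes f: "f \<in> H2"
  shows "radial_bv f \<in> borel_measurable borel"
proof -
  note [measurable] = H2_measurable[OF f]
  define C where "C \<zeta> \<longleftrightarrow> (\<forall>k::nat. \<exists>m::nat. \<forall>i j. 1 - 1 / real (Suc m) < radius_enum i \<longrightarrow> 1 - 1 / real (Suc m) < radius_enum j \<longrightarrow>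
      cmod (f (of_real (radius_enum i) * \<zeta>) - f (of_real (radius_enum j) * \<zeta>)) \<le> 1 / real (Suc k))" for \<zeta>
  have [measurable]: "Measurable.pred borel C"
    unfolding C_def by measurable
  define g where "g \<zeta> = lim (\<lambda>n. f (of_real (1 - 1 / real (Suc n)) * \<zeta>))" for \<zeta>
  have [measurable]: "g \<in> borel_measurable borel"
    unfolding g_def by measurable
  \<comment> \<open>\<open>Lim\<close> is a definite description. Where no limit exists its
    predicate is identically false, so its value is this one constant at every such point.\<close>
  define c where "c = (THE l::complex. False)"
  have "radial_bv f = (\<lambda>\<zeta>. if cmod \<zeta> = 1 then (if C \<zeta> then g \<zeta> else c) else if cmod \<zeta> < 1 then f \<zeta> else 0)"
  proof
    fix \<zeta>
    show "radial_bv f \<zeta> = (if cmod \<zeta> = 1 then (if C \<zeta> then g \<zeta> else c) else if cmod \<zeta> < 1 then f \<zeta> else 0)"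
    proof (cases "cmod \<zeta> = 1")
      case True
      note iff = radial_cauchy_iff[OF f True, folded C_def]
      show ?thesis
      proof (cases "C \<zeta>")
        case C: True
        then obtain l where l: "((\<lambda>r::real. f (of_real r * \<zeta>)) \<longlongrightarrow> l) (at_left 1)"
          using iff by blast
        have "filterlim (\<lambda>n. 1 - 1 / real (Suc n)) (at_left 1) sequentially"
          unfolding filterlim_at
        proof
          show "(\<lambda>n. 1 - 1 / real (Suc n)) \<longlonglongrightarrow> 1"
            using tendsto_diff[OF tendsto_const[of 1] LIMSEQ_inverse_real_of_nat] by (simp add: divide_inverse)
        qed auto
        then have "(\<lambda>n. f (of_real (1 - 1 / real (Suc n)) * \<zeta>)) \<longlonglongrightarrow> l"
          using l by (rule filterlim_compose[rotated])
        then have "g \<zeta> = l" unfolding g_def by (rule limI)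
        then show ?thesis using True C tendsto_radial_bv[OF l] by simp
      next
        case False
        then have "\<not> ((\<lambda>r::real. f (of_real r * \<zeta>)) \<longlongrightarrow> l) (at_left 1)" for l
          using iff by blast
        then have "radial_bv f \<zeta> = c" by (simp add: radial_bv_def t2_space_class.Lim_def c_def)
        then show ?thesis using True False by simp
      qed
    next
      case False
      then show ?thesis
        using radial_bv_inside[OF f, of \<zeta>] radial_bv_outside[OF f, of \<zeta>] by auto
    qed
  qed
  also have "\<dots> \<in> borel_measurable borel" by measurable
  finally show ?thesis .
qed

text \<open>The maximal function dominates the boundary values of the remainder. The partial sums
  therefore converge to \<open>radial_bv f\<close> in L2, and the factor 256 is harmless for
  that.\<close>

lemma radial_bv_remainder:
  assumes f: "f \<in> H2"
  shows "(\<lambda>\<zeta>. radial_bv f \<zeta> - partial_sum f N \<zeta>) \<in> L2_circle"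
    and "(L2_norm (\<lambda>\<zeta>. radial_bv f \<zeta> - partial_sum f N \<zeta>))\<^sup>2 \<le> 256 * coeff_tail f N"
proof -
  note [measurable] = radial_bv_measurable[OF f]
  let ?d = "\<lambda>\<zeta>. radial_bv f \<zeta> - partial_sum f N \<zeta>"
  have "AE \<zeta> in circle_measure. ennreal ((cmod (?d \<zeta>))\<^sup>2) \<le> max_remainder f N \<zeta>"
    using fatou_radial_limit[OF f] AE_circle_norm
  proof eventually_elim
    case (elim \<zeta>)
    show ?case
    proof (cases "max_remainder f N \<zeta>")
      case (real c)
      have "((\<lambda>r. partial_sum f N (of_real r * \<zeta>)) \<longlongrightarrow> partial_sum f N (of_real 1 * \<zeta>)) (at_left 1)"
        unfolding partial_sum_def by (intro tendsto_intros)
      then have "((\<lambda>r. f (of_real r * \<zeta>) - partial_sum f N (of_real r * \<zeta>)) \<longlongrightarrow> ?d \<zeta>) (at_left 1)"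
        using tendsto_diff[OF elim(1)] by simp
      then have "((\<lambda>r. cmod (f (of_real r * \<zeta>) - partial_sum f N (of_real r * \<zeta>))) \<longlongrightarrow> cmod (?d \<zeta>)) (at_left 1)"
        by (rule tendsto_norm)
      then have "cmod (?d \<zeta>) \<le> sqrt c"
        by (rule tendsto_upperbound)
          (use real in \<open>auto intro!: eventually_at_left_1 max_remainder_bound f elim(2)\<close>)
      then have "(cmod (?d \<zeta>))\<^sup>2 \<le> c"
        using power_mono[of "cmod (?d \<zeta>)" "sqrt c" 2] real by simp
      then show ?thesis using real by (simp add: ennreal_leI)
    qed simp
  qed
  then have *: "(\<integral>\<^sup>+\<zeta>. ennreal ((cmod (?d \<zeta>))\<^sup>2) \<partial>circle_measure) \<le> ennreal (256 * coeff_tail f N)"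
    by (rule order_trans[OF nn_integral_mono_AE nn_integral_max_remainder[OF f]])
  have int: "integrable circle_measure (\<lambda>\<zeta>. (cmod (?d \<zeta>))\<^sup>2)"
    by (rule integrableI_bounded) (use * in \<open>auto intro: le_less_trans[OF _ ennreal_less_top]\<close>)
  then show "?d \<in> L2_circle" by (simp add: mem_L2_circle)
  have "0 \<le> coeff_tail f N"
    unfolding coeff_tail_def
    by (intro suminf_nonneg summable_ignore_initial_segment H2_coeff_summable f) auto
  with * show "(L2_norm ?d)\<^sup>2 \<le> 256 * coeff_tail f N"
    unfolding L2_norm_square by (subst (asm) nn_integral_eq_integral[OF int]) auto
qed

section \<open>Hardy spaces and their boundary values\<close>

lemma partial_sum_L2: "partial_sum f N \<in> L2_circle"
  unfolding partial_sum_def by (intro L2_circle_sum L2_circle_cmult L2_circle_power)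

lemma radial_bv_L2:
  assumes "f \<in> H2"
  shows "radial_bv f \<in> L2_circle"
  using L2_circle_add[OF radial_bv_remainder(1)[OF assms, of 0] partial_sum_L2[of f 0]] by simp

lemma radial_bv_remainder_tendsto_0:
  assumes f: "f \<in> H2"
  shows "(\<lambda>N. L2_norm (\<lambda>\<zeta>. radial_bv f \<zeta> - partial_sum f N \<zeta>)) \<longlonglongrightarrow> 0"
proof -
  have "(\<lambda>N. (L2_norm (\<lambda>\<zeta>. radial_bv f \<zeta> - partial_sum f N \<zeta>))\<^sup>2) \<longlonglongrightarrow> 0"
  proof (rule tendsto_sandwich[OF _ _ tendsto_const])
    show "(\<lambda>N. 256 * coeff_tail f N) \<longlonglongrightarrow> 0"
      using tendsto_mult[OF tendsto_const coeff_tail_tendsto_0[OF f]] by simp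
  qed (use radial_bv_remainder(2)[OF f] in auto)
  from tendsto_real_sqrt[OF this] show ?thesis by simp
qed

lemma L2_inner_tendsto:
  assumes "\<And>N. u N \<in> L2_circle" "v \<in> L2_circle" "w \<in> L2_circle"
    and "(\<lambda>N. L2_norm (\<lambda>\<zeta>. v \<zeta> - u N \<zeta>)) \<longlonglongrightarrow> 0"
  shows "(\<lambda>N. L2_inner (u N) w) \<longlonglongrightarrow> L2_inner v w"
proof (rule LIM_zero_cancel, rule Lim_null_comparison)
  have "cmod (L2_inner (u N) w - L2_inner v w) \<le> L2_norm (\<lambda>\<zeta>. v \<zeta> - u N \<zeta>) * L2_norm w" for N
    using cmod_L2_inner_le[OF L2_circle_diff[OF assms(2) assms(1)[of N]] assms(3)]
      L2_inner_diff_left[OF assms(2) assms(1)[of N] assms(3)] by (simp add: norm_minus_commute)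
  then show "\<forall>\<^sub>F N in sequentially. norm (L2_inner (u N) w - L2_inner v w) \<le> L2_norm (\<lambda>\<zeta>. v \<zeta> - u N \<zeta>) * L2_norm w"
    by simp
  show "(\<lambda>N. L2_norm (\<lambda>\<zeta>. v \<zeta> - u N \<zeta>) * L2_norm w) \<longlonglongrightarrow> 0"
    using tendsto_mult[OF assms(4) tendsto_const] by simp
qed

lemma fourier_coeff_radial_bv:
  assumes f: "f \<in> H2"
  shows "fourier_coeff (radial_bv f) n = taylor_coeff f n"
proof -
  have "(\<lambda>N. L2_inner (partial_sum f N) (\<lambda>\<zeta>. \<zeta> ^ n)) \<longlonglongrightarrow> L2_inner (radial_bv f) (\<lambda>\<zeta>. \<zeta> ^ n)"
    by (intro L2_inner_tendsto partial_sum_L2 radial_bv_L2 f L2_circle_power radial_bv_remainder_tendsto_0)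
  moreover have "L2_inner (partial_sum f N) (\<lambda>\<zeta>. \<zeta> ^ n) = (if n < N then taylor_coeff f n else 0)" for N
    using fourier_coeff_power_sum[of "{..<N}" "taylor_coeff f" n]
    by (simp add: fourier_coeff_def partial_sum_def[abs_def])
  moreover have "(\<lambda>N. if n < N then taylor_coeff f n else 0) \<longlonglongrightarrow> taylor_coeff f n"
    by (rule tendsto_eventually) (use eventually_gt_at_top[of n] in eventually_elim, simp)
  ultimately show ?thesis
    unfolding fourier_coeff_def using LIMSEQ_unique by fastforce
qed

lemma H2_reproducing:
  assumes f: "f \<in> H2" and z: "cmod z < 1"
  shows "f z = (\<integral>\<eta>. radial_bv f \<eta> * szego z \<eta> \<partial>circle_measure)"
  using sums_szego[OF L2_circle_integrable[OF radial_bv_L2[OF f]] z]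
    taylor_coeff_sums[OF H2_holomorphic[OF f] z]
  by (simp add: fourier_coeff_radial_bv[OF f] sums_unique2)

text \<open>Stated with the L1 norm because the density in
  \<open>square_root_kernel_estimate\<close> is controlled, uniformly in \<open>N\<close>, as a
  product of two L2 functions.\<close>

lemma H2_eval_bound:
  assumes u: "u \<in> borel_measurable borel" "integrable circle_measure u" and z: "cmod z < 1"
  shows "cmod (\<integral>\<eta>. u \<eta> * szego z \<eta> \<partial>circle_measure) \<le> (\<integral>\<eta>. cmod (u \<eta>) \<partial>circle_measure) / (1 - cmod z)"
proof -
  note [measurable] = u(1)
  have "cmod (\<integral>\<eta>. u \<eta> * szego z \<eta> \<partial>circle_measure) \<le> (\<integral>\<eta>. cmod (u \<eta> * szego z \<eta>) \<partial>circle_measure)"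
    by (rule integral_norm_bound)
  also have "\<dots> \<le> (\<integral>\<eta>. cmod (u \<eta>) * (1 / (1 - cmod z)) \<partial>circle_measure)"
  proof (rule integral_mono_AE')
    show "integrable circle_measure (\<lambda>\<eta>. cmod (u \<eta>) * (1 / (1 - cmod z)))" using u by auto
    show "AE \<eta> in circle_measure. cmod (u \<eta> * szego z \<eta>) \<le> cmod (u \<eta>) * (1 / (1 - cmod z))"
      using AE_circle_norm
      by eventually_elim (unfold norm_mult, intro mult_left_mono cmod_szego_le z, auto)
  qed (use z in auto)
  finally show ?thesis by simp
qed

lemma H2_eval_norm_bound:
  assumes f: "f \<in> H2" and z: "cmod z < 1"
  shows "cmod (f z) \<le> L2_norm (radial_bv f) / (1 - cmod z)"
proof -
  have "cmod (f z) \<le> (\<integral>\<eta>. cmod (radial_bv f \<eta>) \<partial>circle_measure) / (1 - cmod z)"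
    unfolding H2_reproducing[OF f z]
    by (intro H2_eval_bound L2_circle_integrable radial_bv_L2 radial_bv_measurable f z)
  also have "\<dots> \<le> L2_norm (radial_bv f) / (1 - cmod z)"
    using L2_norm_mult_le[OF radial_bv_L2[OF f] L2_circle_power[of 0]] z
    by (intro divide_right_mono) (simp_all add: L2_norm_def)
  finally show ?thesis .
qed

lemma H2_eq_0:
  assumes "f \<in> H2" "L2_norm (radial_bv f) = 0"
  shows "f = (\<lambda>_. 0)"
proof
  fix z show "f z = 0"
    using H2_eval_norm_bound[OF assms(1), of z] assms(2) H2_zero[OF assms(1), of z]
    by (cases "cmod z < 1") auto
qed

text \<open>The partial sums of \<open>g\<close> are orthogonal to \<open>u\<close> and converge to
  \<open>radial_bv g\<close> in L2.\<close>

lemma L2_inner_radial_bv_eq_0: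
  assumes u: "u \<in> L2_circle" "\<And>n. fourier_coeff u n = 0" and g: "g \<in> H2"
  shows "L2_inner u (radial_bv g) = 0"
proof -
  have "L2_inner (partial_sum g N) u = 0" for N
  proof -
    have "L2_inner (partial_sum g N) u = (\<Sum>n<N. taylor_coeff g n * cnj (fourier_coeff u n))"
      unfolding partial_sum_def[abs_def] fourier_coeff_def using u(1)
      by (subst L2_inner_sum_left)
        (auto intro: L2_circle_cmult L2_circle_power simp: L2_inner_cmult_left simp flip: L2_inner_commute)
    then show ?thesis using u(2) by simp
  qed
  moreover have "(\<lambda>N. L2_inner (partial_sum g N) u) \<longlonglongrightarrow> L2_inner (radial_bv g) u"
    by (intro L2_inner_tendsto partial_sum_L2 radial_bv_L2 g u(1) radial_bv_remainder_tendsto_0)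
  ultimately have "L2_inner (radial_bv g) u = 0"
    using LIMSEQ_unique[OF _ tendsto_const] by simp
  then show ?thesis using L2_inner_commute[of u] by simp
qed

section \<open>Algebra of H2 and of the bounded analytic functions, and its effect on boundary
  values\<close>

lemma H2_slice_integrable:
  assumes "f \<in> H2" "0 \<le> r" "r < 1"
  shows "integrable circle_measure (\<lambda>\<zeta>. (cmod (f (of_real r * \<zeta>)))\<^sup>2)"
  using power_series_slice_L2[OF taylor_coeff_sums[OF H2_holomorphic[OF assms(1)]] H2_measurable[OF assms(1)] assms(2,3)]
  by (simp add: mem_L2_circle)

lemma H2_add:
  assumes f: "f \<in> H2" and g: "g \<in> H2"
  shows "(\<lambda>z. f z + g z) \<in> H2"
proof (rule power_series_H2(1))
  show "summable (\<lambda>n. (cmod (taylor_coeff f n + taylor_coeff g n))\<^sup>2)"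
  proof (rule summable_comparison_test')
    show "summable (\<lambda>n. 2 * (cmod (taylor_coeff f n))\<^sup>2 + 2 * (cmod (taylor_coeff g n))\<^sup>2)"
      by (intro summable_add summable_mult H2_coeff_summable f g)
    fix n
    have "(cmod (a + b))\<^sup>2 \<le> 2 * (cmod a)\<^sup>2 + 2 * (cmod b)\<^sup>2" for a b
      using power_mono[OF norm_triangle_ineq[of a b], of 2] sum_squares_bound[of "cmod a" "cmod b"]
      by (simp add: power2_sum)
    then show "norm ((cmod (taylor_coeff f n + taylor_coeff g n))\<^sup>2) \<le> 2 * (cmod (taylor_coeff f n))\<^sup>2 + 2 * (cmod (taylor_coeff g n))\<^sup>2"
      by simp
  qed
  show "(\<lambda>n. (taylor_coeff f n + taylor_coeff g n) * z ^ n) sums (f z + g z)" if "cmod z < 1" for z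
    unfolding distrib_right
    by (intro sums_add taylor_coeff_sums H2_holomorphic f g that)
qed (use H2_zero[OF f] H2_zero[OF g] in auto)

lemma HinfI:
  assumes "\<psi> holomorphic_on ball 0 1" "\<And>z. z \<in> ball 0 1 \<Longrightarrow> cmod (\<psi> z) \<le> C"
  shows "\<psi> \<in> Hinf"
  unfolding Hinf_def bounded_iff using assms by blast

lemma HinfE:
  assumes "\<psi> \<in> Hinf"
  obtains C where "0 \<le> C" "\<And>z. z \<in> ball 0 1 \<Longrightarrow> cmod (\<psi> z) \<le> C"
proof -
  obtain C where C: "\<And>z. z \<in> ball 0 1 \<Longrightarrow> cmod (\<psi> z) \<le> C"
    using assms by (force simp: Hinf_def bounded_iff)
  have "0 \<le> C" using order_trans[OF norm_ge_zero C[of 0]] by simp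
  then show ?thesis using C that by blast
qed

lemma Hinf_holomorphic: "\<psi> \<in> Hinf \<Longrightarrow> \<psi> holomorphic_on ball 0 1"
  by (simp add: Hinf_def)

lemma Hinf_const: "(\<lambda>_. c) \<in> Hinf"
  by (rule HinfI[where C = "cmod c"]) auto

lemma Hinf_mult:
  assumes "\<phi> \<in> Hinf" "\<psi> \<in> Hinf"
  shows "(\<lambda>z. \<phi> z * \<psi> z) \<in> Hinf"
proof -
  obtain C D where bds: "0 \<le> C" "\<And>z. z \<in> ball 0 1 \<Longrightarrow> cmod (\<phi> z) \<le> C" "0 \<le> D" "\<And>z. z \<in> ball 0 1 \<Longrightarrow> cmod (\<psi> z) \<le> D"
    using assms HinfE by metis
  show ?thesis
  proof (rule HinfI)
    show "(\<lambda>z. \<phi> z * \<psi> z) holomorphic_on ball 0 1"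
      by (intro holomorphic_intros Hinf_holomorphic assms)
    show "cmod (\<phi> z * \<psi> z) \<le> C * D" if "z \<in> ball 0 1" for z
      unfolding norm_mult using bds that by (intro mult_mono) auto
  qed
qed

lemma Hinf_ident: "(\<lambda>z. z) \<in> Hinf"
  by (rule HinfI[where C = 1]) (auto intro!: holomorphic_intros)

lemma H2_Hinf_mult:
  assumes \<psi>: "\<psi> \<in> Hinf" and f: "f \<in> H2"
  shows "(\<lambda>z. \<psi> z * f z) \<in> H2"
proof -
  obtain C where C: "\<And>z. z \<in> ball 0 1 \<Longrightarrow> cmod (\<psi> z) \<le> C"
    using HinfE[OF \<psi>] by metis
  obtain D where D: "(\<integral>\<zeta>. (cmod (f (of_real r * \<zeta>)))\<^sup>2 \<partial>circle_measure) \<le> D" if "r \<in> {0..<1}" for r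
    using f by (force simp: H2_def bdd_above_def)
  have "(\<integral>\<zeta>. (cmod (\<psi> (of_real r * \<zeta>) * f (of_real r * \<zeta>)))\<^sup>2 \<partial>circle_measure) \<le> C\<^sup>2 * D" if r: "r \<in> {0..<1}" for r
  proof -
    have "(\<integral>\<zeta>. (cmod (\<psi> (of_real r * \<zeta>) * f (of_real r * \<zeta>)))\<^sup>2 \<partial>circle_measure) \<le>
      (\<integral>\<zeta>. C\<^sup>2 * (cmod (f (of_real r * \<zeta>)))\<^sup>2 \<partial>circle_measure)"
    proof (rule integral_mono_AE')
      show "integrable circle_measure (\<lambda>\<zeta>. C\<^sup>2 * (cmod (f (of_real r * \<zeta>)))\<^sup>2)"
        using H2_slice_integrable[OF f, of r] r by auto
      show "AE \<zeta> in circle_measure. (cmod (\<psi> (of_real r * \<zeta>) * f (of_real r * \<zeta>)))\<^sup>2 \<le> C\<^sup>2 * (cmod (f (of_real r * \<zeta>)))\<^sup>2"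
        using AE_circle_norm
      proof eventually_elim
        case (elim \<zeta>)
        then have "cmod (\<psi> (of_real r * \<zeta>)) \<le> C" using r by (intro C) (auto simp: norm_mult)
        then show ?case by (auto simp: norm_mult power_mult_distrib intro!: mult_right_mono power_mono)
      qed
    qed auto
    also have "\<dots> \<le> C\<^sup>2 * D" using D[OF r] by (simp add: mult_left_mono)
    finally show ?thesis .
  qed
  then show ?thesis
    using \<psi> f H2_holomorphic[OF f]
    by (auto simp: H2_def Hinf_def intro!: holomorphic_intros bdd_aboveI[where M = "C\<^sup>2 * D"])
qed

lemma Hinf_uminus: "\<psi> \<in> Hinf \<Longrightarrow> (\<lambda>z. - \<psi> z) \<in> Hinf"
  using Hinf_mult[OF Hinf_const[of "-1"]] by simp

lemma H2_cmult: "f \<in> H2 \<Longrightarrow> (\<lambda>z. c * f z) \<in> H2"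
  using H2_Hinf_mult[OF Hinf_const] .

lemma H2_diff: "f \<in> H2 \<Longrightarrow> g \<in> H2 \<Longrightarrow> (\<lambda>z. f z - g z) \<in> H2"
  using H2_add[of f "\<lambda>z. -1 * g z"] H2_cmult[of g "-1"] by simp

text \<open>The constant 1, normalised to vanish off the disc as elements of \<open>H2\<close>
  must.\<close>

definition disc_one :: "complex \<Rightarrow> complex" where
  "disc_one = indicator (ball 0 1)"

lemma disc_one_H2: "disc_one \<in> H2"
proof (rule power_series_H2(1))
  show "summable (\<lambda>n. (cmod (if n = 0 then 1 else 0))\<^sup>2)"
    by (rule summable_finite[of "{0}"]) auto
  show "(\<lambda>n. (if n = 0 then 1 else 0) * z ^ n) sums disc_one z" if "cmod z < 1" for z :: complex
    using sums_single[of 0 "\<lambda>_. 1::complex"] that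
    by (simp add: disc_one_def if_distrib[of "\<lambda>x. x * _"] cong: if_cong)
qed (auto simp: disc_one_def)

text \<open>Elements of \<open>Hinf\<close> are arbitrary off the disc. The factor
  \<open>disc_one\<close> turns \<open>\<psi>\<close> into an element of \<open>H2\<close>, so that
  Fatou's theorem and the measurability of boundary values apply.\<close>

definition Hinf_bv :: "(complex \<Rightarrow> complex) \<Rightarrow> complex \<Rightarrow> complex" where
  "Hinf_bv \<psi> = radial_bv (\<lambda>z. \<psi> z * disc_one z)"

lemma Hinf_bv_measurable: "\<psi> \<in> Hinf \<Longrightarrow> Hinf_bv \<psi> \<in> borel_measurable borel"
  unfolding Hinf_bv_def by (intro radial_bv_measurable H2_Hinf_mult disc_one_H2)

lemma tendsto_Hinf_bv:
  assumes "\<psi> \<in> Hinf"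
  shows "AE \<zeta> in circle_measure. ((\<lambda>r::real. \<psi> (of_real r * \<zeta>)) \<longlongrightarrow> Hinf_bv \<psi> \<zeta>) (at_left 1)"
  using fatou_radial_limit[OF H2_Hinf_mult[OF assms disc_one_H2], folded Hinf_bv_def] AE_circle_norm
proof eventually_elim
  case (elim \<zeta>)
  have "\<forall>\<^sub>F r::real in at_left 1. \<psi> (of_real r * \<zeta>) * disc_one (of_real r * \<zeta>) = \<psi> (of_real r * \<zeta>)"
    using elim(2) by (intro eventually_at_left_1) (auto simp: disc_one_def norm_mult)
  then show ?case using elim(1) by (rule Lim_transform_eventually[rotated])
qed

lemma Hinf_bv_bound:
  assumes "\<psi> \<in> Hinf" "\<And>z. z \<in> ball 0 1 \<Longrightarrow> cmod (\<psi> z) \<le> C"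
  shows "AE \<zeta> in circle_measure. cmod (Hinf_bv \<psi> \<zeta>) \<le> C"
  using tendsto_Hinf_bv[OF assms(1)] AE_circle_norm
proof eventually_elim
  case (elim \<zeta>)
  show ?case
    by (rule tendsto_upperbound[OF tendsto_norm[OF elim(1)]])
      (use elim(2) in \<open>auto intro!: eventually_at_left_1 assms(2) simp: norm_mult\<close>)
qed

lemma radial_bv_Hinf_mult:
  assumes "\<psi> \<in> Hinf" "f \<in> H2"
  shows "AE \<zeta> in circle_measure. radial_bv (\<lambda>z. \<psi> z * f z) \<zeta> = Hinf_bv \<psi> \<zeta> * radial_bv f \<zeta>"
  using tendsto_Hinf_bv[OF assms(1)] fatou_radial_limit[OF assms(2)]
  by eventually_elim (intro tendsto_radial_bv tendsto_intros)

lemma radial_bv_add: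
  assumes "f \<in> H2" "g \<in> H2"
  shows "AE \<zeta> in circle_measure. radial_bv (\<lambda>z. f z + g z) \<zeta> = radial_bv f \<zeta> + radial_bv g \<zeta>"
  using fatou_radial_limit[OF assms(1)] fatou_radial_limit[OF assms(2)]
  by eventually_elim (intro tendsto_radial_bv tendsto_intros)

lemma radial_bv_diff:
  assumes "f \<in> H2" "g \<in> H2"
  shows "AE \<zeta> in circle_measure. radial_bv (\<lambda>z. f z - g z) \<zeta> = radial_bv f \<zeta> - radial_bv g \<zeta>"
  using fatou_radial_limit[OF assms(1)] fatou_radial_limit[OF assms(2)]
  by eventually_elim (intro tendsto_radial_bv tendsto_intros)

lemma radial_bv_cmult:
  assumes "f \<in> H2"
  shows "AE \<zeta> in circle_measure. radial_bv (\<lambda>z. c * f z) \<zeta> = c * radial_bv f \<zeta>"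
  using fatou_radial_limit[OF assms(1)]
  by eventually_elim (intro tendsto_radial_bv tendsto_intros)

lemma L2_norm_Hinf_mult_le:
  assumes \<psi>: "\<psi> \<in> Hinf" "\<And>z. z \<in> ball 0 1 \<Longrightarrow> cmod (\<psi> z) \<le> C" and f: "f \<in> H2"
  shows "L2_norm (radial_bv (\<lambda>z. \<psi> z * f z)) \<le> C * L2_norm (radial_bv f)"
proof -
  have C: "0 \<le> C" using order_trans[OF norm_ge_zero \<psi>(2)[of 0]] by simp
  have bd: "AE \<zeta> in circle_measure. cmod (Hinf_bv \<psi> \<zeta>) \<le> C"
    using \<psi> by (rule Hinf_bv_bound)
  have "L2_norm (radial_bv (\<lambda>z. \<psi> z * f z)) \<le> L2_norm (\<lambda>\<zeta>. of_real C * radial_bv f \<zeta>)"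
  proof (rule L2_norm_mono_AE)
    show "AE \<zeta> in circle_measure. cmod (radial_bv (\<lambda>z. \<psi> z * f z) \<zeta>) \<le> cmod (of_real C * radial_bv f \<zeta>)"
      using radial_bv_Hinf_mult[OF \<psi>(1) f] bd
      by eventually_elim (use C in \<open>auto simp: norm_mult intro: mult_right_mono\<close>)
  qed (intro radial_bv_measurable H2_Hinf_mult \<psi> f L2_circle_cmult radial_bv_L2)+
  then show ?thesis using C by (simp add: L2_norm_cmult)
qed

text \<open>The orthogonal projection of L2 onto \<open>H2\<close>, realised on the disc: it keeps
  the Fourier coefficients of index at least 0.\<close>

definition riesz_proj :: "(complex \<Rightarrow> complex) \<Rightarrow> complex \<Rightarrow> complex" where
  "riesz_proj u z = (if cmod z < 1 then \<integral>\<eta>. u \<eta> * szego z \<eta> \<partial>circle_measure else 0)"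

lemma riesz_proj:
  assumes u: "u \<in> L2_circle"
  shows riesz_proj_H2: "riesz_proj u \<in> H2"
    and taylor_coeff_riesz_proj: "taylor_coeff (riesz_proj u) = fourier_coeff u"
proof -
  have s: "(\<lambda>n. fourier_coeff u n * z ^ n) sums riesz_proj u z" if "cmod z < 1" for z
    using sums_szego[OF L2_circle_integrable[OF u] that] that by (simp add: riesz_proj_def)
  show "riesz_proj u \<in> H2" "taylor_coeff (riesz_proj u) = fourier_coeff u"
    by (rule power_series_H2[OF bessel_summable[OF u] s]; simp add: riesz_proj_def)+
qed

lemma riesz_proj_orthogonal:
  assumes u: "u \<in> L2_circle" and g: "g \<in> H2"
  shows "L2_inner (\<lambda>\<zeta>. u \<zeta> - radial_bv (riesz_proj u) \<zeta>) (radial_bv g) = 0"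
proof (rule L2_inner_radial_bv_eq_0[OF _ _ g])
  have r: "radial_bv (riesz_proj u) \<in> L2_circle" by (intro radial_bv_L2 riesz_proj_H2 u)
  show "(\<lambda>\<zeta>. u \<zeta> - radial_bv (riesz_proj u) \<zeta>) \<in> L2_circle" by (intro L2_circle_diff u r)
  show "fourier_coeff (\<lambda>\<zeta>. u \<zeta> - radial_bv (riesz_proj u) \<zeta>) n = 0" for n
    using fourier_coeff_radial_bv[OF riesz_proj_H2[OF u], of n] taylor_coeff_riesz_proj[OF u]
    unfolding fourier_coeff_def by (simp add: L2_inner_diff_left[OF u r L2_circle_power])
qed

section \<open>Model spaces of inner functions\<close>

abbreviation H2_inner :: "(complex \<Rightarrow> complex) \<Rightarrow> (complex \<Rightarrow> complex) \<Rightarrow> complex" where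
  "H2_inner f g \<equiv> L2_inner (radial_bv f) (radial_bv g)"

abbreviation H2_norm :: "(complex \<Rightarrow> complex) \<Rightarrow> real" where
  "H2_norm f \<equiv> L2_norm (radial_bv f)"

lemma H2_inner_add_left:
  assumes "f \<in> H2" "g \<in> H2" "h \<in> H2"
  shows "H2_inner (\<lambda>z. f z + g z) h = H2_inner f h + H2_inner g h"
proof -
  have "H2_inner (\<lambda>z. f z + g z) h = L2_inner (\<lambda>\<zeta>. radial_bv f \<zeta> + radial_bv g \<zeta>) (radial_bv h)"
    using radial_bv_add[OF assms(1,2)] assms
    by (intro L2_inner_cong_AE radial_bv_measurable borel_measurable_add H2_add) auto
  then show ?thesis using assms by (simp add: L2_inner_add_left radial_bv_L2)
qed

lemma H2_inner_cmult_left: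
  assumes "f \<in> H2" "h \<in> H2"
  shows "H2_inner (\<lambda>z. c * f z) h = c * H2_inner f h"
proof -
  have "H2_inner (\<lambda>z. c * f z) h = L2_inner (\<lambda>\<zeta>. c * radial_bv f \<zeta>) (radial_bv h)"
    using radial_bv_cmult[OF assms(1)] assms
    by (intro L2_inner_cong_AE radial_bv_measurable borel_measurable_times borel_measurable_const H2_cmult) auto
  then show ?thesis by (simp add: L2_inner_cmult_left)
qed

lemma H2_inner_diff_left:
  assumes "f \<in> H2" "g \<in> H2" "h \<in> H2"
  shows "H2_inner (\<lambda>z. f z - g z) h = H2_inner f h - H2_inner g h"
  using H2_inner_add_left[OF assms(1) H2_cmult[OF assms(2), of "-1"] assms(3)]
    H2_inner_cmult_left[OF assms(2,3), of "-1"] by simp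

lemma H2_inner_self_eq_0: "f \<in> H2 \<Longrightarrow> H2_inner f f = 0 \<Longrightarrow> f = (\<lambda>_. 0)"
  by (rule H2_eq_0) (simp_all add: L2_inner_self)

lemma H2_norm_diff_tendsto_0_imp_tendsto:
  assumes "\<And>N. u N \<in> H2" "f \<in> H2" "(\<lambda>N. H2_norm (\<lambda>z. f z - u N z)) \<longlonglongrightarrow> 0" "cmod z < 1"
  shows "(\<lambda>N. u N z) \<longlonglongrightarrow> f z"
proof (rule LIM_zero_cancel, rule Lim_null_comparison)
  show "\<forall>\<^sub>F N in sequentially. norm (u N z - f z) \<le> H2_norm (\<lambda>z. f z - u N z) / (1 - cmod z)"
    using H2_eval_norm_bound[OF H2_diff[OF assms(2) assms(1)] assms(4)] by (simp add: norm_minus_commute)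
  show "(\<lambda>N. H2_norm (\<lambda>z. f z - u N z) / (1 - cmod z)) \<longlonglongrightarrow> 0"
    using tendsto_divide[OF assms(3) tendsto_const[of "1 - cmod z"]] assms(4) by simp
qed

locale inner_function =
  fixes \<Theta> :: "complex \<Rightarrow> complex"
  assumes Hinf: "\<Theta> \<in> Hinf"
    and unimodular: "AE \<zeta> in circle_measure. cmod (Hinf_bv \<Theta> \<zeta>) = 1"
begin

lemma mult_H2: "g \<in> H2 \<Longrightarrow> (\<lambda>z. \<Theta> z * g z) \<in> H2"
  by (rule H2_Hinf_mult[OF Hinf])

lemma model_space_H2: "f \<in> model_space \<Theta> \<Longrightarrow> f \<in> H2"
  by (simp add: model_space_def)

lemma model_space_orthogonal: "f \<in> model_space \<Theta> \<Longrightarrow> g \<in> H2 \<Longrightarrow> H2_inner f (\<lambda>z. \<Theta> z * g z) = 0"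
  by (simp add: model_space_def)

lemma model_space_add: "f \<in> model_space \<Theta> \<Longrightarrow> g \<in> model_space \<Theta> \<Longrightarrow> (\<lambda>z. f z + g z) \<in> model_space \<Theta>"
  by (auto simp: model_space_def H2_add H2_inner_add_left mult_H2)

lemma model_space_diff: "f \<in> model_space \<Theta> \<Longrightarrow> g \<in> model_space \<Theta> \<Longrightarrow> (\<lambda>z. f z - g z) \<in> model_space \<Theta>"
  by (auto simp: model_space_def H2_diff H2_inner_diff_left mult_H2)

lemma model_space_cmult: "f \<in> model_space \<Theta> \<Longrightarrow> (\<lambda>z. c * f z) \<in> model_space \<Theta>"
  by (auto simp: model_space_def H2_cmult H2_inner_cmult_left mult_H2)

text \<open>Such an \<open>f\<close> is orthogonal to itself. The uniqueness of decompositions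
  modulo \<open>\<Theta>\<close> rests on this.\<close>

lemma model_space_mult_eq_0:
  assumes "f \<in> model_space \<Theta>" "g \<in> H2" "f = (\<lambda>z. \<Theta> z * g z)"
  shows "f = (\<lambda>_. 0)"
  using model_space_orthogonal[OF assms(1,2)] assms(3) model_space_H2[OF assms(1)]
  by (intro H2_inner_self_eq_0) auto

text \<open>The Riesz projection of \<open>cnj \<Theta> * f\<close>. Together with
  \<open>compress\<close> this is the classical formula for the projection onto the model space:
  subtract from \<open>f\<close> the function \<open>\<Theta>\<close> times this projection.\<close>

definition quotient :: "(complex \<Rightarrow> complex) \<Rightarrow> complex \<Rightarrow> complex" where
  "quotient f = riesz_proj (\<lambda>\<zeta>. cnj (Hinf_bv \<Theta> \<zeta>) * radial_bv f \<zeta>)"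

definition compress :: "(complex \<Rightarrow> complex) \<Rightarrow> complex \<Rightarrow> complex" where
  "compress f = (\<lambda>z. f z - \<Theta> z * quotient f z)"

lemma quotient_L2:
  assumes "f \<in> H2"
  shows "(\<lambda>\<zeta>. cnj (Hinf_bv \<Theta> \<zeta>) * radial_bv f \<zeta>) \<in> L2_circle"
proof (rule L2_circle_bounded_mult[where C = 1])
  show "(\<lambda>\<zeta>. cnj (Hinf_bv \<Theta> \<zeta>)) \<in> borel_measurable borel"
    using Hinf_bv_measurable[OF Hinf] cnj_measurable by (rule measurable_compose)
  show "AE \<zeta> in circle_measure. cmod (cnj (Hinf_bv \<Theta> \<zeta>)) \<le> 1"
    using unimodular by eventually_elim simp
qed (rule radial_bv_L2[OF assms])

lemma quotient_H2: "f \<in> H2 \<Longrightarrow> quotient f \<in> H2"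
  unfolding quotient_def by (intro riesz_proj_H2 quotient_L2)

lemma compress_H2: "f \<in> H2 \<Longrightarrow> compress f \<in> H2"
  unfolding compress_def by (intro H2_diff mult_H2 quotient_H2)

text \<open>Since \<open>\<Theta>\<close> has modulus 1 on the circle, moving it across the inner
  product leaves \<open>cnj \<Theta> * f\<close> minus its own Riesz projection, which is orthogonal
  to \<open>H2\<close>.\<close>

lemma compress_model_space:
  assumes f: "f \<in> H2"
  shows "compress f \<in> model_space \<Theta>"
  unfolding model_space_def
proof (intro CollectI conjI ballI compress_H2 f)
  fix g assume g: "g \<in> H2"
  note [measurable] = Hinf_bv_measurable[OF Hinf] radial_bv_measurable[OF f] radial_bv_measurable[OF g]
    radial_bv_measurable[OF quotient_H2[OF f]] radial_bv_measurable[OF compress_H2[OF f]]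
    radial_bv_measurable[OF mult_H2[OF g]]
  have "H2_inner (compress f) (\<lambda>z. \<Theta> z * g z) =
    L2_inner (\<lambda>\<zeta>. cnj (Hinf_bv \<Theta> \<zeta>) * radial_bv f \<zeta> - radial_bv (quotient f) \<zeta>) (radial_bv g)"
    unfolding L2_inner_def
  proof (rule integral_cong_AE)
    show "AE \<zeta> in circle_measure. radial_bv (compress f) \<zeta> * cnj (radial_bv (\<lambda>z. \<Theta> z * g z) \<zeta>) =
      (cnj (Hinf_bv \<Theta> \<zeta>) * radial_bv f \<zeta> - radial_bv (quotient f) \<zeta>) * cnj (radial_bv g \<zeta>)"
      using unimodular radial_bv_Hinf_mult[OF Hinf g] radial_bv_Hinf_mult[OF Hinf quotient_H2[OF f]]
        radial_bv_diff[OF f mult_H2[OF quotient_H2[OF f]], folded compress_def]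
    proof eventually_elim
      case (elim \<zeta>)
      have "Hinf_bv \<Theta> \<zeta> * cnj (Hinf_bv \<Theta> \<zeta>) = 1"
        using elim(1) by (simp add: complex_norm_square[symmetric])
      then have "(a - Hinf_bv \<Theta> \<zeta> * b) * cnj (Hinf_bv \<Theta> \<zeta> * c) = (cnj (Hinf_bv \<Theta> \<zeta>) * a - b) * cnj c" for a b c
        by (simp add: algebra_simps)
      then show ?case using elim by simp
    qed
  qed measurable
  also have "\<dots> = 0"
    unfolding quotient_def by (rule riesz_proj_orthogonal[OF quotient_L2[OF f] g])
  finally show "H2_inner (compress f) (\<lambda>z. \<Theta> z * g z) = 0" .
qed

text \<open>The algebraic rules for \<open>compress\<close> below are proved by exhibiting a
  decomposition of this form.\<close>

lemma compress_unique:
  assumes f: "f \<in> H2" and k: "k \<in> model_space \<Theta>" and g: "g \<in> H2"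
    and eq: "\<And>z. z \<in> ball 0 1 \<Longrightarrow> f z = k z + \<Theta> z * g z"
  shows "compress f = k"
proof -
  have "(\<lambda>z. compress f z - k z) = (\<lambda>_. 0)"
  proof (rule model_space_mult_eq_0)
    show "(\<lambda>z. compress f z - k z) \<in> model_space \<Theta>"
      by (intro model_space_diff compress_model_space f k)
    show "(\<lambda>z. g z - quotient f z) \<in> H2"
      by (intro H2_diff g quotient_H2 f)
    show "(\<lambda>z. compress f z - k z) = (\<lambda>z. \<Theta> z * (g z - quotient f z))"
    proof
      fix z show "compress f z - k z = \<Theta> z * (g z - quotient f z)"
        using eq[of z] H2_zero[OF f, of z] H2_zero[OF g, of z] H2_zero[OF quotient_H2[OF f], of z]
          H2_zero[OF model_space_H2[OF k], of z]
        by (cases "z \<in> ball 0 1") (auto simp: compress_def algebra_simps)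
    qed
  qed
  then show ?thesis by (auto simp: fun_eq_iff)
qed

lemma compress_model_space_id: "k \<in> model_space \<Theta> \<Longrightarrow> compress k = k"
  by (rule compress_unique[where g = "\<lambda>_. 0"]) (use model_space_H2 H2_cmult[OF disc_one_H2, of 0] in auto)

lemma compress_orthogonal:
  assumes f: "f \<in> H2" and g: "g \<in> model_space \<Theta>"
  shows "H2_inner (\<lambda>z. f z - compress f z) g = 0"
proof -
  have "(\<lambda>z. f z - compress f z) = (\<lambda>z. \<Theta> z * quotient f z)"
    by (simp add: compress_def)
  then show ?thesis
    using model_space_orthogonal[OF g quotient_H2[OF f]] L2_inner_commute[of _ "radial_bv g"] by simp
qed

text \<open>Evaluates the definite description in \<open>model_proj\<close>; the later arguments
  work with \<open>compress\<close> in its place.\<close>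

lemma model_proj_radial_bv:
  assumes f: "f \<in> H2"
  shows "model_proj \<Theta> (radial_bv f) = compress f"
proof -
  have *: "L2_inner (\<lambda>\<zeta>. radial_bv f \<zeta> - radial_bv k \<zeta>) (radial_bv g) = H2_inner (\<lambda>z. f z - k z) g"
    if "k \<in> H2" "g \<in> H2" for k g
    using that by (simp add: L2_inner_diff_left radial_bv_L2 f H2_inner_diff_left)
  have "(THE k. k \<in> model_space \<Theta> \<and>
     (\<forall>g\<in>model_space \<Theta>. L2_inner (\<lambda>\<zeta>. radial_bv f \<zeta> - radial_bv k \<zeta>) (radial_bv g) = 0)) = compress f"
  proof (rule the_equality)
    show "compress f \<in> model_space \<Theta> \<and>
     (\<forall>g\<in>model_space \<Theta>. L2_inner (\<lambda>\<zeta>. radial_bv f \<zeta> - radial_bv (compress f) \<zeta>) (radial_bv g) = 0)"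
      using compress_model_space[OF f] compress_orthogonal[OF f] *[OF compress_H2[OF f]] model_space_H2 by simp
  next
    fix k assume k: "k \<in> model_space \<Theta> \<and>
     (\<forall>g\<in>model_space \<Theta>. L2_inner (\<lambda>\<zeta>. radial_bv f \<zeta> - radial_bv k \<zeta>) (radial_bv g) = 0)"
    let ?d = "\<lambda>z. compress f z - k z"
    have d: "?d \<in> model_space \<Theta>" using k by (intro model_space_diff compress_model_space f) auto
    have "H2_inner (\<lambda>z. f z - k z) ?d = 0"
      using k d *[of k ?d] model_space_H2 by simp
    moreover have "H2_inner (\<lambda>z. f z - compress f z) ?d = 0" by (rule compress_orthogonal[OF f d])
    moreover have "H2_inner ?d ?d = H2_inner (\<lambda>z. f z - k z) ?d - H2_inner (\<lambda>z. f z - compress f z) ?d"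
      using H2_inner_diff_left[of "\<lambda>z. f z - k z" "\<lambda>z. f z - compress f z" ?d] f k d
      by (simp add: H2_diff model_space_H2 compress_H2)
    ultimately have "?d = (\<lambda>_. 0)"
      using model_space_H2[OF d] by (intro H2_inner_self_eq_0) auto
    then show "k = compress f" by (auto simp: fun_eq_iff)
  qed
  then show ?thesis by (simp add: model_proj_def radial_bv_L2[OF f])
qed

lemma H2_norm_compress_le:
  assumes f: "f \<in> H2"
  shows "H2_norm (compress f) \<le> H2_norm f"
proof (cases "H2_norm (compress f) = 0")
  case False
  have "complex_of_real ((H2_norm (compress f))\<^sup>2) = H2_inner (compress f) (compress f)"
    by (simp only: L2_inner_self)
  also have "\<dots> = H2_inner f (compress f)"
    using compress_orthogonal[OF f compress_model_space[OF f]]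
    by (simp add: H2_inner_diff_left f compress_H2)
  finally have "cmod (complex_of_real ((H2_norm (compress f))\<^sup>2)) \<le> H2_norm f * H2_norm (compress f)"
    using cmod_L2_inner_le[OF radial_bv_L2[OF f] radial_bv_L2[OF compress_H2[OF f]]] by simp
  then have "H2_norm (compress f) * H2_norm (compress f) \<le> H2_norm f * H2_norm (compress f)"
    unfolding norm_of_real by (simp add: power2_eq_square)
  then show ?thesis using False L2_norm_nonneg[of "radial_bv (compress f)"] by (simp add: mult_le_cancel_right)
qed simp

lemma compress_add:
  assumes "f \<in> H2" "g \<in> H2"
  shows "compress (\<lambda>z. f z + g z) = (\<lambda>z. compress f z + compress g z)"
  using assms
  by (intro compress_unique[where g = "\<lambda>z. quotient f z + quotient g z"] H2_add model_space_add
      compress_model_space quotient_H2) (auto simp: compress_def algebra_simps)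

lemma compress_cmult:
  assumes "f \<in> H2"
  shows "compress (\<lambda>z. c * f z) = (\<lambda>z. c * compress f z)"
  using assms
  by (intro compress_unique[where g = "\<lambda>z. c * quotient f z"] H2_cmult model_space_cmult
      compress_model_space quotient_H2) (auto simp: compress_def algebra_simps)

lemma compress_diff:
  assumes "f \<in> H2" "g \<in> H2"
  shows "compress (\<lambda>z. f z - g z) = (\<lambda>z. compress f z - compress g z)"
  using assms
  by (intro compress_unique[where g = "\<lambda>z. quotient f z - quotient g z"] H2_diff model_space_diff
      compress_model_space quotient_H2) (auto simp: compress_def algebra_simps)

lemma compress_cong_mod:
  assumes "f \<in> H2" "g \<in> H2" "h \<in> H2" "\<And>z. z \<in> ball 0 1 \<Longrightarrow> f z = g z + \<Theta> z * h z"
  shows "compress f = compress g"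
  using assms
  by (intro compress_unique[where g = "\<lambda>z. quotient g z + h z"] H2_add
      compress_model_space quotient_H2) (auto simp: compress_def algebra_simps)

text \<open>Multiplication by \<open>\<psi>\<close> maps multiples of \<open>\<Theta>\<close> to
  multiples of \<open>\<Theta>\<close>. This is why \<open>\<psi> \<mapsto> A\<^sub>\<psi>\<close>
  is multiplicative.\<close>

lemma compress_Hinf_mult_compress:
  assumes "\<psi> \<in> Hinf" "f \<in> H2"
  shows "compress (\<lambda>z. \<psi> z * compress f z) = compress (\<lambda>z. \<psi> z * f z)"
  using assms
  by (intro compress_cong_mod[where h = "\<lambda>z. - 1 * (\<psi> z * quotient f z)"] H2_Hinf_mult H2_cmult compress_H2 quotient_H2)
    (auto simp: compress_def algebra_simps)

section \<open>The operators with bounded analytic symbol\<close>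

lemma model_mult_apply: "\<psi> \<in> Hinf \<Longrightarrow> f \<in> model_space \<Theta> \<Longrightarrow> model_mult \<Theta> \<psi> f = compress (\<lambda>z. \<psi> z * f z)"
  by (simp add: model_mult_def model_proj_radial_bv H2_Hinf_mult model_space_H2)

lemma compressed_shift_eq_model_mult: "compressed_shift \<Theta> = model_mult \<Theta> (\<lambda>z. z)"
  by (simp add: compressed_shift_def model_mult_def unilateral_shift_def)

lemma compressed_shift_apply: "f \<in> model_space \<Theta> \<Longrightarrow> compressed_shift \<Theta> f = compress (\<lambda>z. z * f z)"
  by (simp add: compressed_shift_eq_model_mult model_mult_apply Hinf_ident)

lemma model_mult_bounded_ops:
  assumes \<psi>: "\<psi> \<in> Hinf"
  shows "model_mult \<Theta> \<psi> \<in> bounded_ops \<Theta>"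
proof -
  note H2 = model_space_H2 H2_Hinf_mult[OF \<psi>]
  obtain C where C: "\<And>z. z \<in> ball 0 1 \<Longrightarrow> cmod (\<psi> z) \<le> C"
    using HinfE[OF \<psi>] by metis
  have "model_mult \<Theta> \<psi> \<in> model_space \<Theta> \<rightarrow>\<^sub>E model_space \<Theta>"
    by (auto simp: model_mult_apply \<psi> compress_model_space H2) (simp add: model_mult_def)
  moreover have "model_mult \<Theta> \<psi> (\<lambda>z. f z + g z) = (\<lambda>z. model_mult \<Theta> \<psi> f z + model_mult \<Theta> \<psi> g z)"
    if "f \<in> model_space \<Theta>" "g \<in> model_space \<Theta>" for f g
    using that compress_add[of "\<lambda>z. \<psi> z * f z" "\<lambda>z. \<psi> z * g z"]
    by (simp add: model_mult_apply \<psi> model_space_add H2 distrib_left)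
  moreover have "model_mult \<Theta> \<psi> (\<lambda>z. c * f z) = (\<lambda>z. c * model_mult \<Theta> \<psi> f z)"
    if "f \<in> model_space \<Theta>" for f c
    using that compress_cmult[of "\<lambda>z. \<psi> z * f z" c]
    by (simp add: model_mult_apply \<psi> model_space_cmult H2 mult.left_commute)
  moreover have "H2_norm (model_mult \<Theta> \<psi> f) \<le> C * H2_norm f" if "f \<in> model_space \<Theta>" for f
    using that H2_norm_compress_le[of "\<lambda>z. \<psi> z * f z"] L2_norm_Hinf_mult_le[OF \<psi> C, of f]
    by (fastforce simp: model_mult_apply \<psi> H2)
  ultimately show ?thesis unfolding bounded_ops_def by blast
qed

lemma compose_model_mult:
  assumes "\<phi> \<in> Hinf" "\<psi> \<in> Hinf"
  shows "compose (model_space \<Theta>) (model_mult \<Theta> \<phi>) (model_mult \<Theta> \<psi>) = model_mult \<Theta> (\<lambda>z. \<phi> z * \<psi> z)"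
proof
  fix f
  show "compose (model_space \<Theta>) (model_mult \<Theta> \<phi>) (model_mult \<Theta> \<psi>) f = model_mult \<Theta> (\<lambda>z. \<phi> z * \<psi> z) f"
  proof (cases "f \<in> model_space \<Theta>")
    case True
    then show ?thesis
      using assms compress_Hinf_mult_compress[OF assms(1), of "\<lambda>z. \<psi> z * f z"]
      by (simp add: compose_def model_mult_apply Hinf_mult compress_model_space H2_Hinf_mult model_space_H2 mult.assoc)
  qed (simp add: compose_def model_mult_def)
qed

lemma model_mult_cong_mod:
  assumes "\<phi> \<in> Hinf" "\<psi> \<in> Hinf" "h \<in> Hinf" "\<And>z. z \<in> ball 0 1 \<Longrightarrow> \<phi> z = \<psi> z + \<Theta> z * h z"
  shows "model_mult \<Theta> \<phi> = model_mult \<Theta> \<psi>"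
proof
  fix f
  show "model_mult \<Theta> \<phi> f = model_mult \<Theta> \<psi> f"
  proof (cases "f \<in> model_space \<Theta>")
    case True
    then show ?thesis
      using assms compress_cong_mod[of "\<lambda>z. \<phi> z * f z" "\<lambda>z. \<psi> z * f z" "\<lambda>z. h z * f z"]
      by (simp add: model_mult_apply H2_Hinf_mult model_space_H2 distrib_right mult.assoc)
  qed (simp add: model_mult_def)
qed

lemma model_mult_square:
  assumes "\<psi> \<in> Hinf" "h \<in> Hinf" "\<And>z. z \<in> ball 0 1 \<Longrightarrow> (\<psi> z)\<^sup>2 = z + \<Theta> z * h z"
  shows "compose (model_space \<Theta>) (model_mult \<Theta> \<psi>) (model_mult \<Theta> \<psi>) = compressed_shift \<Theta>"
  unfolding compose_model_mult[OF assms(1,1)] compressed_shift_eq_model_mult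
  using assms by (intro model_mult_cong_mod[where h = h] Hinf_mult Hinf_ident) (auto simp: power2_eq_square)

lemma model_mult_uminus:
  assumes "\<psi> \<in> Hinf" "f \<in> model_space \<Theta>"
  shows "model_mult \<Theta> (\<lambda>z. - \<psi> z) f = (\<lambda>z. - model_mult \<Theta> \<psi> f z)"
  using assms compress_cmult[of "\<lambda>z. \<psi> z * f z" "-1"]
  by (simp add: model_mult_apply Hinf_uminus H2_Hinf_mult model_space_H2)

end

section \<open>Square roots of the compressed shift\<close>

lemma partial_sum_Hinf: "partial_sum f N \<in> Hinf"
proof (rule HinfI)
  show "partial_sum f N holomorphic_on ball 0 1"
    unfolding partial_sum_def[abs_def] by (intro holomorphic_intros)
  show "cmod (partial_sum f N z) \<le> (\<Sum>n<N. cmod (taylor_coeff f n))" if "z \<in> ball 0 1" for z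
    unfolding partial_sum_def
    by (rule sum_norm_le) (use that in \<open>auto simp: norm_mult norm_power intro!: mult_right_le_one_le power_le_one\<close>)
qed

lemma partial_sum_norm_le:
  assumes "f \<in> H2"
  shows "L2_norm (partial_sum f N) \<le> H2_norm f"
proof (rule power2_le_imp_le)
  have "(L2_norm (partial_sum f N))\<^sup>2 = (\<Sum>n<N. (cmod (taylor_coeff f n))\<^sup>2)"
    using L2_norm_power_sum[of "{..<N}" "taylor_coeff f"] by (simp add: partial_sum_def[abs_def])
  also have "\<dots> \<le> (H2_norm f)\<^sup>2"
    using bessel[OF radial_bv_L2[OF assms], of "{..<N}"] by (simp add: fourier_coeff_radial_bv[OF assms])
  finally show "(L2_norm (partial_sum f N))\<^sup>2 \<le> (H2_norm f)\<^sup>2" .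
qed simp

lemma partial_sum_tendsto: "f \<in> H2 \<Longrightarrow> cmod z < 1 \<Longrightarrow> (\<lambda>N. partial_sum f N z) \<longlonglongrightarrow> f z"
  using taylor_coeff_sums[OF H2_holomorphic, of f z] by (simp add: sums_def partial_sum_def)

lemma radial_bv_partial_sum_mult:
  assumes "a \<in> H2"
  shows "AE \<zeta> in circle_measure. radial_bv (\<lambda>z. partial_sum f N z * a z) \<zeta> = partial_sum f N \<zeta> * radial_bv a \<zeta>"
  using fatou_radial_limit[OF assms]
proof eventually_elim
  case (elim \<zeta>)
  have "((\<lambda>r. partial_sum f N (of_real r * \<zeta>)) \<longlongrightarrow> partial_sum f N (of_real 1 * \<zeta>)) (at_left 1)"
    unfolding partial_sum_def by (intro tendsto_intros)
  then show ?case using elim by (intro tendsto_radial_bv tendsto_mult) simp_all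
qed

lemma H2_norm_partial_sum_remainder:
  assumes f: "f \<in> H2"
  shows "H2_norm (\<lambda>z. f z - partial_sum f N z * disc_one z) = L2_norm (\<lambda>\<zeta>. radial_bv f \<zeta> - partial_sum f N \<zeta>)"
proof -
  note P = H2_Hinf_mult[OF partial_sum_Hinf disc_one_H2, of f N]
  have one: "AE \<zeta> in circle_measure. radial_bv disc_one \<zeta> = 1"
    using AE_circle_norm
  proof eventually_elim
    case (elim \<zeta>)
    have "\<forall>\<^sub>F r::real in at_left 1. disc_one (of_real r * \<zeta>) = 1"
      using elim by (intro eventually_at_left_1) (auto simp: disc_one_def norm_mult)
    then show ?case by (intro tendsto_radial_bv tendsto_eventually)
  qed
  show ?thesis
  proof (rule L2_norm_cong_AE)
    show "AE \<zeta> in circle_measure. radial_bv (\<lambda>z. f z - partial_sum f N z * disc_one z) \<zeta> = radial_bv f \<zeta> - partial_sum f N \<zeta>"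
      using one radial_bv_diff[OF f P] radial_bv_partial_sum_mult[OF disc_one_H2, of f N]
      by eventually_elim simp
  qed (intro radial_bv_L2 H2_diff f P radial_bv_remainder)+
qed

lemma Hinf_power: "(\<lambda>z. z ^ n) \<in> Hinf"
proof (induction n)
  case 0
  show ?case using Hinf_const[of 1] by simp
next
  case (Suc n)
  show ?case using Hinf_mult[OF Hinf_ident Suc] by simp
qed

context inner_function
begin

text \<open>The reproducing kernel of the model space at 0. Polynomials in the compressed shift
  applied to it are dense in the model space, so the value of a root here determines the
  root.\<close>

definition kernel_zero :: "complex \<Rightarrow> complex" where
  "kernel_zero = compress disc_one"

lemma kernel_zero_model_space: "kernel_zero \<in> model_space \<Theta>"
  unfolding kernel_zero_def by (intro compress_model_space disc_one_H2)

lemma bounded_ops_model_space: "A \<in> bounded_ops \<Theta> \<Longrightarrow> f \<in> model_space \<Theta> \<Longrightarrow> A f \<in> model_space \<Theta>"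
  unfolding bounded_ops_def by (auto dest: PiE_mem)

lemma bounded_ops_undefined: "A \<in> bounded_ops \<Theta> \<Longrightarrow> f \<notin> model_space \<Theta> \<Longrightarrow> A f = undefined"
  unfolding bounded_ops_def by (auto dest: PiE_arb)

lemma bounded_ops_add:
  "A \<in> bounded_ops \<Theta> \<Longrightarrow> f \<in> model_space \<Theta> \<Longrightarrow> g \<in> model_space \<Theta> \<Longrightarrow> A (\<lambda>z. f z + g z) = (\<lambda>z. A f z + A g z)"
  unfolding bounded_ops_def by blast

lemma bounded_ops_cmult:
  "A \<in> bounded_ops \<Theta> \<Longrightarrow> f \<in> model_space \<Theta> \<Longrightarrow> A (\<lambda>z. c * f z) = (\<lambda>z. c * A f z)"
  unfolding bounded_ops_def by blast

lemma bounded_ops_diff: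
  assumes "A \<in> bounded_ops \<Theta>" "f \<in> model_space \<Theta>" "g \<in> model_space \<Theta>"
  shows "A (\<lambda>z. f z - g z) = (\<lambda>z. A f z - A g z)"
  using bounded_ops_add[OF assms(1,2) model_space_cmult[OF assms(3), of "-1"]]
    bounded_ops_cmult[OF assms(1,3), of "-1"] by simp

context
  fixes A
  assumes A: "A \<in> bounded_ops \<Theta>"
    and square: "compose (model_space \<Theta>) A A = compressed_shift \<Theta>"
begin

lemma apply_model_space: "f \<in> model_space \<Theta> \<Longrightarrow> A f \<in> model_space \<Theta>"
  using A by (rule bounded_ops_model_space)

lemma apply_kernel_zero: "A kernel_zero \<in> model_space \<Theta>"
  by (rule apply_model_space[OF kernel_zero_model_space])

lemma apply_kernel_zero_H2: "A kernel_zero \<in> H2"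
  by (rule model_space_H2[OF apply_kernel_zero])

lemma square_apply: "f \<in> model_space \<Theta> \<Longrightarrow> A (A f) = compress (\<lambda>z. z * f z)"
  using fun_cong[OF square, of f] by (simp add: compose_def compressed_shift_apply)

text \<open>\<open>A\<close> commutes with its own square.\<close>

lemma square_root_commute:
  assumes f: "f \<in> model_space \<Theta>"
  shows "A (compress (\<lambda>z. z * f z)) = compress (\<lambda>z. z * A f z)"
  using square_apply[OF f] square_apply[OF apply_model_space[OF f]] by simp

lemma square_root_power:
  "A (compress (\<lambda>z. z ^ n * disc_one z)) = compress (\<lambda>z. z ^ n * A kernel_zero z)"
proof (induction n)
  case 0
  then show ?case
    using compress_model_space_id[OF apply_kernel_zero] by (simp add: kernel_zero_def)
next
  case (Suc n)

  note a = apply_kernel_zero_H2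
  note pd = H2_Hinf_mult[OF Hinf_power[of n] disc_one_H2] and pa = H2_Hinf_mult[OF Hinf_power[of n] a]
  have "A (compress (\<lambda>z. z ^ Suc n * disc_one z)) = A (compress (\<lambda>z. z * compress (\<lambda>z. z ^ n * disc_one z) z))"
    using compress_Hinf_mult_compress[OF Hinf_ident pd] by (simp add: mult.assoc)
  also have "\<dots> = compress (\<lambda>z. z * compress (\<lambda>z. z ^ n * A kernel_zero z) z)"
    by (subst square_root_commute) (auto intro: compress_model_space pd simp: Suc)
  also have "\<dots> = compress (\<lambda>z. z ^ Suc n * A kernel_zero z)"
    using compress_Hinf_mult_compress[OF Hinf_ident pa] by (simp add: mult.assoc)
  finally show ?case .
qed

lemma square_root_partial_sum:
  "A (compress (\<lambda>z. partial_sum f N z * disc_one z)) = compress (\<lambda>z. partial_sum f N z * A kernel_zero z)"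
proof (induction N)
  case 0
  have "compress (\<lambda>_. 0) = (\<lambda>_. 0)"
    using compress_cmult[OF disc_one_H2, of 0] by simp
  then show ?case
    using bounded_ops_cmult[OF A kernel_zero_model_space, of 0] by (simp add: partial_sum_def)
next
  case (Suc N)

  note a = apply_kernel_zero_H2
  let ?c = "taylor_coeff f N"
  have split: "compress (\<lambda>z. partial_sum f (Suc N) z * b z) =
      (\<lambda>z. compress (\<lambda>z. partial_sum f N z * b z) z + ?c * compress (\<lambda>z. z ^ N * b z) z)" if b: "b \<in> H2" for b
  proof -
    have "(\<lambda>z. partial_sum f (Suc N) z * b z) = (\<lambda>z. partial_sum f N z * b z + ?c * (z ^ N * b z))"
      by (simp add: partial_sum_def algebra_simps)
    then show ?thesis
      using compress_add[OF H2_Hinf_mult[OF partial_sum_Hinf b] H2_cmult[OF H2_Hinf_mult[OF Hinf_power[of N] b]], of f N ?c]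
        compress_cmult[OF H2_Hinf_mult[OF Hinf_power[of N] b], of ?c] by simp
  qed
  have m: "compress (\<lambda>z. partial_sum f N z * disc_one z) \<in> model_space \<Theta>"
    "compress (\<lambda>z. z ^ N * disc_one z) \<in> model_space \<Theta>"
    by (intro compress_model_space H2_Hinf_mult partial_sum_Hinf Hinf_power disc_one_H2)+
  show ?case
    unfolding split[OF disc_one_H2] split[OF a]
    using bounded_ops_add[OF A m(1) model_space_cmult[OF m(2)], of ?c] bounded_ops_cmult[OF A m(2), of ?c]
    by (simp add: Suc square_root_power)
qed

text \<open>The compressed Taylor polynomials of \<open>f\<close> approximate \<open>f\<close> in
  norm. Boundedness of \<open>A\<close> carries this over to the images, and point evaluation is
  continuous in the norm.\<close>

lemma square_root_tendsto:
  assumes f: "f \<in> model_space \<Theta>" and z: "cmod z < 1"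
  shows "(\<lambda>N. compress (\<lambda>z. partial_sum f N z * A kernel_zero z) z) \<longlonglongrightarrow> A f z"
proof (rule H2_norm_diff_tendsto_0_imp_tendsto[where u = "\<lambda>N. compress (\<lambda>z. partial_sum f N z * A kernel_zero z)" and f = "A f", OF _ _ _ z])
  note f2 = model_space_H2[OF f] and Af = model_space_H2[OF apply_model_space[OF f]]
    and a = apply_kernel_zero_H2
  show "A f \<in> H2" by fact
  show "compress (\<lambda>z. partial_sum f N z * A kernel_zero z) \<in> H2" for N
    by (intro compress_H2 H2_Hinf_mult partial_sum_Hinf a)
  \<comment> \<open>\<open>bounded_ops\<close> puts no sign on \<open>C\<close>, so
    \<open>max C 0\<close> serves as the factor below.\<close>
  obtain C where C: "\<And>g. g \<in> model_space \<Theta> \<Longrightarrow> H2_norm (A g) \<le> C * H2_norm g"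
    using A unfolding bounded_ops_def by blast
  let ?P = "\<lambda>N z. partial_sum f N z * disc_one z"
  have P: "?P N \<in> H2" for N by (intro H2_Hinf_mult partial_sum_Hinf disc_one_H2)
  have le: "H2_norm (\<lambda>z. A f z - compress (\<lambda>z. partial_sum f N z * A kernel_zero z) z) \<le>
      max C 0 * L2_norm (\<lambda>\<zeta>. radial_bv f \<zeta> - partial_sum f N \<zeta>)" for N
  proof -
    have m: "compress (\<lambda>z. f z - ?P N z) \<in> model_space \<Theta>"
      by (intro compress_model_space H2_diff f2 P)
    have "A (compress (\<lambda>z. f z - ?P N z)) = (\<lambda>z. A f z - compress (\<lambda>z. partial_sum f N z * A kernel_zero z) z)"
      using bounded_ops_diff[OF A f compress_model_space[OF P, of N]]
      by (simp add: compress_diff f2 P compress_model_space_id[OF f] square_root_partial_sum)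
    then have "H2_norm (\<lambda>z. A f z - compress (\<lambda>z. partial_sum f N z * A kernel_zero z) z) \<le>
        C * H2_norm (compress (\<lambda>z. f z - ?P N z))"
      using C[OF m] by simp
    also have "\<dots> \<le> max C 0 * H2_norm (\<lambda>z. f z - ?P N z)"
      by (intro mult_mono H2_norm_compress_le H2_diff f2 P) auto
    finally show ?thesis by (simp add: H2_norm_partial_sum_remainder[OF f2])
  qed
  have "(\<lambda>N. max C 0 * L2_norm (\<lambda>\<zeta>. radial_bv f \<zeta> - partial_sum f N \<zeta>)) \<longlonglongrightarrow> max C 0 * 0"
    by (intro tendsto_mult tendsto_const radial_bv_remainder_tendsto_0 f2)
  then have lim: "(\<lambda>N. max C 0 * L2_norm (\<lambda>\<zeta>. radial_bv f \<zeta> - partial_sum f N \<zeta>)) \<longlonglongrightarrow> 0" by simp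
  show "(\<lambda>N. H2_norm (\<lambda>z. A f z - compress (\<lambda>z. partial_sum f N z * A kernel_zero z) z)) \<longlonglongrightarrow> 0"
    by (rule tendsto_sandwich[OF _ _ tendsto_const lim]) (simp_all add: le)
qed

text \<open>
  With \<open>a = A k\<^sub>0\<close> formally \<open>a\<^sup>2 = A a = A\<^sup>2 k\<^sub>0\<close> modulo multiples of \<open>\<Theta>\<close>, but \<open>a\<^sup>2\<close> is only in
  \<open>H\<^sup>1\<close>; the multiple of \<open>\<Theta>\<close> is therefore estimated along the partial sums of \<open>a\<close>.
\<close>

lemma square_root_kernel_estimate:
  obtains C where "\<And>z. cmod z < 1 \<Longrightarrow> cmod ((A kernel_zero z)\<^sup>2 - z) \<le> C * cmod (\<Theta> z) / (1 - cmod z)"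
proof -
  define a where "a = A kernel_zero"
  have aK: "a \<in> model_space \<Theta>" unfolding a_def by (rule apply_kernel_zero)
  then have a: "a \<in> H2" by (rule model_space_H2)
  have zd: "(\<lambda>z. z * disc_one z) \<in> H2" by (intro H2_Hinf_mult Hinf_ident disc_one_H2)
  define q where "q = quotient (\<lambda>z. z * disc_one z)"
  have q: "q \<in> H2" unfolding q_def by (intro quotient_H2 zd)
  define Q where "Q N = quotient (\<lambda>z. partial_sum a N z * a z)" for N
  have pa: "(\<lambda>z. partial_sum a N z * a z) \<in> H2" for N
    by (intro H2_Hinf_mult partial_sum_Hinf a)
  \<comment> \<open>The bound is uniform in \<open>N\<close>: \<open>Q N\<close> is the Riesz
    projection of a function whose L1 norm is at most the norm of the partial sum times that of
    \<open>a\<close>, because \<open>\<Theta>\<close> is unimodular and drops out.\<close>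
  have Q_bound: "cmod (Q N z) \<le> (H2_norm a)\<^sup>2 / (1 - cmod z)" if z: "cmod z < 1" for N z
  proof -
    let ?u = "\<lambda>\<zeta>. cnj (Hinf_bv \<Theta> \<zeta>) * radial_bv (\<lambda>z. partial_sum a N z * a z) \<zeta>"
    have u: "?u \<in> L2_circle" by (rule quotient_L2[OF pa])
    have "cmod (Q N z) \<le> (\<integral>\<zeta>. cmod (?u \<zeta>) \<partial>circle_measure) / (1 - cmod z)"
      using H2_eval_bound[OF L2_circle_measurable[OF u] L2_circle_integrable[OF u] z] z
      by (simp add: Q_def quotient_def riesz_proj_def)
    also have "(\<integral>\<zeta>. cmod (?u \<zeta>) \<partial>circle_measure) = (\<integral>\<zeta>. cmod (partial_sum a N \<zeta>) * cmod (radial_bv a \<zeta>) \<partial>circle_measure)"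
    proof (rule integral_cong_AE)
      show "AE \<zeta> in circle_measure. cmod (?u \<zeta>) = cmod (partial_sum a N \<zeta>) * cmod (radial_bv a \<zeta>)"
        using unimodular radial_bv_partial_sum_mult[OF a, of a N]
        by eventually_elim (simp add: norm_mult)
    qed (use L2_circle_measurable[OF u] radial_bv_measurable[OF a] in measurable)
    also have "\<dots> \<le> L2_norm (partial_sum a N) * H2_norm a"
      by (intro L2_norm_mult_le partial_sum_L2 radial_bv_L2 a)
    also have "\<dots> \<le> H2_norm a * H2_norm a"
      by (intro mult_right_mono partial_sum_norm_le a) simp
    finally show ?thesis using z by (simp add: power2_eq_square divide_right_mono)
  qed
  have Aa: "A a = compress (\<lambda>z. z * disc_one z)"
    unfolding a_def square_apply[OF kernel_zero_model_space]
    unfolding kernel_zero_def by (rule compress_Hinf_mult_compress[OF Hinf_ident disc_one_H2])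
  have "cmod ((a z)\<^sup>2 - z) \<le> ((H2_norm a)\<^sup>2 + H2_norm q) * cmod (\<Theta> z) / (1 - cmod z)" if z: "cmod z < 1" for z
  proof -
    have Aaz: "A a z = z - \<Theta> z * q z"
      using z by (simp add: Aa compress_def q_def disc_one_def)
    have "(\<lambda>N. compress (\<lambda>z. partial_sum a N z * a z) z) \<longlonglongrightarrow> A a z"
      using square_root_tendsto[OF aK z] by (simp add: a_def)
    \<comment> \<open>The differences are \<open>\<Theta> z * Q N z\<close>, so the uniform bound
      for \<open>Q N\<close> survives in the limit although \<open>a\<^sup>2\<close> itself cannot
      be compressed.\<close>
    then have "(\<lambda>N. partial_sum a N z * a z - compress (\<lambda>z. partial_sum a N z * a z) z) \<longlonglongrightarrow> a z * a z - A a z"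
      by (intro tendsto_diff tendsto_mult tendsto_const partial_sum_tendsto a z)
    then have "(\<lambda>N. cmod (\<Theta> z * Q N z)) \<longlonglongrightarrow> cmod (a z * a z - A a z)"
      by (intro tendsto_norm) (simp add: compress_def Q_def)
    then have 1: "cmod (a z * a z - A a z) \<le> cmod (\<Theta> z) * ((H2_norm a)\<^sup>2 / (1 - cmod z))"
      by (rule LIMSEQ_le_const2) (intro exI allI impI, unfold norm_mult, intro mult_left_mono Q_bound z norm_ge_zero)
    have 2: "cmod (\<Theta> z * q z) \<le> cmod (\<Theta> z) * (H2_norm q / (1 - cmod z))"
      unfolding norm_mult using H2_eval_norm_bound[OF q z] by (rule mult_left_mono) simp
    have "cmod ((a z)\<^sup>2 - z) = cmod ((a z * a z - A a z) - \<Theta> z * q z)"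
      by (simp add: Aaz power2_eq_square)
    also have "\<dots> \<le> cmod (a z * a z - A a z) + cmod (\<Theta> z * q z)"
      by (rule norm_triangle_ineq4)
    also have "\<dots> \<le> cmod (\<Theta> z) * ((H2_norm a)\<^sup>2 / (1 - cmod z)) + cmod (\<Theta> z) * (H2_norm q / (1 - cmod z))"
      using 1 2 by (rule add_mono)
    also have "\<dots> = ((H2_norm a)\<^sup>2 + H2_norm q) * cmod (\<Theta> z) / (1 - cmod z)"
      by (simp add: add_divide_distrib distrib_left mult.commute[of _ "cmod (\<Theta> z)"])
    finally show ?thesis .
  qed
  then show ?thesis unfolding a_def by (rule that)
qed

end

text \<open>The approximants in \<open>square_root_tendsto\<close> depend on the operator only
  through its value at \<open>kernel_zero\<close>.\<close>

lemma square_root_determined: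
  assumes A: "A \<in> bounded_ops \<Theta>" "compose (model_space \<Theta>) A A = compressed_shift \<Theta>"
    and B: "B \<in> bounded_ops \<Theta>" "compose (model_space \<Theta>) B B = compressed_shift \<Theta>"
    and eq: "A kernel_zero = B kernel_zero"
  shows "A = B"
proof
  fix f
  show "A f = B f"
  proof (cases "f \<in> model_space \<Theta>")
    case True
    show ?thesis
    proof
      fix z show "A f z = B f z"
      proof (cases "cmod z < 1")
        case z: True
        show ?thesis
          using square_root_tendsto[OF A True z] square_root_tendsto[OF B True z] LIMSEQ_unique unfolding eq by blast
      next
        case False
        then show ?thesis
          using H2_zero[OF model_space_H2[OF bounded_ops_model_space[OF A(1) True]]]
            H2_zero[OF model_space_H2[OF bounded_ops_model_space[OF B(1) True]]] by auto
      qed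
    qed
  qed (use bounded_ops_undefined A(1) B(1) in auto)
qed

end

section \<open>Mikusinski's lemma\<close>

text \<open>Lebesgue measure on \<open>[0, 1]\<close> as a finite measure on the line, so that
  Fubini with the circle and domination by constants apply without restricting to a set.\<close>

definition unit_measure :: "real measure" where
  "unit_measure = uniform_measure lborel {0..1}"

lemma sets_unit_measure [simp, measurable_cong]: "sets unit_measure = sets borel"
  by (simp add: unit_measure_def)

lemma space_unit_measure [simp]: "space unit_measure = UNIV"
  by (simp add: unit_measure_def)

lemma borel_measurable_unit_measure [simp]: "borel_measurable unit_measure = borel_measurable borel"
  by (intro measurable_cong_sets) simp_all

lemma emeasure_unit_measure_UNIV: "emeasure unit_measure UNIV = 1"
  unfolding unit_measure_def by (subst emeasure_uniform_measure) auto

lemma measure_unit_measure_UNIV [simp]: "measure unit_measure UNIV = 1"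
  by (simp add: measure_def emeasure_unit_measure_UNIV)

interpretation unit: finite_measure unit_measure
  by (rule finite_measureI) (simp add: emeasure_unit_measure_UNIV)

lemma AE_unit_measure_bounds: "AE t in unit_measure. 0 \<le> t \<and> t \<le> 1"
  unfolding unit_measure_def by (intro AE_uniform_measureI) auto

lemma AE_unit_measure_neq: "AE t in unit_measure. t \<noteq> c"
  unfolding unit_measure_def
  by (intro AE_uniform_measureI) (use AE_lborel_singleton[of c] in auto)

lemma integral_unit_measure:
  fixes g :: "real \<Rightarrow> complex"
  assumes g: "continuous_on UNIV g" and \<tau>: "0 \<le> \<tau>" "\<tau> \<le> 1"
  shows "(\<integral>t. indicator {..\<tau>} t *\<^sub>R g t \<partial>unit_measure) = integral {0..\<tau>} g"
proof -
  have [measurable]: "g \<in> borel_measurable borel" by (rule borel_measurable_continuous_onI[OF g])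
  have "unit_measure = density lborel (\<lambda>t. ennreal (indicator {0..1} t))"
    unfolding unit_measure_def uniform_measure_def
    by (intro density_cong) (auto simp: indicator_def)
  moreover have "(\<integral>t. indicator {..\<tau>} t *\<^sub>R g t \<partial>density lborel (\<lambda>t. ennreal (indicator {0..1} t))) =
      (\<integral>t. indicator {0..1} t *\<^sub>R (indicator {..\<tau>} t *\<^sub>R g t) \<partial>lborel)"
    by (rule integral_density) auto
  ultimately have "(\<integral>t. indicator {..\<tau>} t *\<^sub>R g t \<partial>unit_measure) = (\<integral>t. indicator {0..1} t *\<^sub>R (indicator {..\<tau>} t *\<^sub>R g t) \<partial>lborel)"
    by metis
  also have "\<dots> = (LBINT t:{0..\<tau>}. g t)"
    unfolding set_lebesgue_integral_def using \<tau>
    by (intro Bochner_Integration.integral_cong) (auto simp: indicator_def)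
  also have "\<dots> = integral {0..\<tau>} g"
    by (intro set_borel_integral_eq_integral borel_integrable_atLeastAtMost' continuous_on_subset[OF g]) auto
  finally show ?thesis .
qed

lemma integral_unit_measure_full:
  fixes g :: "real \<Rightarrow> complex"
  assumes g: "continuous_on UNIV g"
  shows "(\<integral>t. g t \<partial>unit_measure) = integral {0..1} g"
proof -
  have [measurable]: "g \<in> borel_measurable borel" by (rule borel_measurable_continuous_onI[OF g])
  have "(\<integral>t. g t \<partial>unit_measure) = (\<integral>t. indicator {..1} t *\<^sub>R g t \<partial>unit_measure)"
    by (intro integral_cong_AE) (use AE_unit_measure_bounds in \<open>simp, simp, eventually_elim, simp\<close>)
  then show ?thesis using integral_unit_measure[OF g, of 1] by simp
qed

text \<open>The primitive vanishes on the open interval, hence so does its derivative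
  \<open>g\<close>; continuity adds the endpoints.\<close>

lemma integral_0_imp_continuous_0:
  fixes g :: "real \<Rightarrow> complex"
  assumes g: "continuous_on {0..1} g" and int: "\<And>\<tau>. 0 < \<tau> \<Longrightarrow> \<tau> < 1 \<Longrightarrow> integral {0..\<tau>} g = 0"
    and t: "t \<in> {0..1}"
  shows "g t = 0"
proof -
  have "g t = 0" if t: "t \<in> {0<..<1}" for t
  proof -
    have "((\<lambda>u. integral {0..u} g) has_vector_derivative g t) (at t within {0..1})"
      using g t by (intro integral_has_vector_derivative) auto
    then have "((\<lambda>u. integral {0..u} g) has_vector_derivative g t) (at t)"
      using t at_within_interior[of t "{0..1::real}"] by simp
    moreover have "((\<lambda>u. integral {0..u} g) has_vector_derivative 0) (at t)"
      by (rule has_vector_derivative_transform_within_open[OF has_vector_derivative_const, of "{0<..<1}"])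
        (use t int in auto)
    ultimately show ?thesis by (rule vector_derivative_unique_at)
  qed
  moreover have "closure {0<..<1::real} = {0..1}" by simp
  ultimately show ?thesis
    using continuous_constant_on_closure[of "{0<..<1}" g 0 t] g t by auto
qed

text \<open>Mikusinski's argument: the weights \<open>1 - exp (- exp (n (\<tau> - t)))\<close> tend to the indicator of
  \<open>[0, \<tau>)\<close>, and they expand into the exponentials \<open>exp (m n (1 - t))\<close> with coefficients that are
  summable even when multiplied by the bound \<open>C\<close>.\<close>

lemma exp_moments_bounded_imp_0:
  fixes g :: "real \<Rightarrow> complex"
  assumes g: "continuous_on UNIV g"
    and bound: "\<And>n. N \<le> n \<Longrightarrow> cmod (\<integral>t. exp (real n * (1 - t)) *\<^sub>R g t \<partial>unit_measure) \<le> C"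
    and t: "t \<in> {0..1}"
  shows "g t = 0"
proof (rule integral_0_imp_continuous_0[OF continuous_on_subset[OF g] _ t])
  fix \<tau> :: real assume \<tau>: "0 < \<tau>" "\<tau> < 1"
  have [measurable]: "g \<in> borel_measurable borel" by (rule borel_measurable_continuous_onI[OF g])
  obtain B where B: "\<And>t. t \<in> {0..1} \<Longrightarrow> cmod (g t) \<le> B"
    using compact_imp_bounded[OF compact_continuous_image[OF continuous_on_subset[OF g] compact_Icc[of 0 1]]]
    by (force simp: bounded_iff)
  have C: "0 \<le> C" using order_trans[OF norm_ge_zero bound[of N]] by simp
  define w where "w n t = 1 - exp (- exp (real n * (\<tau> - t)))" for n t
  have w_bound: "\<bar>w n t\<bar> \<le> 1" for n t by (simp add: w_def)
  have sums_w: "(\<lambda>m. - ((- exp (real n * (\<tau> - t))) ^ Suc m / fact (Suc m))) sums w n t" for n t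
  proof -
    have "(\<lambda>m. (- exp (real n * (\<tau> - t))) ^ m / fact m) sums exp (- exp (real n * (\<tau> - t)))"
      using exp_converges[of "- exp (real n * (\<tau> - t))"] by (simp add: divide_inverse mult.commute)
    from sums_split_initial_segment[OF this, of 1]
    have "(\<lambda>m. (- exp (real n * (\<tau> - t))) ^ Suc m / fact (Suc m)) sums (exp (- exp (real n * (\<tau> - t))) - 1)"
      by simp
    from sums_minus[OF this] show ?thesis by (simp add: w_def)
  qed
  have lim: "(\<lambda>n. \<integral>t. w n t *\<^sub>R g t \<partial>unit_measure) \<longlonglongrightarrow> (\<integral>t. indicator {..\<tau>} t *\<^sub>R g t \<partial>unit_measure)"
  proof (rule integral_dominated_convergence[where w = "\<lambda>_. B"])
    show "AE t in unit_measure. (\<lambda>n. w n t *\<^sub>R g t) \<longlonglongrightarrow> indicator {..\<tau>} t *\<^sub>R g t"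
      \<comment> \<open>At \<open>t = \<tau>\<close> the weight is \<open>1 - exp (- 1)\<close> for
        every \<open>n\<close>, so this point is excluded.\<close>
      using AE_unit_measure_neq[of \<tau>]
    proof eventually_elim
      case (elim t)
      have "(\<lambda>n. w n t) \<longlonglongrightarrow> indicator {..\<tau>} t"
      proof (cases "t < \<tau>")
        case True
        have "filterlim (\<lambda>n. exp (real n * (\<tau> - t))) at_top sequentially"
          by (rule filterlim_compose[OF exp_at_top])
            (rule filterlim_at_top_mult_tendsto_pos[OF tendsto_const _ filterlim_real_sequentially], use True in simp)
        then have "(\<lambda>n. exp (- exp (real n * (\<tau> - t)))) \<longlonglongrightarrow> 0"
          by (intro filterlim_compose[OF exp_at_bot]) (simp add: filterlim_uminus_at_bot)
        then show ?thesis
          using tendsto_diff[OF tendsto_const[of 1]] True by (fastforce simp: w_def)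
      next
        case False
        then have "0 < t - \<tau>" using elim by simp
        then have "filterlim (\<lambda>n. real n * (t - \<tau>)) at_top sequentially"
          by (rule filterlim_at_top_mult_tendsto_pos[OF tendsto_const _ filterlim_real_sequentially])
        then have "(\<lambda>n. exp (- (real n * (t - \<tau>)))) \<longlonglongrightarrow> 0"
          by (intro filterlim_compose[OF exp_at_bot]) (simp add: filterlim_uminus_at_bot)
        then have "(\<lambda>n. exp (real n * (\<tau> - t))) \<longlonglongrightarrow> 0"
          by (simp add: algebra_simps)
        then have "(\<lambda>n. 1 - exp (- exp (real n * (\<tau> - t)))) \<longlonglongrightarrow> 1 - exp (- 0)"
          by (intro tendsto_intros)
        then show ?thesis using False elim by (simp add: w_def)
      qed
      then show ?case by (intro tendsto_intros)
    qed
    show "AE t in unit_measure. norm (w n t *\<^sub>R g t) \<le> B" for n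
      using AE_unit_measure_bounds
    proof eventually_elim
      case (elim t)
      have "norm (w n t *\<^sub>R g t) \<le> 1 * cmod (g t)"
        unfolding norm_scaleR using w_bound by (intro mult_right_mono) auto
      then show ?case using B[of t] elim by auto
    qed
  qed (auto simp: w_def)
  have small: "cmod (\<integral>t. w n t *\<^sub>R g t \<partial>unit_measure) \<le> C * (exp (exp (- (real n * (1 - \<tau>)))) - 1)"
    if n: "N \<le> n" for n
  proof -
    \<comment> \<open>The factor \<open>exp (- (n * (1 - \<tau>)))\<close> separates
      \<open>exp (n * (\<tau> - t))\<close> from \<open>exp (n * (1 - t))\<close>. The constant term
      of the exponential series cancels the 1 in \<open>w\<close>, so the powers start at
      \<open>Suc m\<close> and only moments of order at least \<open>n\<close> occur, where
      \<open>bound\<close> applies.\<close>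
    define c where "c m = - ((- exp (- (real n * (1 - \<tau>)))) ^ Suc m / fact (Suc m))" for m
    define h where "h m t = (c m * exp (real (Suc m * n) * (1 - t))) *\<^sub>R g t" for m t
    have ch: "c m * exp (real (Suc m * n) * (1 - t)) = - ((- exp (real n * (\<tau> - t))) ^ Suc m / fact (Suc m))" for m t
    proof -
      have "exp (real (Suc m * n) * (1 - t)) = exp (real n * (1 - t)) ^ Suc m"
        unfolding exp_of_nat_mult[symmetric] by (simp add: algebra_simps)
      then have "c m * exp (real (Suc m * n) * (1 - t)) =
        - ((- exp (- (real n * (1 - \<tau>))) * exp (real n * (1 - t))) ^ Suc m / fact (Suc m))"
        by (simp only: c_def power_mult_distrib) simp
      also have "- exp (- (real n * (1 - \<tau>))) * exp (real n * (1 - t)) = - exp (real n * (\<tau> - t))"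
        by (simp add: exp_add[symmetric] algebra_simps)
      finally show ?thesis .
    qed
    have c_abs: "\<bar>c m\<bar> = exp (- (real n * (1 - \<tau>))) ^ Suc m / fact (Suc m)" for m
      by (simp add: c_def abs_mult power_abs)
    have c_sums: "(\<lambda>m. \<bar>c m\<bar>) sums (exp (exp (- (real n * (1 - \<tau>)))) - 1)"
    proof -
      have "(\<lambda>m. exp (- (real n * (1 - \<tau>))) ^ m / fact m) sums exp (exp (- (real n * (1 - \<tau>))))"
        using exp_converges[of "exp (- (real n * (1 - \<tau>)))"] by (simp add: divide_inverse mult.commute)
      from sums_split_initial_segment[OF this, of 1] show ?thesis
        unfolding c_abs by simp
    qed
    have hbd: "norm (h m t) \<le> exp (real n) ^ Suc m / fact (Suc m) * B" if t: "0 \<le> t \<and> t \<le> 1" for m t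
    proof -
      have "exp (real n * (\<tau> - t)) \<le> exp (real n * 1)"
        using t \<tau> by (intro iffD2[OF exp_le_cancel_iff] mult_left_mono) auto
      then have "exp (real n * (\<tau> - t)) ^ Suc m / fact (Suc m) \<le> exp (real n) ^ Suc m / fact (Suc m)"
        by (intro divide_right_mono power_mono) auto
      moreover have "norm (h m t) = exp (real n * (\<tau> - t)) ^ Suc m / fact (Suc m) * cmod (g t)"
        unfolding h_def ch by (simp add: abs_mult power_abs)
      ultimately show ?thesis using B[of t] t by (simp only:) (intro mult_mono, auto)
    qed
    have hint: "integrable unit_measure (h m)" for m
    proof (rule Bochner_Integration.integrable_bound)
      show "integrable unit_measure (\<lambda>_. exp (real n) ^ Suc m / fact (Suc m) * B)" by simp
      show "AE t in unit_measure. norm (h m t) \<le> norm (exp (real n) ^ Suc m / fact (Suc m) * B)"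
        using AE_unit_measure_bounds by eventually_elim (metis hbd abs_ge_self order_trans real_norm_def)
    qed (simp add: h_def[abs_def])
    have esum: "summable (\<lambda>m. exp (real n) ^ Suc m / fact (Suc m) * B)"
    proof (rule summable_mult2)
      have "summable (\<lambda>m. exp (real n) ^ m / fact m)"
        using summable_exp[of "exp (real n)"] by (simp add: divide_inverse mult.commute)
      then show "summable (\<lambda>m. exp (real n) ^ Suc m / fact (Suc m))"
        using summable_ignore_initial_segment[of _ 1] by fastforce
    qed
    have "(\<lambda>m. \<integral>t. h m t \<partial>unit_measure) sums (\<integral>t. (\<Sum>m. h m t) \<partial>unit_measure)"
    proof (rule sums_integral[OF hint])
      show "AE t in unit_measure. summable (\<lambda>m. norm (h m t))"
        using AE_unit_measure_bounds
        by eventually_elim (rule summable_comparison_test'[OF esum], use hbd in auto)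
      show "summable (\<lambda>m. \<integral>t. norm (h m t) \<partial>unit_measure)"
      proof (rule summable_comparison_test'[OF esum])
        fix m
        have "(\<integral>t. norm (h m t) \<partial>unit_measure) \<le> (\<integral>t. exp (real n) ^ Suc m / fact (Suc m) * B \<partial>unit_measure)"
        proof (rule integral_mono_AE)
          show "AE t in unit_measure. norm (h m t) \<le> exp (real n) ^ Suc m / fact (Suc m) * B"
            using AE_unit_measure_bounds by eventually_elim (rule hbd)
        qed (use hint in auto)
        then show "norm (\<integral>t. norm (h m t) \<partial>unit_measure) \<le> exp (real n) ^ Suc m / fact (Suc m) * B"
          by simp
      qed
    qed
    moreover have "(\<Sum>m. h m t) = w n t *\<^sub>R g t" for t
      using sums_scaleR_left[OF sums_w[of n t], of "g t"] unfolding h_def ch by (simp add: sums_iff)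
    ultimately have sums: "(\<lambda>m. \<integral>t. h m t \<partial>unit_measure) sums (\<integral>t. w n t *\<^sub>R g t \<partial>unit_measure)" by simp
    have h_le: "cmod (\<integral>t. h m t \<partial>unit_measure) \<le> \<bar>c m\<bar> * C" for m
    proof -
      have "(\<integral>t. h m t \<partial>unit_measure) = c m *\<^sub>R (\<integral>t. exp (real (Suc m * n) * (1 - t)) *\<^sub>R g t \<partial>unit_measure)"
        unfolding h_def by (simp add: scaleR_scaleR[symmetric] del: scaleR_scaleR)
      moreover have "N \<le> Suc m * n" using n by simp
      ultimately show ?thesis using bound[of "Suc m * n"] by (simp only: norm_scaleR) (intro mult_left_mono, auto)
    qed
    have "cmod (\<integral>t. w n t *\<^sub>R g t \<partial>unit_measure) = cmod (\<Sum>m. \<integral>t. h m t \<partial>unit_measure)"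
      using sums by (simp add: sums_iff)
    also have "\<dots> \<le> (\<Sum>m. \<bar>c m\<bar> * C)"
      using c_sums by (intro norm_suminf_le h_le summable_mult2) (auto simp: sums_iff)
    also have "\<dots> = (exp (exp (- (real n * (1 - \<tau>)))) - 1) * C"
      using sums_mult2[OF c_sums, of C] by (simp add: sums_iff)
    finally show ?thesis by (simp add: mult.commute)
  qed
  have "(\<lambda>n. C * (exp (exp (- (real n * (1 - \<tau>)))) - 1)) \<longlonglongrightarrow> C * (exp 0 - 1)"
  proof (intro tendsto_intros)
    have "filterlim (\<lambda>n. real n * (1 - \<tau>)) at_top sequentially"
      by (rule filterlim_at_top_mult_tendsto_pos[OF tendsto_const _ filterlim_real_sequentially]) (use \<tau> in simp)
    then show "(\<lambda>n. exp (- (real n * (1 - \<tau>)))) \<longlonglongrightarrow> 0"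
      by (intro filterlim_compose[OF exp_at_bot]) (simp add: filterlim_uminus_at_bot)
  qed
  then have "(\<lambda>n. C * (exp (exp (- (real n * (1 - \<tau>)))) - 1)) \<longlonglongrightarrow> 0" by simp
  then have "(\<lambda>n. \<integral>t. w n t *\<^sub>R g t \<partial>unit_measure) \<longlonglongrightarrow> 0"
    by (rule Lim_null_comparison[OF eventually_mono[OF eventually_ge_at_top[of N] small], rotated])
  then have "(\<integral>t. indicator {..\<tau>} t *\<^sub>R g t \<partial>unit_measure) = 0"
    using lim LIMSEQ_unique by blast
  then show "integral {0..\<tau>} g = 0"
    using integral_unit_measure[OF g, of \<tau>] \<tau> by simp
qed auto

section \<open>The atomic inner function\<close>

lemma Re_cayley:
  assumes "z \<noteq> 1"
  shows "Re ((z + 1) / (z - 1)) = ((cmod z)\<^sup>2 - 1) / (cmod (z - 1))\<^sup>2"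
proof -
  have "Re ((z + 1) / (z - 1)) = Re ((z + 1) * cnj (z - 1)) / (cmod (z - 1))\<^sup>2"
    by (simp add: Re_divide cmod_power2)
  also have "Re ((z + 1) * cnj (z - 1)) = (cmod z)\<^sup>2 - 1"
    by (simp only: cmod_power2) (simp add: algebra_simps power2_eq_square)
  finally show ?thesis .
qed

text \<open>At \<open>\<zeta> = 1\<close> division by 0 makes the quotient 0, so the powers of
  \<open>\<Theta>\<close> have modulus 1 on the whole circle without an exceptional point.\<close>

lemma Re_cayley_circle: "cmod \<zeta> = 1 \<Longrightarrow> Re ((\<zeta> + 1) / (\<zeta> - 1)) = 0"
  by (cases "\<zeta> = 1") (simp_all add: Re_cayley)

lemma Re_cayley_disc: "cmod z < 1 \<Longrightarrow> Re ((z + 1) / (z - 1)) < 0"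
  by (subst Re_cayley) (auto simp: abs_square_less_1 intro!: divide_neg_pos)

lemma atomic_inner_Hinf: "atomic_inner \<in> Hinf"
proof (rule HinfI)
  show "atomic_inner holomorphic_on ball 0 1"
    unfolding atomic_inner_def[abs_def] by (intro holomorphic_intros) auto
  show "cmod (atomic_inner z) \<le> 1" if "z \<in> ball 0 1" for z
    using Re_cayley_disc[of z] that by (simp add: atomic_inner_def)
qed

lemma Hinf_bv_continuous:
  assumes "\<psi> \<in> Hinf" "\<And>\<zeta>. cmod \<zeta> = 1 \<Longrightarrow> \<zeta> \<noteq> 1 \<Longrightarrow> isCont \<psi> \<zeta>"
  shows "AE \<zeta> in circle_measure. Hinf_bv \<psi> \<zeta> = \<psi> \<zeta>"
  using tendsto_Hinf_bv[OF assms(1)] AE_circle_norm AE_circle_neq_1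
proof eventually_elim
  case (elim \<zeta>)
  have "((\<lambda>r::real. \<psi> (of_real r * \<zeta>)) \<longlongrightarrow> \<psi> \<zeta>) (at 1)"
    by (rule isCont_tendsto_compose[OF assms(2)[OF elim(2,3)]]) (auto intro!: tendsto_eq_intros)
  then have "((\<lambda>r::real. \<psi> (of_real r * \<zeta>)) \<longlongrightarrow> \<psi> \<zeta>) (at_left 1)"
    by (rule tendsto_mono[rotated]) (simp add: at_le)
  then show ?case using tendsto_unique[OF _ elim(1)] by simp
qed

lemma Hinf_bv_atomic_inner: "AE \<zeta> in circle_measure. Hinf_bv atomic_inner \<zeta> = atomic_inner \<zeta>"
  by (rule Hinf_bv_continuous[OF atomic_inner_Hinf])
    (auto simp: atomic_inner_def[abs_def] intro!: continuous_intros)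

interpretation atomic: inner_function atomic_inner
proof
  show "AE \<zeta> in circle_measure. cmod (Hinf_bv atomic_inner \<zeta>) = 1"
    using Hinf_bv_atomic_inner AE_circle_norm
    by eventually_elim (simp add: atomic_inner_def Re_cayley_circle)
qed (rule atomic_inner_Hinf)

text \<open>The real powers of \<open>\<Theta>\<close>, that is \<open>exp (- t * w)\<close> in the
  half-plane variable \<open>w = (1 + z) / (1 - z)\<close>.\<close>

definition atomic_power :: "real \<Rightarrow> complex \<Rightarrow> complex" where
  "atomic_power t z = exp (of_real t * ((z + 1) / (z - 1)))"

lemma atomic_power_0 [simp]: "atomic_power 0 z = 1"
  by (simp add: atomic_power_def)

lemma atomic_power_1: "atomic_power 1 = atomic_inner"
  by (simp add: atomic_power_def atomic_inner_def fun_eq_iff)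

lemma cmod_atomic_power_circle:
  assumes "cmod \<zeta> = 1"
  shows "cmod (atomic_power t \<zeta>) = 1"
proof -
  have "Re (of_real t * w) = t * Re w" for w by simp
  then show ?thesis
    unfolding atomic_power_def norm_exp_eq_Re using Re_cayley_circle[OF assms]
    by (simp del: times_divide_eq_right)
qed

lemma atomic_inner_measurable [measurable]: "atomic_inner \<in> borel_measurable borel"
  unfolding atomic_inner_def[abs_def] by measurable

lemma atomic_power_measurable [measurable]:
  assumes [measurable]: "f \<in> borel_measurable M" "g \<in> borel_measurable M"
  shows "(\<lambda>x. atomic_power (f x) (g x)) \<in> borel_measurable M"
  unfolding atomic_power_def by measurable

definition atomic_moment :: "(complex \<Rightarrow> complex) \<Rightarrow> real \<Rightarrow> complex" where
  "atomic_moment f t = L2_inner (radial_bv f) (atomic_power t)"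

lemma continuous_atomic_moment:
  assumes f: "f \<in> H2"
  shows "continuous_on UNIV (atomic_moment f)"
  unfolding continuous_on_sequentially
proof (intro allI ballI impI)
  fix s :: "nat \<Rightarrow> real" and t assume "(\<forall>n. s n \<in> UNIV) \<and> s \<longlonglongrightarrow> t"
  then have s: "s \<longlonglongrightarrow> t" by simp
  note [measurable] = radial_bv_measurable[OF f]
  show "(atomic_moment f \<circ> s) \<longlonglongrightarrow> atomic_moment f t"
    unfolding atomic_moment_def L2_inner_def o_def
  proof (rule integral_dominated_convergence[where w = "\<lambda>\<zeta>. cmod (radial_bv f \<zeta>)"])
    show "(\<lambda>\<zeta>. radial_bv f \<zeta> * cnj (atomic_power t \<zeta>)) \<in> borel_measurable circle_measure"
      "(\<lambda>\<zeta>. radial_bv f \<zeta> * cnj (atomic_power (s n) \<zeta>)) \<in> borel_measurable circle_measure" for n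
      by measurable
    show "integrable circle_measure (\<lambda>\<zeta>. cmod (radial_bv f \<zeta>))"
      using L2_circle_integrable[OF radial_bv_L2[OF f]] by auto
    show "AE \<zeta> in circle_measure. (\<lambda>n. radial_bv f \<zeta> * cnj (atomic_power (s n) \<zeta>)) \<longlonglongrightarrow> radial_bv f \<zeta> * cnj (atomic_power t \<zeta>)"
      unfolding atomic_power_def by (intro always_eventually allI tendsto_intros s)
    show "AE \<zeta> in circle_measure. norm (radial_bv f \<zeta> * cnj (atomic_power (s n) \<zeta>)) \<le> cmod (radial_bv f \<zeta>)" for n
      using AE_circle_norm by eventually_elim (simp add: norm_mult cmod_atomic_power_circle)
  qed
qed

text \<open>Orthogonality to multiples of \<open>\<Theta>\<close> for an explicit boundary function
  \<open>g'\<close>. It removes the last term of \<open>szego_atomic_power\<close> after integration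
  against \<open>f\<close>.\<close>

lemma H2_inner_atomic_mult:
  assumes f: "f \<in> model_space atomic_inner" and g: "g \<in> Hinf" "AE \<zeta> in circle_measure. Hinf_bv g \<zeta> = g' \<zeta>"
    and g' [measurable]: "g' \<in> borel_measurable borel"
  shows "L2_inner (radial_bv f) (\<lambda>\<zeta>. atomic_inner \<zeta> * g' \<zeta>) = 0"
proof -
  have gd: "(\<lambda>z. g z * disc_one z) \<in> H2" by (intro H2_Hinf_mult g disc_one_H2)
  note [measurable] = radial_bv_measurable[OF atomic.model_space_H2[OF f]] radial_bv_measurable[OF atomic.mult_H2[OF gd]]
  have "L2_inner (radial_bv f) (\<lambda>\<zeta>. atomic_inner \<zeta> * g' \<zeta>) =
    H2_inner f (\<lambda>z. atomic_inner z * (g z * disc_one z))"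
  proof (rule L2_inner_cong_AE)
    show "AE \<zeta> in circle_measure. atomic_inner \<zeta> * g' \<zeta> = radial_bv (\<lambda>z. atomic_inner z * (g z * disc_one z)) \<zeta>"
      using Hinf_bv_atomic_inner radial_bv_Hinf_mult[OF atomic_inner_Hinf gd] g(2)
      by eventually_elim (simp add: Hinf_bv_def)
  qed measurable
  also have "\<dots> = 0" by (rule atomic.model_space_orthogonal[OF f gd])
  finally show ?thesis .
qed

lemma atomic_moment_1:
  assumes "f \<in> model_space atomic_inner"
  shows "atomic_moment f 1 = 0"
proof -
  have "AE \<zeta> in circle_measure. Hinf_bv (\<lambda>_. 1) \<zeta> = 1"
    by (rule Hinf_bv_continuous[OF Hinf_const]) auto
  from H2_inner_atomic_mult[OF assms Hinf_const this] show ?thesis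
    by (simp add: atomic_moment_def atomic_power_1)
qed

lemma integral_unit_measure_exp:
  assumes "c \<noteq> (0::complex)"
  shows "(\<integral>t. exp (- (of_real t * c)) \<partial>unit_measure) = (1 - exp (- c)) / c"
proof -
  have "((\<lambda>t. exp (- (of_real t * c))) has_integral (- exp (- (of_real 1 * c)) / c - (- exp (- (of_real 0 * c)) / c))) {0..1}"
  proof (rule fundamental_theorem_of_calculus)
    fix t :: real assume "t \<in> {0..1}"
    have "((\<lambda>z. - exp (- (z * c)) / c) has_field_derivative exp (- (of_real t * c))) (at (of_real t))"
      using assms by (auto intro!: derivative_eq_intros)
    from has_vector_derivative_real_field[OF this, of "{0..1}"]
    show "((\<lambda>t. - exp (- (of_real t * c)) / c) has_vector_derivative exp (- (of_real t * c))) (at t within {0..1})"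
      by (simp add: o_def)
  qed simp
  then have "integral {0..1} (\<lambda>t. exp (- (of_real t * c))) = (1 - exp (- c)) / c"
    by (simp add: integral_unique diff_divide_distrib)
  then show ?thesis
    by (subst integral_unit_measure_full) (auto intro!: continuous_intros)
qed

text \<open>In the half-plane variable \<open>w = (1 + z) / (1 - z)\<close>, for which \<open>\<Theta> = exp (- w)\<close> and \<open>x\<close>
  corresponds to \<open>X\<close>, the Szego kernel at \<open>x\<close> is \<open>(1 - (X - 1) / (X + w)) / (1 - x)\<close>.\<close>

lemma szego_atomic_power:
  assumes X: "1 \<le> X" and \<zeta>: "cmod \<zeta> = 1" "\<zeta> \<noteq> 1"
  defines "x \<equiv> (X - 1) / (X + 1)"
  shows "of_real (1 - x) * szego (of_real x) \<zeta> =
    1 - of_real (X - 1) * (\<integral>t. of_real (exp (- (t * X))) * cnj (atomic_power t \<zeta>) \<partial>unit_measure)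
      - of_real ((X - 1) * exp (- X)) * cnj (atomic_inner \<zeta> * ((1 - \<zeta>) / (of_real (X + 1) * (1 - of_real x * \<zeta>))))"
proof -
  define v where "v = cnj ((\<zeta> + 1) / (\<zeta> - 1))"
  define c where "c = of_real X - v"
  have Re_v: "Re v = 0" using \<zeta> by (simp add: v_def Re_cayley_circle)
  then have c: "c \<noteq> 0" using X by (auto simp: c_def complex_eq_iff)
  have n1: "cnj \<zeta> \<noteq> 1" using \<zeta>(2) by (metis complex_cnj_cnj complex_cnj_one)
  have Xp: "complex_of_real (X + 1) \<noteq> 0" using X by (simp add: complex_eq_iff)
  have x: "0 \<le> x" "x < 1" using X by (auto simp: x_def)
  have Xx: "X - 1 = (X + 1) * x" using X by (simp add: x_def)
  have ne: "1 - of_real x * cnj \<zeta> \<noteq> 0"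
  proof
    assume "1 - of_real x * cnj \<zeta> = 0"
    then have "cmod (of_real x * cnj \<zeta>) = 1" by (metis eq_iff_diff_eq_0 norm_one)
    then show False using x \<zeta> by (simp add: norm_mult)
  qed
  have c_eq: "c = of_real (X + 1) * (1 - of_real x * cnj \<zeta>) / (1 - cnj \<zeta>)"
  proof -
    have "c * (1 - cnj \<zeta>) = of_real X * (1 - cnj \<zeta>) + (cnj \<zeta> + 1)"
      using n1 by (simp add: c_def v_def field_simps)
    also have "\<dots> = of_real (X + 1) - of_real (X - 1) * cnj \<zeta>" by (simp add: algebra_simps)
    also have "of_real (X - 1) = of_real (X + 1) * complex_of_real x"
      using Xx by (metis of_real_mult)
    finally show ?thesis using n1 by (simp add: field_simps)
  qed
  \<comment> \<open>Here \<open>c = X + cnj w\<close>. Integrating \<open>exp (- t * c)\<close> over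
    \<open>[0, 1]\<close> rather than the half-line leaves the end term
    \<open>exp (- c) / c\<close>, and \<open>exp (- c)\<close> is what carries the factor
    \<open>cnj \<Theta>\<close>.\<close>
  have "(\<integral>t. of_real (exp (- (t * X))) * cnj (atomic_power t \<zeta>) \<partial>unit_measure) = (\<integral>t. exp (- (of_real t * c)) \<partial>unit_measure)"
    by (intro Bochner_Integration.integral_cong refl)
      (simp add: atomic_power_def exp_cnj exp_of_real[symmetric] v_def c_def exp_add[symmetric] algebra_simps)
  also have "\<dots> = (1 - exp (- c)) / c" by (rule integral_unit_measure_exp[OF c])
  also have "exp (- c) = of_real (exp (- X)) * cnj (atomic_inner \<zeta>)"
    by (simp add: atomic_inner_def exp_cnj exp_of_real[symmetric] v_def c_def exp_add[symmetric])
  finally have I: "(\<integral>t. of_real (exp (- (t * X))) * cnj (atomic_power t \<zeta>) \<partial>unit_measure) =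
    (1 - of_real (exp (- X)) * cnj (atomic_inner \<zeta>)) / c" .
  have g: "cnj ((1 - \<zeta>) / (of_real (X + 1) * (1 - of_real x * \<zeta>))) = 1 / c"
    using n1 ne Xp by (simp add: c_eq)
  have "of_real (1 - x) * szego (of_real x) \<zeta> = 1 - of_real (X - 1) / c"
  proof -
    have "of_real (X - 1) / c = complex_of_real x * (1 - cnj \<zeta>) / (1 - of_real x * cnj \<zeta>)"
    proof -
      have "of_real (X - 1) = of_real (X + 1) * complex_of_real x"
        using Xx by (metis of_real_mult)
      then show ?thesis unfolding c_eq using Xp n1 by simp
    qed
    then show ?thesis using ne by (simp add: szego_def field_simps)
  qed
  then show ?thesis
    unfolding I complex_cnj_mult g by (simp add: algebra_simps diff_divide_distrib)
qed

text \<open>Integrate \<open>szego_atomic_power\<close> against \<open>f\<close>. The constant gives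
  \<open>atomic_moment f 0\<close>, Fubini turns the middle term into a Laplace transform of the
  moments, and the last one pairs \<open>f\<close> with \<open>\<Theta>\<close> times a bounded
  analytic function.\<close>

lemma model_space_atomic_radius:
  assumes f: "f \<in> model_space atomic_inner" and X: "1 \<le> X"
  defines "x \<equiv> (X - 1) / (X + 1)"
  shows "of_real (1 - x) * f (of_real x) =
    atomic_moment f 0 - of_real (X - 1) * (\<integral>t. of_real (exp (- (t * X))) * atomic_moment f t \<partial>unit_measure)"
proof -
  have f2: "f \<in> H2" by (rule atomic.model_space_H2[OF f])
  have x: "0 \<le> x" "x < 1" using X by (auto simp: x_def)
  note [measurable] = radial_bv_measurable[OF f2]
  note fint = L2_circle_integrable[OF radial_bv_L2[OF f2]]
  \<comment> \<open>In the half-plane variable this is \<open>1 / (X + w)\<close>. It is bounded on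
    the disc because \<open>1 - x * z\<close> has modulus at least \<open>1 - x\<close>
    there.\<close>
  define g where "g z = (1 - z) / (of_real (X + 1) * (1 - of_real x * z))" for z :: complex
  have den: "1 - x \<le> cmod (1 - of_real x * z)" if "cmod z \<le> 1" for z
  proof -
    have "cmod (of_real x * z) \<le> x" using that x by (simp add: norm_mult mult_left_le)
    then show ?thesis using norm_triangle_ineq2[of 1 "of_real x * z"] by simp
  qed
  have ne: "of_real (X + 1) * (1 - of_real x * z) \<noteq> 0" if "cmod z \<le> 1" for z
  proof -
    have "0 < cmod (1 - of_real x * z)" using den[OF that] x by linarith
    moreover have "complex_of_real (X + 1) \<noteq> 0" using X by (simp add: complex_eq_iff)
    ultimately show ?thesis by auto
  qed
  have gH: "g \<in> Hinf"
  proof (rule HinfI)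
    show "g holomorphic_on ball 0 1"
      unfolding g_def[abs_def] using ne by (intro holomorphic_intros) auto
    show "cmod (g z) \<le> 2 / ((X + 1) * (1 - x))" if "z \<in> ball 0 1" for z
    proof -
      have "cmod (1 - z) \<le> 2" using norm_triangle_ineq4[of 1 z] that by simp
      moreover have "(X + 1) * (1 - x) \<le> cmod (of_real (X + 1) * (1 - of_real x * z))"
        unfolding norm_mult using den[of z] that X x by (intro mult_mono) auto
      moreover have "0 < (X + 1) * (1 - x)" using X x by simp
      ultimately show ?thesis unfolding g_def norm_divide by (intro frac_le) auto
    qed
  qed
  have [measurable]: "g \<in> borel_measurable borel" unfolding g_def[abs_def] by measurable
  have g_bv: "AE \<zeta> in circle_measure. Hinf_bv g \<zeta> = g \<zeta>"
    by (rule Hinf_bv_continuous[OF gH]) (unfold g_def, intro continuous_intros ne, simp)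
  define J where "J \<zeta> = (\<integral>t. of_real (exp (- (t * X))) * cnj (atomic_power t \<zeta>) \<partial>unit_measure)" for \<zeta>
  interpret prod: pair_sigma_finite circle_measure unit_measure ..
  define k where "k \<zeta> t = radial_bv f \<zeta> * (of_real (exp (- (t * X))) * cnj (atomic_power t \<zeta>))" for \<zeta> t
  have k_meas: "(\<lambda>(\<zeta>, t). k \<zeta> t) \<in> borel_measurable (circle_measure \<Otimes>\<^sub>M unit_measure)"
    unfolding k_def by measurable
  have k_bound: "AE t in unit_measure. cmod (k \<zeta> t) \<le> cmod (radial_bv f \<zeta>)" if "cmod \<zeta> = 1" for \<zeta>
    using AE_unit_measure_bounds
  proof eventually_elim
    case (elim t)
    then show ?case using that X
      by (simp add: k_def norm_mult cmod_atomic_power_circle mult_left_le)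
  qed
  have k_int: "integrable unit_measure (k \<zeta>)" if "cmod \<zeta> = 1" for \<zeta>
  proof (rule Bochner_Integration.integrable_bound)
    show "integrable unit_measure (\<lambda>_. cmod (radial_bv f \<zeta>))" by simp
    show "k \<zeta> \<in> borel_measurable unit_measure" unfolding k_def by measurable
    show "AE t in unit_measure. norm (k \<zeta> t) \<le> norm (cmod (radial_bv f \<zeta>))"
      using k_bound[OF that] by simp
  qed
  have k_prod: "integrable (circle_measure \<Otimes>\<^sub>M unit_measure) (\<lambda>(\<zeta>, t). k \<zeta> t)"
  proof (rule prod.Fubini_integrable[OF k_meas])
    show "AE \<zeta> in circle_measure. integrable unit_measure (\<lambda>t. case (\<zeta>, t) of (\<zeta>, t) \<Rightarrow> k \<zeta> t)"
      using AE_circle_norm by eventually_elim (use k_int in simp)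
    show "integrable circle_measure (\<lambda>\<zeta>. \<integral>t. norm (case (\<zeta>, t) of (\<zeta>, t) \<Rightarrow> k \<zeta> t) \<partial>unit_measure)"
    proof (rule Bochner_Integration.integrable_bound)
      show "integrable circle_measure (\<lambda>\<zeta>. cmod (radial_bv f \<zeta>))" using fint by auto
      show "(\<lambda>\<zeta>. \<integral>t. norm (case (\<zeta>, t) of (\<zeta>, t) \<Rightarrow> k \<zeta> t) \<partial>unit_measure) \<in> borel_measurable circle_measure"
        unfolding k_def by measurable
      show "AE \<zeta> in circle_measure. norm (\<integral>t. norm (case (\<zeta>, t) of (\<zeta>, t) \<Rightarrow> k \<zeta> t) \<partial>unit_measure) \<le> norm (cmod (radial_bv f \<zeta>))"
        using AE_circle_norm
      proof eventually_elim
        case (elim \<zeta>)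
        have "(\<integral>t. norm (k \<zeta> t) \<partial>unit_measure) \<le> (\<integral>t. cmod (radial_bv f \<zeta>) \<partial>unit_measure)"
          using k_int[OF elim] k_bound[OF elim] by (intro integral_mono_AE) auto
        then show ?case by simp
      qed
    qed
  qed
  have J_int: "integrable circle_measure (\<lambda>\<zeta>. radial_bv f \<zeta> * J \<zeta>)"
  proof -
    have "integrable circle_measure (\<lambda>\<zeta>. \<integral>t. k \<zeta> t \<partial>unit_measure)"
      using prod.integrable_fst'[OF k_prod] by simp
    then show ?thesis by (simp add: k_def J_def)
  qed
  have J: "(\<integral>\<zeta>. radial_bv f \<zeta> * J \<zeta> \<partial>circle_measure) = (\<integral>t. of_real (exp (- (t * X))) * atomic_moment f t \<partial>unit_measure)"
  proof -
    have "(\<integral>\<zeta>. radial_bv f \<zeta> * J \<zeta> \<partial>circle_measure) = (\<integral>\<zeta>. \<integral>t. k \<zeta> t \<partial>unit_measure \<partial>circle_measure)"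
      by (simp add: k_def J_def)
    also have "\<dots> = (\<integral>t. \<integral>\<zeta>. k \<zeta> t \<partial>circle_measure \<partial>unit_measure)"
      by (rule prod.Fubini_integral[OF k_prod, symmetric])
    also have "\<dots> = (\<integral>t. of_real (exp (- (t * X))) * atomic_moment f t \<partial>unit_measure)"
      unfolding k_def atomic_moment_def L2_inner_def
      by (subst integral_mult_right_zero[symmetric]) (simp add: mult_ac)
    finally show ?thesis .
  qed
  define E where "E \<zeta> = cnj (atomic_inner \<zeta> * g \<zeta>)" for \<zeta>
  have ag: "(\<lambda>\<zeta>. atomic_inner \<zeta> * g \<zeta>) \<in> L2_circle"
  proof (rule L2_circle_AE_bounded[where C = "2 / ((X + 1) * (1 - x))"])
    show "(\<lambda>\<zeta>. atomic_inner \<zeta> * g \<zeta>) \<in> borel_measurable borel"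
      by measurable
    show "AE \<zeta> in circle_measure. cmod (atomic_inner \<zeta> * g \<zeta>) \<le> 2 / ((X + 1) * (1 - x))"
      using AE_circle_norm
    proof eventually_elim
      case (elim \<zeta>)
      have "cmod (1 - \<zeta>) \<le> 2" using norm_triangle_ineq4[of 1 \<zeta>] elim by simp
      moreover have "(X + 1) * (1 - x) \<le> cmod (of_real (X + 1) * (1 - of_real x * \<zeta>))"
        unfolding norm_mult using den[of \<zeta>] elim X x by (intro mult_mono) auto
      moreover have "0 < (X + 1) * (1 - x)" using X x by simp
      ultimately have "cmod (g \<zeta>) \<le> 2 / ((X + 1) * (1 - x))" unfolding g_def norm_divide by (intro frac_le) auto
      then show ?case
        using elim by (simp add: norm_mult atomic_inner_def Re_cayley_circle)
    qed
  qed
  have E_int: "integrable circle_measure (\<lambda>\<zeta>. radial_bv f \<zeta> * E \<zeta>)"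
    unfolding E_def using L2_circle_mult_integrable[OF radial_bv_L2[OF f2] ag] .
  have E: "(\<integral>\<zeta>. radial_bv f \<zeta> * E \<zeta> \<partial>circle_measure) = 0"
    using H2_inner_atomic_mult[OF f gH g_bv] unfolding E_def L2_inner_def by simp
  have "of_real (1 - x) * f (of_real x) = (\<integral>\<zeta>. radial_bv f \<zeta> * (of_real (1 - x) * szego (of_real x) \<zeta>) \<partial>circle_measure)"
  proof -
    have "(\<integral>\<zeta>. radial_bv f \<zeta> * (of_real (1 - x) * szego (of_real x) \<zeta>) \<partial>circle_measure) =
      (\<integral>\<zeta>. of_real (1 - x) * (radial_bv f \<zeta> * szego (of_real x) \<zeta>) \<partial>circle_measure)"
      by (simp only: mult.left_commute)
    also have "\<dots> = of_real (1 - x) * f (of_real x)"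
      using H2_reproducing[OF f2, of "of_real x"] x by simp
    finally show ?thesis by simp
  qed
  also have "\<dots> = (\<integral>\<zeta>. radial_bv f \<zeta> - of_real (X - 1) * (radial_bv f \<zeta> * J \<zeta>) -
      of_real ((X - 1) * exp (- X)) * (radial_bv f \<zeta> * E \<zeta>) \<partial>circle_measure)"
  proof (rule integral_cong_AE)
    show "AE \<zeta> in circle_measure. radial_bv f \<zeta> * (of_real (1 - x) * szego (of_real x) \<zeta>) =
      radial_bv f \<zeta> - of_real (X - 1) * (radial_bv f \<zeta> * J \<zeta>) -
      of_real ((X - 1) * exp (- X)) * (radial_bv f \<zeta> * E \<zeta>)"
      using AE_circle_norm AE_circle_neq_1
    proof eventually_elim
      case (elim \<zeta>)
      from szego_atomic_power[OF X elim, folded x_def]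
      have "of_real (1 - x) * szego (of_real x) \<zeta> =
        1 - of_real (X - 1) * J \<zeta> - of_real ((X - 1) * exp (- X)) * E \<zeta>"
        by (simp only: J_def E_def g_def)
      then show ?case by (simp only:) (simp add: algebra_simps)
    qed
    show "(\<lambda>\<zeta>. radial_bv f \<zeta> - of_real (X - 1) * (radial_bv f \<zeta> * J \<zeta>) -
      of_real ((X - 1) * exp (- X)) * (radial_bv f \<zeta> * E \<zeta>)) \<in> borel_measurable circle_measure"
      using fint J_int E_int by (intro borel_measurable_integrable) auto
  qed measurable
  also have "\<dots> = (\<integral>\<zeta>. radial_bv f \<zeta> \<partial>circle_measure) - of_real (X - 1) * (\<integral>\<zeta>. radial_bv f \<zeta> * J \<zeta> \<partial>circle_measure)"
    using fint J_int E_int by (simp add: E)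
  also have "(\<integral>\<zeta>. radial_bv f \<zeta> \<partial>circle_measure) = atomic_moment f 0"
    by (simp add: atomic_moment_def L2_inner_def)
  finally show ?thesis unfolding J .
qed

section \<open>Uniqueness and existence of square roots\<close>

lemma cmod_atomic_inner_real:
  assumes "x < 1"
  shows "cmod (atomic_inner (of_real x)) = exp (- ((1 + x) / (1 - x)))"
proof -
  have "(complex_of_real x + 1) / (of_real x - 1) = of_real (- ((1 + x) / (1 - x)))"
    using assms by (simp add: divide_simps complex_eq_iff) (simp add: algebra_simps)
  then show ?thesis by (simp only: atomic_inner_def norm_exp_eq_Re Re_complex_of_real)
qed

text \<open>A linear rate, enough to separate the signs of the roots near 1 and to exclude
  \<open>a = 0\<close>. It comes from \<open>s\<^sup>2 / 2 \<le> exp s\<close> with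
  \<open>s = 1 / (1 - x)\<close>.\<close>

lemma cmod_atomic_inner_real_le:
  assumes "0 \<le> x" "x < 1"
  shows "cmod (atomic_inner (of_real x)) / (1 - x) \<le> 2 * (1 - x)"
proof -
  define s where "s = 1 / (1 - x)"
  have s: "0 < s" "1 - x = 1 / s" using assms by (simp_all add: s_def)
  have "s \<le> (1 + x) / (1 - x)" unfolding s_def using assms by (intro divide_right_mono) auto
  then have "cmod (atomic_inner (of_real x)) \<le> exp (- s)"
    using assms by (simp add: cmod_atomic_inner_real)
  also have "exp (- s) \<le> 2 / s\<^sup>2"
  proof -
    have "s\<^sup>2 / 2 \<le> exp s" using exp_lower_Taylor_quadratic[of s] s by simp
    then show ?thesis using s by (simp add: exp_minus field_simps)
  qed
  finally have "cmod (atomic_inner (of_real x)) * s \<le> 2 / s\<^sup>2 * s"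
    using s by (intro mult_right_mono) auto
  then show ?thesis using s by (simp add: power2_eq_square)
qed

text \<open>The denominator \<open>1 - x\<close> in \<open>small\<close> cancels against the factor
  in \<open>model_space_atomic_radius\<close>, so \<open>L\<close> below is at most
  \<open>\<bar>C\<bar> * exp (- X)\<close>. Passing from \<open>F\<close> to \<open>G\<close> trades
  the constant \<open>F 0\<close> for \<open>F 0 * exp (- (X - 1))\<close>; multiplied by
  \<open>exp X\<close>, both contributions stay bounded, as Mikusinski's lemma requires.\<close>

lemma model_space_atomic_small_imp_0:
  assumes f: "f \<in> model_space atomic_inner" and x0: "x0 < 1"
    and small: "\<And>x. x0 \<le> x \<Longrightarrow> 0 \<le> x \<Longrightarrow> x < 1 \<Longrightarrow> cmod (f (of_real x)) \<le> C * cmod (atomic_inner (of_real x)) / (1 - x)"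
  shows "f = (\<lambda>_. 0)"
proof -
  have f2: "f \<in> H2" by (rule atomic.model_space_H2[OF f])
  define F where "F = atomic_moment f"
  have F_cont: "continuous_on UNIV F" unfolding F_def by (rule continuous_atomic_moment[OF f2])
  define G where "G t = F t - F 0 * of_real (exp t)" for t
  have G_cont: "continuous_on UNIV G" unfolding G_def by (intro continuous_intros F_cont)
  have int_cont: "integrable unit_measure (\<lambda>t. of_real (exp (- (t * X))) * F t)" for X
  proof -
    have c: "continuous_on UNIV (\<lambda>t. of_real (exp (- (t * X))) * F t)"
      by (intro continuous_intros F_cont)
    obtain B where B: "\<And>t. t \<in> {0..1} \<Longrightarrow> cmod (of_real (exp (- (t * X))) * F t) \<le> B"
      using compact_imp_bounded[OF compact_continuous_image[OF continuous_on_subset[OF c] compact_Icc[of 0 1]]]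
      unfolding bounded_iff by blast
    show ?thesis
    proof (rule Bochner_Integration.integrable_bound)
      show "integrable unit_measure (\<lambda>_. B)" by simp
      show "AE t in unit_measure. norm (of_real (exp (- (t * X))) * F t) \<le> norm B"
        using AE_unit_measure_bounds
      proof eventually_elim
        case (elim t)
        then show ?case using B[of t] by (auto intro: order_trans[OF _ abs_ge_self])
      qed
      show "(\<lambda>t. of_real (exp (- (t * X))) * F t) \<in> borel_measurable unit_measure"
        using borel_measurable_continuous_onI[OF c] by simp
    qed
  qed
  \<comment> \<open>The first bound makes \<open>X - 1\<close> at least 1, so dividing by it does no
    harm. The second places the point \<open>x\<close> with \<open>(1 + x) / (1 - x) = X\<close> to
    the right of \<open>x0\<close>.\<close>
  obtain N :: nat where N: "2 \<le> N" "(1 + x0) / (1 - x0) \<le> real N"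
    using real_arch_simple[of "max 2 ((1 + x0) / (1 - x0))"] by (metis max.bounded_iff of_nat_le_iff of_nat_numeral)
  have bound: "cmod (\<integral>t. exp (real n * (1 - t)) *\<^sub>R G t \<partial>unit_measure) \<le> \<bar>C\<bar> + cmod (F 0) * exp 1" if n: "N \<le> n" for n
  proof -
    define X where "X = real n"
    have X: "2 \<le> X" "(1 + x0) / (1 - x0) \<le> X" using n N by (auto simp: X_def intro: order_trans)
    define x where "x = (X - 1) / (X + 1)"
    have x: "0 \<le> x" "x < 1" "(1 + x) / (1 - x) = X" "x0 \<le> x"
    proof -
      show "0 \<le> x" "x < 1" using X by (auto simp: x_def)
      show "(1 + x) / (1 - x) = X" using X by (simp add: x_def divide_simps)
      have "1 + x0 \<le> X * (1 - x0)" using X(2) x0 by (simp add: pos_divide_le_eq)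
      then show "x0 \<le> x" using X by (simp add: x_def field_simps)
    qed
    define L where "L = of_real (1 - x) * f (of_real x)"
    have L: "cmod L \<le> \<bar>C\<bar> * exp (- X)"
    proof -
      have "cmod L = (1 - x) * cmod (f (of_real x))" using x by (simp add: L_def norm_mult flip: of_real_diff)
      also have "\<dots> \<le> (1 - x) * (C * cmod (atomic_inner (of_real x)) / (1 - x))"
        using small x by (intro mult_left_mono) auto
      also have "\<dots> = C * exp (- X)" using x by (simp add: cmod_atomic_inner_real)
      also have "\<dots> \<le> \<bar>C\<bar> * exp (- X)" by (intro mult_right_mono) auto
      finally show ?thesis .
    qed
    define I where "I = (\<integral>t. of_real (exp (- (t * X))) * F t \<partial>unit_measure)"
    have LI: "L = F 0 - of_real (X - 1) * I"
      using model_space_atomic_radius[OF f, of X] X by (simp add: L_def x_def I_def F_def)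
    have e: "(\<integral>t. of_real (exp (- (t * X))) * (F 0 * of_real (exp t)) \<partial>unit_measure) =
        F 0 * ((1 - of_real (exp (- (X - 1)))) / of_real (X - 1))"
      and e_int: "integrable unit_measure (\<lambda>t. of_real (exp (- (t * X))) * (F 0 * of_real (exp t)))"
    proof -
      have eq: "of_real (exp (- (t * X))) * (F 0 * of_real (exp t)) = F 0 * exp (- (of_real t * complex_of_real (X - 1)))" for t
        by (simp add: exp_of_real[symmetric] exp_add[symmetric] algebra_simps)
      have "complex_of_real (X - 1) \<noteq> 0" using X by (simp add: complex_eq_iff)
      from integral_unit_measure_exp[OF this]
      show "(\<integral>t. of_real (exp (- (t * X))) * (F 0 * of_real (exp t)) \<partial>unit_measure) =
        F 0 * ((1 - of_real (exp (- (X - 1)))) / of_real (X - 1))"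
        unfolding eq by (simp flip: exp_of_real)
      show "integrable unit_measure (\<lambda>t. of_real (exp (- (t * X))) * (F 0 * of_real (exp t)))"
      proof (rule Bochner_Integration.integrable_bound)
        show "integrable unit_measure (\<lambda>_. cmod (F 0))" by simp
        show "AE t in unit_measure. norm (of_real (exp (- (t * X))) * (F 0 * of_real (exp t))) \<le> norm (cmod (F 0))"
          using AE_unit_measure_bounds
        proof eventually_elim
          case (elim t)
          have "exp (- (t * X)) * exp t = exp (- (t * (X - 1)))"
            by (simp add: exp_add[symmetric] algebra_simps)
          also have "\<dots> \<le> 1" using elim X by simp
          finally show ?case by (simp add: norm_mult mult.left_commute mult_left_le)
        qed
      qed measurable
    qed
    have "(\<integral>t. of_real (exp (- (t * X))) * G t \<partial>unit_measure) =
        I - F 0 * ((1 - of_real (exp (- (X - 1)))) / of_real (X - 1))"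
      unfolding G_def right_diff_distrib I_def e[symmetric]
      by (rule Bochner_Integration.integral_diff[OF int_cont e_int])
    also have "\<dots> = (F 0 * of_real (exp (- (X - 1))) - L) / of_real (X - 1)"
      using X by (simp add: LI field_simps)
    finally have IG: "(\<integral>t. of_real (exp (- (t * X))) * G t \<partial>unit_measure) = (F 0 * of_real (exp (- (X - 1))) - L) / of_real (X - 1)" .
    have "(\<integral>t. exp (real n * (1 - t)) *\<^sub>R G t \<partial>unit_measure) = of_real (exp X) * (\<integral>t. of_real (exp (- (t * X))) * G t \<partial>unit_measure)"
      by (subst integral_mult_right_zero[symmetric])
        (simp add: scaleR_conv_of_real X_def[symmetric] exp_of_real[symmetric] exp_add[symmetric] mult.assoc[symmetric] algebra_simps)
    then have "cmod (\<integral>t. exp (real n * (1 - t)) *\<^sub>R G t \<partial>unit_measure) = exp X * (cmod (F 0 * of_real (exp (- (X - 1))) - L) / (X - 1))"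
      using X by (simp add: IG norm_mult norm_divide flip: of_real_diff)
    also have "\<dots> \<le> exp X * cmod (F 0 * of_real (exp (- (X - 1))) - L)"
    proof (intro mult_left_mono)
      have "cmod (F 0 * of_real (exp (- (X - 1))) - L) / (X - 1) \<le> cmod (F 0 * of_real (exp (- (X - 1))) - L) / 1"
        using X by (intro divide_left_mono) auto
      then show "cmod (F 0 * of_real (exp (- (X - 1))) - L) / (X - 1) \<le> cmod (F 0 * of_real (exp (- (X - 1))) - L)" by simp
    qed simp
    also have "\<dots> \<le> exp X * (cmod (F 0) * exp (- (X - 1)) + \<bar>C\<bar> * exp (- X))"
      using L norm_triangle_ineq4[of "F 0 * of_real (exp (- (X - 1)))" L]
      by (intro mult_left_mono) (auto simp: norm_mult)
    also have "\<dots> = \<bar>C\<bar> + cmod (F 0) * exp 1"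
    proof -
      have "exp X * exp (- (X - 1)) = exp 1" "exp X * exp (- X) = 1"
        by (simp_all add: exp_add[symmetric])
      moreover have "exp X * (cmod (F 0) * exp (- (X - 1)) + \<bar>C\<bar> * exp (- X)) =
        cmod (F 0) * (exp X * exp (- (X - 1))) + \<bar>C\<bar> * (exp X * exp (- X))" by (simp only: ring_distribs mult_ac)
      ultimately show ?thesis by simp
    qed
    finally show ?thesis .
  qed
  have G0: "G t = 0" if "t \<in> {0..1}" for t
    by (rule exp_moments_bounded_imp_0[OF G_cont bound that])
  have "F 0 = 0"
    using G0[of 1] atomic_moment_1[OF f] by (simp add: G_def F_def)
  then have F0: "F t = 0" if "t \<in> {0..1}" for t
    using G0[OF that] by (simp add: G_def)
  have fx: "f (of_real x) = 0" if x: "0 \<le> x" "x < 1" for x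
  proof -
    define X where "X = (1 + x) / (1 - x)"
    have X: "1 \<le> X" "(X - 1) / (X + 1) = x" using x by (simp_all add: X_def divide_simps)
    have "(\<integral>t. of_real (exp (- (t * X))) * F t \<partial>unit_measure) = (\<integral>t. 0 \<partial>unit_measure)"
    proof (rule integral_cong_AE)
      show "AE t in unit_measure. of_real (exp (- (t * X))) * F t = 0"
        using AE_unit_measure_bounds by eventually_elim (simp add: F0)
    qed (use borel_measurable_integrable[OF int_cont] in auto)
    then show ?thesis
      using model_space_atomic_radius[OF f X(1)] F0[of 0] x by (simp add: X(2) F_def)
  qed
  show ?thesis
  proof
    fix z show "f z = 0"
    proof (cases "z \<in> ball 0 1")
      case True
      have lim: "0 islimpt (complex_of_real ` {0..<1})"
      proof -
        have "\<exists>y\<in>complex_of_real ` {0..<1}. y \<noteq> 0 \<and> dist y 0 < e" if "e > 0" for e :: real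
          using that by (intro bexI[of _ "of_real (min (1/2) (e/2))"]) auto
        then show ?thesis unfolding islimpt_approachable by blast
      qed
      show ?thesis
        by (rule analytic_continuation[OF H2_holomorphic[OF f2] open_ball connected_ball _ _ lim _ True])
          (use fx in auto)
    qed (rule H2_zero[OF f2])
  qed
qed

text \<open>At a zero, \<open>\<bar>sin y\<bar> \<le> \<bar>y\<bar>\<close> and
  \<open>exp (- Re w) < 1\<close> force \<open>Im w = 0\<close>; but for positive real
  \<open>u\<close> one has \<open>exp (- u) > 1 - u\<close>.\<close>

lemma exp_minus_plus_neq_0:
  assumes "0 < Re w"
  shows "w - 1 + exp (- w) \<noteq> 0"
proof
  assume "w - 1 + exp (- w) = 0"
  then have re: "Re w - 1 + exp (- Re w) * cos (Im w) = 0" and im: "Im w = exp (- Re w) * sin (Im w)"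
    by (auto simp: complex_eq_iff Re_exp Im_exp)
  have "Im w = 0"
  proof (rule ccontr)
    assume "Im w \<noteq> 0"
    have "\<bar>Im w\<bar> = exp (- Re w) * \<bar>sin (Im w)\<bar>" by (subst im) (simp add: abs_mult)
    also have "\<dots> \<le> exp (- Re w) * \<bar>Im w\<bar>" by (intro mult_left_mono abs_sin_x_le_abs_x) auto
    also have "\<dots> < 1 * \<bar>Im w\<bar>" using assms \<open>Im w \<noteq> 0\<close> by (intro mult_strict_right_mono) auto
    finally show False by simp
  qed
  with re have e: "exp (- Re w) = 1 - Re w" by simp
  then have "Re w < 1" using exp_gt_zero[of "- Re w"] by linarith
  \<comment> \<open>Squaring the tangent bound at half the argument makes the inequality strict: it
    would give \<open>1 - u + u\<^sup>2 / 4 \<le> 1 - u\<close> for \<open>u = Re w\<close>.\<close>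
  have "(1 - Re w / 2)\<^sup>2 \<le> (exp (- Re w / 2))\<^sup>2"
    using exp_ge_add_one_self[of "- Re w / 2"] \<open>Re w < 1\<close> by (intro power_mono) auto
  also have "\<dots> = exp (- Re w)" by (simp add: exp_double[symmetric])
  finally show False using e mult_pos_pos[OF assms assms] by (simp add: power2_eq_square algebra_simps)
qed

lemma shift_root_symbol:
  obtains \<psi> h where "\<psi> \<in> Hinf" "h \<in> Hinf" "\<And>z. z \<in> ball 0 1 \<Longrightarrow> (\<psi> z)\<^sup>2 = z + atomic_inner z * h z"
proof -
  \<comment> \<open>The symbol \<open>z\<close> alone has a simple zero at \<open>w = 1\<close> and
    so no square root. As \<open>h = 1 / (w + 1)\<close>, the numerator becomes
    \<open>w - 1 + exp (- w)\<close>, whose zero at \<open>w = 0\<close> is double and lies on the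
    boundary, at \<open>z = - 1\<close>.\<close>
  define h where "h z = (1 - z) / 2" for z :: complex
  have h_bd: "cmod (h z) \<le> 1" if "z \<in> ball 0 1" for z
    using norm_triangle_ineq4[of 1 z] that by (simp add: h_def norm_divide)
  have h: "h \<in> Hinf"
    by (rule HinfI[OF _ h_bd]) (auto simp: h_def[abs_def] intro!: holomorphic_intros)
  have ne: "z + atomic_inner z * h z \<noteq> 0" if z: "z \<in> ball 0 1" for z
  proof -
    have z1: "z \<noteq> 1" using z by auto
    define w where "w = - ((z + 1) / (z - 1))"
    have "0 < Re w" using Re_cayley_disc[of z] z by (simp add: w_def del: minus_divide_left minus_divide_right)
    then have "w - 1 + exp (- w) \<noteq> 0" by (rule exp_minus_plus_neq_0)
    moreover have "exp (- w) = atomic_inner z" by (simp add: w_def atomic_inner_def)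
    moreover have "w - 1 = 2 * z / (1 - z)" using z1 by (simp add: w_def divide_simps) (simp add: algebra_simps)
    ultimately have "2 * z / (1 - z) + atomic_inner z \<noteq> 0" by simp
    then show ?thesis using z1 by (simp add: h_def field_simps)
  qed
  have "(\<lambda>z. z + atomic_inner z * h z) holomorphic_on ball 0 1"
    by (intro holomorphic_intros Hinf_holomorphic atomic_inner_Hinf h)
  from contractible_imp_holomorphic_sqrt[OF this convex_imp_contractible[OF convex_ball] ne]
  obtain \<psi> where \<psi>: "\<psi> holomorphic_on ball 0 1" "\<And>z. z \<in> ball 0 1 \<Longrightarrow> z + atomic_inner z * h z = (\<psi> z)\<^sup>2"
    by blast
  have "\<psi> \<in> Hinf"
  proof (rule HinfI[OF \<psi>(1)])
    fix z :: complex assume z: "z \<in> ball 0 1"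
    have "(cmod (\<psi> z))\<^sup>2 = cmod (z + atomic_inner z * h z)" by (simp add: \<psi>(2)[OF z] norm_power)
    also have "\<dots> \<le> cmod z + cmod (atomic_inner z) * cmod (h z)"
      by (rule order_trans[OF norm_triangle_ineq]) (simp add: norm_mult)
    also have "\<dots> \<le> 1 + 1 * 1"
      using z h_bd[OF z] Re_cayley_disc[of z] by (intro add_mono mult_mono) (auto simp: atomic_inner_def)
    finally have "(cmod (\<psi> z))\<^sup>2 \<le> 2\<^sup>2" by simp
    then show "cmod (\<psi> z) \<le> 2" by (rule power2_le_imp_le) simp
  qed
  then show ?thesis by (rule that[OF _ h]) (simp add: \<psi>(2))
qed

section \<open>Two square roots agree up to sign\<close>

lemma continuous_nonzero_sign:
  fixes \<phi> :: "real \<Rightarrow> real"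
  assumes "continuous_on S \<phi>" "connected S" "\<And>x. x \<in> S \<Longrightarrow> \<phi> x \<noteq> 0"
  shows "(\<forall>x\<in>S. 0 < \<phi> x) \<or> (\<forall>x\<in>S. \<phi> x < 0)"
proof (rule ccontr)
  assume "\<not> ?thesis"
  then obtain x y where "x \<in> S" "y \<in> S" "\<phi> x \<le> 0" "0 \<le> \<phi> y" by (auto simp: not_less)
  moreover have "is_interval (\<phi> ` S)"
    using connected_continuous_image[OF assms(1,2)] by (simp add: is_interval_connected_1)
  ultimately have "0 \<in> \<phi> ` S" unfolding is_interval_1 by blast
  then show False using assms(3) by auto
qed

text \<open>In \<open>a\<^sup>2 - b\<^sup>2 = (a - b) * (a + b)\<close> one factor inherits the
  decay once the other is bounded below. Near 1 both squares are close to 1, so the real parts stay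
  away from 0, and the constant sign of their product decides which factor is small.\<close>

lemma square_root_pair:
  assumes A: "A \<in> bounded_ops atomic_inner"
      "compose (model_space atomic_inner) A A = compressed_shift atomic_inner"
    and B: "B \<in> bounded_ops atomic_inner"
      "compose (model_space atomic_inner) B B = compressed_shift atomic_inner"
  defines "a \<equiv> A atomic.kernel_zero" and "b \<equiv> B atomic.kernel_zero"
  shows "a = b \<or> a = (\<lambda>z. - b z)"
proof -
  have aK: "a \<in> model_space atomic_inner" and bK: "b \<in> model_space atomic_inner"
    unfolding a_def b_def
    using atomic.apply_kernel_zero[OF A] atomic.apply_kernel_zero[OF B] by auto
  obtain C where C: "\<And>z. cmod z < 1 \<Longrightarrow> cmod ((a z)\<^sup>2 - z) \<le> C * cmod (atomic_inner z) / (1 - cmod z)"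
    using atomic.square_root_kernel_estimate[OF A] unfolding a_def by blast
  obtain D where D: "\<And>z. cmod z < 1 \<Longrightarrow> cmod ((b z)\<^sup>2 - z) \<le> D * cmod (atomic_inner z) / (1 - cmod z)"
    using atomic.square_root_kernel_estimate[OF B] unfolding b_def by blast
  define M where "M = \<bar>C\<bar> + \<bar>D\<bar> + 1"
  have M: "0 < M" "\<bar>C\<bar> \<le> M" "\<bar>D\<bar> \<le> M" by (auto simp: M_def)
  \<comment> \<open>Chosen so that on \<open>[x0, 1)\<close> both
    \<open>\<bar>c(x)\<^sup>2 - x\<bar>\<close> and \<open>1 - x\<close> are at most 1/10, which
    adds up to the 1/5 in \<open>near1\<close>.\<close>
  define x0 where "x0 = max (9/10) (1 - 1 / (20 * M))"
  have x0: "x0 < 1" "9/10 \<le> x0" "0 \<le> x0" "2 * M * (1 - x0) \<le> 1/10"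
  proof -
    show "x0 < 1" "9/10 \<le> x0" "0 \<le> x0" using M by (auto simp: x0_def)
    have "1 - x0 \<le> 1 / (20 * M)" by (simp add: x0_def)
    then have "2 * M * (1 - x0) \<le> 2 * M * (1 / (20 * M))" using M by (intro mult_left_mono) auto
    then show "2 * M * (1 - x0) \<le> 1/10" using M by simp
  qed
  have near1: "cmod ((c (of_real x))\<^sup>2 - 1) \<le> 1/5"
    if c: "\<And>z. cmod z < 1 \<Longrightarrow> cmod ((c z)\<^sup>2 - z) \<le> K * cmod (atomic_inner z) / (1 - cmod z)"
      and K: "\<bar>K\<bar> \<le> M" and x: "x0 \<le> x" "x < 1" for c :: "complex \<Rightarrow> complex" and K x
  proof -
    have x': "0 \<le> x" "9/10 \<le> x" using x x0 by auto
    have "cmod ((c (of_real x))\<^sup>2 - of_real x) \<le> K * (cmod (atomic_inner (of_real x)) / (1 - x))"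
      using c[of "of_real x"] x x' by simp
    also have "\<dots> \<le> M * (2 * (1 - x))"
      using K M x x' cmod_atomic_inner_real_le[OF x'(1) x(2)] by (intro mult_mono) auto
    also have "\<dots> \<le> M * (2 * (1 - x0))" using M x by (intro mult_left_mono) auto
    also have "\<dots> \<le> 1/10" using x0(4) by (simp add: mult_ac)
    finally have "cmod ((c (of_real x))\<^sup>2 - of_real x) \<le> 1/10" .
    moreover have "cmod (complex_of_real x - 1) \<le> 1/10"
      using x x' norm_of_real[of "x - 1", where 'a = complex] by simp
    ultimately show ?thesis
      using norm_triangle_ineq[of "(c (of_real x))\<^sup>2 - of_real x" "of_real x - 1"] by simp
  qed
  \<comment> \<open>The real part of \<open>u\<^sup>2\<close> is at least 4/5, so
    \<open>(Re u)\<^sup>2 \<ge> 4/5 > 1/4\<close>. The value 1/2 is convenient because two such real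
    parts of equal sign add up to modulus at least 1.\<close>
  have Re_large: "1/2 \<le> \<bar>Re u\<bar>" if "cmod (u\<^sup>2 - 1) \<le> 1/5" for u
  proof (rule ccontr)
    assume "\<not> 1/2 \<le> \<bar>Re u\<bar>"
    then have "(Re u)\<^sup>2 < (1/2)\<^sup>2" by (intro power2_strict_mono) auto
    moreover have "\<bar>Re (u\<^sup>2 - 1)\<bar> \<le> 1/5" using abs_Re_le_cmod that by (rule order_trans)
    then have "\<bar>(Re u)\<^sup>2 - (Im u)\<^sup>2 - 1\<bar> \<le> 1/5" by (simp only: minus_complex.sel Re_power2 one_complex.sel)
    then have "4/5 \<le> (Re u)\<^sup>2 - (Im u)\<^sup>2" by linarith
    moreover have "(1/2)\<^sup>2 = (1/4::real)" by (simp add: power2_eq_square)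
    ultimately show False using zero_le_power2[of "Im u"] by linarith
  qed
  define \<phi> where "\<phi> x = Re (a (of_real x)) * Re (b (of_real x))" for x
  have S: "1/2 \<le> \<bar>Re (a (of_real x))\<bar>" "1/2 \<le> \<bar>Re (b (of_real x))\<bar>" if "x \<in> {x0..<1}" for x
    using that Re_large[OF near1[OF C M(2), of x]] Re_large[OF near1[OF D M(3), of x]] by auto
  have "continuous_on {x0..<1} \<phi>"
  proof -
    have cont: "continuous_on {x0..<1} (\<lambda>x. c (complex_of_real x))" if "c \<in> model_space atomic_inner" for c
      by (rule continuous_on_compose2[OF holomorphic_on_imp_continuous_on[OF H2_holomorphic[OF atomic.model_space_H2[OF that]]]])
        (use x0 in \<open>auto intro: continuous_intros\<close>)
    show ?thesis unfolding \<phi>_def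
      by (intro continuous_on_mult continuous_on_Re cont[OF aK] cont[OF bK])
  qed
  moreover have "\<phi> x \<noteq> 0" if "x \<in> {x0..<1}" for x
    using S[OF that] by (auto simp: \<phi>_def)
  moreover have "connected {x0..<1}" by simp
  ultimately consider "\<forall>x\<in>{x0..<1}. 0 < \<phi> x" | "\<forall>x\<in>{x0..<1}. \<phi> x < 0"
    using continuous_nonzero_sign by blast
  \<comment> \<open>Applied with \<open>u = a(x)\<close> and \<open>v = b(x)\<close> or
    \<open>v = - b(x)\<close>, whichever makes the product of the real parts positive.\<close>
  moreover have *: "cmod (u - v) \<le> (\<bar>C\<bar> + \<bar>D\<bar>) * cmod (atomic_inner (of_real x)) / (1 - x)"
    if uv: "u\<^sup>2 = (a (of_real x))\<^sup>2" "v\<^sup>2 = (b (of_real x))\<^sup>2" "1/2 \<le> \<bar>Re u\<bar>" "1/2 \<le> \<bar>Re v\<bar>" "0 < Re u * Re v"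
      and x: "0 \<le> x" "x < 1" for u v x
  proof -
    have "1 \<le> \<bar>Re (u + v)\<bar>" using uv(3-5) by (auto simp: zero_less_mult_iff)
    also have "\<dots> \<le> cmod (u + v)" by (rule abs_Re_le_cmod)
    finally have "cmod (u - v) * 1 \<le> cmod (u - v) * cmod (u + v)" by (intro mult_left_mono) auto
    also have "\<dots> = cmod ((a (of_real x))\<^sup>2 - (b (of_real x))\<^sup>2)"
      unfolding uv(1,2)[symmetric] by (simp add: norm_mult[symmetric] power2_eq_square algebra_simps)
    also have "\<dots> \<le> cmod ((a (of_real x))\<^sup>2 - of_real x) + cmod ((b (of_real x))\<^sup>2 - of_real x)"
      using norm_triangle_ineq4[of "(a (of_real x))\<^sup>2 - of_real x" "(b (of_real x))\<^sup>2 - of_real x"] by simp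
    also have "\<dots> \<le> C * cmod (atomic_inner (of_real x)) / (1 - x) + D * cmod (atomic_inner (of_real x)) / (1 - x)"
      using C[of "of_real x"] D[of "of_real x"] x by (intro add_mono) auto
    also have "\<dots> = (C + D) * (cmod (atomic_inner (of_real x)) / (1 - x))" by (simp add: algebra_simps add_divide_distrib)
    also have "\<dots> \<le> (\<bar>C\<bar> + \<bar>D\<bar>) * (cmod (atomic_inner (of_real x)) / (1 - x))"
      using x by (intro mult_right_mono) auto
    finally show ?thesis by simp
  qed
  ultimately show ?thesis
  proof cases
    case 1
    have "(\<lambda>z. a z - b z) = (\<lambda>_. 0)"
    proof (rule model_space_atomic_small_imp_0[OF atomic.model_space_diff[OF aK bK] x0(1)])
      fix x assume "x0 \<le> x" "0 \<le> x" "x < 1"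
      then show "cmod (a (of_real x) - b (of_real x)) \<le> (\<bar>C\<bar> + \<bar>D\<bar>) * cmod (atomic_inner (of_real x)) / (1 - x)"
        using S[of x] 1 by (intro *) (auto simp: \<phi>_def)
    qed
    then show ?thesis by (auto simp: fun_eq_iff)
  next
    case 2
    have "(\<lambda>z. a z + b z) = (\<lambda>_. 0)"
    proof (rule model_space_atomic_small_imp_0[OF atomic.model_space_add[OF aK bK] x0(1)])
      fix x assume "x0 \<le> x" "0 \<le> x" "x < 1"
      then have "cmod (a (of_real x) - (- b (of_real x))) \<le> (\<bar>C\<bar> + \<bar>D\<bar>) * cmod (atomic_inner (of_real x)) / (1 - x)"
        using S[of x] 2 by (intro *) (auto simp: \<phi>_def)
      then show "cmod (a (of_real x) + b (of_real x)) \<le> (\<bar>C\<bar> + \<bar>D\<bar>) * cmod (atomic_inner (of_real x)) / (1 - x)" by simp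
    qed
    then show ?thesis by (auto simp: fun_eq_iff eq_neg_iff_add_eq_0)
  qed
qed

text \<open>For \<open>a = 0\<close> the kernel estimate would bound \<open>x\<close> itself by a
  quantity tending to 0 as \<open>x\<close> tends to 1. This is what separates the two roots from
  each other.\<close>

lemma square_root_kernel_nonzero:
  assumes A: "A \<in> bounded_ops atomic_inner"
      "compose (model_space atomic_inner) A A = compressed_shift atomic_inner"
  shows "A atomic.kernel_zero \<noteq> (\<lambda>_. 0)"
proof
  assume 0: "A atomic.kernel_zero = (\<lambda>_. 0)"
  obtain C where C: "\<And>z. cmod z < 1 \<Longrightarrow> cmod ((A atomic.kernel_zero z)\<^sup>2 - z) \<le> C * cmod (atomic_inner z) / (1 - cmod z)"
    using atomic.square_root_kernel_estimate[OF A] by blast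
  \<comment> \<open>With \<open>D = \<bar>C\<bar> + 1\<close> the upper bound becomes
    \<open>2 * D / (2 * D + 2)\<close>, whereas
    \<open>x = (2 * D + 1) / (2 * D + 2)\<close>.\<close>
  define x where "x = 1 - 1 / (2 * (\<bar>C\<bar> + 1) + 2)"
  have x: "0 \<le> x" "x < 1" by (auto simp: x_def)
  have "x \<le> C * (cmod (atomic_inner (of_real x)) / (1 - x))"
    using C[of "of_real x"] x by (simp add: 0)
  also have "\<dots> \<le> (\<bar>C\<bar> + 1) * (2 * (1 - x))"
    using x cmod_atomic_inner_real_le[OF x] by (intro mult_mono) auto
  also have "\<dots> < x"
    by (simp add: x_def field_simps)
  finally show False by simp
qed

theorem theorem4p1:
  shows "(\<forall>A \<in> bounded_ops atomic_inner.
            compose (model_space atomic_inner) A A = compressed_shift atomic_inner \<longleftrightarrow>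
            (\<exists>\<psi>\<in>Hinf. (\<exists>h\<in>Hinf. \<forall>z\<in>ball 0 1. (\<psi> z)\<^sup>2 = z + atomic_inner z * h z) \<and>
                      A = model_mult atomic_inner \<psi>)) \<and>
         card {A \<in> bounded_ops atomic_inner.
            compose (model_space atomic_inner) A A = compressed_shift atomic_inner} = 2"
proof -
  let ?root = "\<lambda>A. A \<in> bounded_ops atomic_inner \<and>
    compose (model_space atomic_inner) A A = compressed_shift atomic_inner"
  let ?symbol = "\<lambda>\<psi>. \<exists>h\<in>Hinf. \<forall>z\<in>ball 0 1. (\<psi> z)\<^sup>2 = z + atomic_inner z * h z"
  have sym_root: "?root (model_mult atomic_inner \<psi>)" if "\<psi> \<in> Hinf" "?symbol \<psi>" for \<psi>
    using that atomic.model_mult_square atomic.model_mult_bounded_ops by blast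
  obtain \<psi> h where \<psi>: "\<psi> \<in> Hinf" "h \<in> Hinf" "\<And>z. z \<in> ball 0 1 \<Longrightarrow> (\<psi> z)\<^sup>2 = z + atomic_inner z * h z"
    using shift_root_symbol by metis
  have \<psi>s: "?symbol \<psi>" "?symbol (\<lambda>z. - \<psi> z)" using \<psi> by auto
  note m\<psi> = Hinf_uminus[OF \<psi>(1)]
  define P Q where "P = model_mult atomic_inner \<psi>" and "Q = model_mult atomic_inner (\<lambda>z. - \<psi> z)"
  have P: "?root P" unfolding P_def by (rule sym_root[OF \<psi>(1) \<psi>s(1)])
  have Q: "?root Q" unfolding Q_def by (rule sym_root[OF m\<psi> \<psi>s(2)])
  have QP: "Q atomic.kernel_zero = (\<lambda>z. - P atomic.kernel_zero z)"
    unfolding P_def Q_def by (rule atomic.model_mult_uminus[OF \<psi>(1) atomic.kernel_zero_model_space])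
  \<comment> \<open>\<open>square_root_pair\<close> leaves two possible values of \<open>A\<close>
    at \<open>kernel_zero\<close>; by \<open>QP\<close> these are the values of \<open>P\<close> and
    \<open>Q\<close>, and the value determines the root.\<close>
  have two: "A = P \<or> A = Q" if A: "?root A" for A
    using square_root_pair[of A P] A P Q
      atomic.square_root_determined[of A P] atomic.square_root_determined[of A Q]
    unfolding QP by blast
  have "P \<noteq> Q"
  proof
    assume "P = Q"
    then have "P atomic.kernel_zero z = - P atomic.kernel_zero z" for z using QP by (metis)
    then have "P atomic.kernel_zero = (\<lambda>_. 0)" by (simp add: fun_eq_iff)
    then show False using square_root_kernel_nonzero P by blast
  qed
  moreover have "{A. ?root A} = {P, Q}" using two P Q by blast
  ultimately have "card {A. ?root A} = 2" by simp
  moreover have "compose (model_space atomic_inner) A A = compressed_shift atomic_inner \<longleftrightarrow>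
      (\<exists>\<psi>\<in>Hinf. ?symbol \<psi> \<and> A = model_mult atomic_inner \<psi>)"
    if A: "A \<in> bounded_ops atomic_inner" for A
  proof
    assume "compose (model_space atomic_inner) A A = compressed_shift atomic_inner"
    with A have "A = P \<or> A = Q" by (intro two conjI)
    then show "\<exists>\<psi>\<in>Hinf. ?symbol \<psi> \<and> A = model_mult atomic_inner \<psi>"
    proof
      assume "A = P"
      with \<psi>s(1) have "?symbol \<psi> \<and> A = model_mult atomic_inner \<psi>" unfolding P_def by (rule conjI)
      then show ?thesis using \<psi>(1) by (rule bexI)
    next
      assume "A = Q"
      with \<psi>s(2) have "?symbol (\<lambda>z. - \<psi> z) \<and> A = model_mult atomic_inner (\<lambda>z. - \<psi> z)" unfolding Q_def by (rule conjI)
      then show ?thesis using m\<psi> by (rule bexI)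
    qed
  next
    assume "\<exists>\<psi>\<in>Hinf. ?symbol \<psi> \<and> A = model_mult atomic_inner \<psi>"
    then show "compose (model_space atomic_inner) A A = compressed_shift atomic_inner"
    proof (elim bexE[where P = "\<lambda>\<psi>. ?symbol \<psi> \<and> A = model_mult atomic_inner \<psi>"])
      fix \<phi> assume "\<phi> \<in> Hinf" and \<phi>: "?symbol \<phi> \<and> A = model_mult atomic_inner \<phi>"
      then have "?root (model_mult atomic_inner \<phi>)" by (intro sym_root conjunct1[OF \<phi>])
      then show ?thesis unfolding conjunct2[OF \<phi>] by (rule conjunct2)
    qed
  qed
  ultimately show ?thesis by (intro conjI ballI)
qed

end
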